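(* Let $d\ge2$. Suppose $G$ is a subgroup of $\Pi_d$, and $H_1,H_2\subset G$ are subgroups which do not act transitively on $\{1,\dots,d\}$, but the group generated by the elements of $H_1\cup H_2$ does act transitively. Then there are finite covers of Chamanara's surface $(S_2,\alpha_2)$ with monodromy in $G$ whose translation flow is uniquely ergodic, but whose orbit under $\phi$ accumulates only on surfaces in the collection of disconnected covers $$\Pi_d\backslash\big(\mathrm{Hom}(\Gamma,H_1)\cup\mathrm{Hom}(\Gamma,H_2)\big).$$ That is, there is $h\in\mathrm{Hom}(\Gamma,G)$ such that the translation flow on $(\tilde S_h,\tilde\alpha_h)$ is uniquely ergodic and every accumulation point of $[h\circ\phi_\beta^{-n}]$ as $n\to+\infty$ lies in this collection.
   Context: Chamanara's surface $(S_2,\alpha_2)$: take the closed unit square $[0,1]^2$ with the $1$-form $dz$. For each integer $k\ge1$ glue by translation the right-side interval $\{1\}\times[1-2^{-(k-1)},1-2^{-k}]$ to the left-side interval $\{0\}\times[2^{-k},2^{-(k-1)}]$; this is the vertical edge labeled $k$ (length $2^{-k}$). For each integer $k\ge0$ glue by translation the top interval $[1-2^{-k},1-2^{-k-1}]\times\{1\}$ to the bottom interval $[2^{-k-1},2^{-k}]\times\{0\}$; this is the horizontal edge labeled $-k$ (length $2^{-k-1}$). Discard the endpoints of all the intervals and the corners of the square. The translation flow is the horizontal unit speed rightward flow; it is uniquely ergodic if normalized Lebesgue measure is its only invariant Borel probability measure. Fix a basepoint $s_0$ in the interior of the square near its southwest corner. $\Gamma=\pi_1(S_2,s_0)$ is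 freely generated by $\{\gamma_n:n\in\mathbb Z\}$: for $n\le0$, $\gamma_n$ moves downward from $s_0$ through the horizontal edge labeled $n$ and returns to $s_0$ without crossing other labeled edges; for $n>0$, $\gamma_n$ moves rightward from $s_0$ across the vertical edge labeled $n$ and returns likewise. Products are concatenations with the left path traversed first. The surface has an affine automorphism $\phi:S_2\to S_2$ with derivative $\mathrm{diag}(1/2,2)$: the image $[0,\tfrac12]\times[0,2]$ of the square is placed in the surface by passing its upper half through the horizontal edge labeled $0$. Let $\beta$ be a curve from $\phi^{-1}(s_0)$ to $s_0$ inside the interior of the square, and let $\phi_\beta^{-1}:\Gamma\to\Gamma$ be the automorphism $[\gamma]\mapsto[\beta^{-1}\bullet(\phi^{-1}\circ\gamma)\bullet\beta]$. Explicitly, $\phi_\beta^{-1}(\gamma_n)=\gamma_{n+1}\gamma_1^{-1}$ for $n<0$, $\phi_\beta^{-1}(\gamma_0)=\gamma_1$, and $\phi_\beta^{-1}(\gamma_n)=\gamma_1\gamma_{n+1}$ for $n>0$. $\phi_\beta^{-n}$ denotes the $n$-th power of $\phi_\beta^{-1}$. The automorphism $\phi$ acts on covers by $[h]\mapsto[h\circ\phi_\beta^{-1}]$. $\Pi_d$ is the symmetric group on $\{1,\dots,d\}$. Each $h\in\mathrm{Hom}(\Gamma,G)$ is the monodromy homomorphism of a degree $d$ unbranched (possibly disconnected) cover $(\tilde S_h,\tilde\alpha_h)$, with pulled-back $1$-form, which depends up to isomorphism only on the $\Pi_d$-conjugacy class $[h]$. $\mathrm{Hom}(\Gamma,G)$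 has the topology of pointwise convergence. The space of covers with monodromy in $G$ is identified with $\Pi_d\backslash\mathrm{Hom}(\Gamma,G)$ ($\Pi_d$ acting by conjugation) with the quotient topology, and $\Pi_d\backslash(\mathrm{Hom}(\Gamma,H_1)\cup\mathrm{Hom}(\Gamma,H_2))$ denotes the image of $\mathrm{Hom}(\Gamma,H_1)\cup\mathrm{Hom}(\Gamma,H_2)$ in it. *)

theory Defs
  imports "HOL-Probability.Probability" "HOL-Algebra.Sym_Groups"
begin

section \<open>Quotient topologies and accumulation points of sequences\<close>

definition quotient_topology :: "'a topology \<Rightarrow> ('a \<Rightarrow> 'b) \<Rightarrow> 'b topology" where
  "quotient_topology X q =
     topology (\<lambda>U. U \<subseteq> q ` topspace X \<and> openin X {x \<in> topspace X. q x \<in> U})"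

lemma openin_quotient_topology:
  "openin (quotient_topology X q) U \<longleftrightarrow>
     U \<subseteq> q ` topspace X \<and> openin X {x \<in> topspace X. q x \<in> U}"
proof -
  have "istopology (\<lambda>U. U \<subseteq> q ` topspace X \<and> openin X {x \<in> topspace X. q x \<in> U})"
    unfolding istopology_def
  proof (intro conjI allI impI)
    fix S T
    assume S: "S \<subseteq> q ` topspace X \<and> openin X {x \<in> topspace X. q x \<in> S}"
      and T: "T \<subseteq> q ` topspace X \<and> openin X {x \<in> topspace X. q x \<in> T}"
    show "S \<inter> T \<subseteq> q ` topspace X" using S by blast
    have "{x \<in> topspace X. q x \<in> S \<inter> T} =
        {x \<in> topspace X. q x \<in> S} \<inter> {x \<in> topspace X. q x \<in> T}" by blast
    then show "openin X {x \<in> topspace X. q x \<in> S \<inter> T}" using S T by auto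
  next
    fix K
    assume K: "\<forall>S\<in>K. S \<subseteq> q ` topspace X \<and> openin X {x \<in> topspace X. q x \<in> S}"
    show "\<Union>K \<subseteq> q ` topspace X" using K by blast
    have "{x \<in> topspace X. q x \<in> \<Union>K} = (\<Union>S\<in>K. {x \<in> topspace X. q x \<in> S})" by blast
    then show "openin X {x \<in> topspace X. q x \<in> \<Union>K}" using K by auto
  qed
  then show ?thesis
    unfolding quotient_topology_def by (simp add: topology_inverse')
qed

lemma topspace_quotient_topology: "topspace (quotient_topology X q) = q ` topspace X"
proof (rule antisym)
  show "topspace (quotient_topology X q) \<subseteq> q ` topspace X"
    using openin_topspace[of "quotient_topology X q"] unfolding openin_quotient_topology by blast
  have "{x \<in> topspace X. q x \<in> q ` topspace X} = topspace X" by blast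
  then have "openin (quotient_topology X q) (q ` topspace X)"
    unfolding openin_quotient_topology by auto
  then show "q ` topspace X \<subseteq> topspace (quotient_topology X q)" by (rule openin_subset)
qed

lemma quotient_map_quotient_topology: "quotient_map X (quotient_topology X q) q"
  unfolding quotient_map_def topspace_quotient_topology openin_quotient_topology by blast

definition accumulation_point :: "'a topology \<Rightarrow> (nat \<Rightarrow> 'a) \<Rightarrow> 'a \<Rightarrow> bool" where
  "accumulation_point X s x \<longleftrightarrow>
     x \<in> topspace X \<and> (\<forall>U. openin X U \<and> x \<in> U \<longrightarrow> infinite {n. s n \<in> U})"


section \<open>The fundamental group, free on \<open>\<gamma>\<^sub>n\<close>, \<open>n \<in> \<int>\<close>\<close>

text \<open>Since the fundamental group of the surface is freely generated by the classes of the loops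
  \<open>\<gamma>\<^sub>n\<close>, it is modelled by the free group on these generators. Elements are
  reduced words in the letters \<open>\<gamma>\<^sub>n\<close>, encoded as \<open>(n, True)\<close>, and
  \<open>\<gamma>\<^sub>n\<inverse>\<close>, encoded as \<open>(n, False)\<close>. The leftmost letter of a word is the first piece of the path.\<close>

type_synonym letter = "int \<times> bool"

fun inv_letter :: "letter \<Rightarrow> letter" where
  "inv_letter (n, b) = (n, \<not> b)"

fun reduced :: "letter list \<Rightarrow> bool" where
  "reduced (x # y # w) \<longleftrightarrow> y \<noteq> inv_letter x \<and> reduced (y # w)"
| "reduced w \<longleftrightarrow> True"

fun push :: "letter \<Rightarrow> letter list \<Rightarrow> letter list" where
  "push x [] = [x]"
| "push x (y # w) = (if y = inv_letter x then w else x # y # w)"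

definition Gam :: "letter list monoid" where
  "Gam = \<lparr>carrier = {w. reduced w}, mult = (\<lambda>u v. foldr push u v), one = []\<rparr>"

definition gen :: "int \<Rightarrow> letter list" where
  "gen n = [(n, True)]"

lemma inv_letter_inv_letter [simp]: "inv_letter (inv_letter x) = x"
  by (cases x) simp

lemma inv_letter_neq [simp]: "inv_letter x \<noteq> x" "x \<noteq> inv_letter x"
  by (cases x; simp)+

lemma reduced_tl: "reduced (x # w) \<Longrightarrow> reduced w"
  by (cases w) auto

lemma reduced_push: "reduced w \<Longrightarrow> reduced (push x w)"
  by (cases w) (auto dest: reduced_tl)

lemma push_inv_letter: "reduced w \<Longrightarrow> push x (push (inv_letter x) w) = w"
proof (cases w)
  case (Cons y v)
  assume "reduced w"
  with Cons show ?thesis by (cases v) auto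
qed simp

lemma reduced_foldr_push: "reduced v \<Longrightarrow> reduced (foldr push u v)"
  by (induction u) (auto intro: reduced_push)

lemma foldr_push_push:
  "reduced v \<Longrightarrow> reduced w \<Longrightarrow> foldr push (push x v) w = push x (foldr push v w)"
proof (cases v)
  case (Cons y v')
  assume "reduced v" "reduced w"
  then show ?thesis
    using push_inv_letter[of "foldr push v' w" x] reduced_foldr_push[of w v'] Cons by auto
qed simp

lemma foldr_push_assoc:
  "reduced v \<Longrightarrow> reduced w \<Longrightarrow>
     foldr push (foldr push u v) w = foldr push u (foldr push v w)"
  by (induction u) (auto simp: foldr_push_push reduced_foldr_push)

lemma foldr_push_Nil: "reduced u \<Longrightarrow> foldr push u [] = u"
proof (induction u)
  case (Cons x u)
  then show ?case by (cases u) (auto dest: reduced_tl)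
qed simp

lemma foldr_push_inverse: "reduced w \<Longrightarrow> \<exists>v. reduced v \<and> foldr push v w = []"
proof (induction w)
  case Nil
  show ?case by (rule exI[of _ "[]"]) simp
next
  case (Cons x w)
  then obtain v where v: "reduced v" "foldr push v w = []" using reduced_tl by blast
  have w: "push (inv_letter x) (x # w) = w" by simp
  define u where "u = foldr push v [inv_letter x]"
  have "foldr push u (x # w) = foldr push v (foldr push [inv_letter x] (x # w))"
    unfolding u_def using Cons.prems by (intro foldr_push_assoc) auto
  also have "\<dots> = []" using v w by simp
  finally show ?case unfolding u_def by (metis reduced.simps(3) reduced_foldr_push)
qed

lemma group_Gam: "group Gam"
  by (rule groupI)
    (auto simp: Gam_def reduced_foldr_push foldr_push_assoc foldr_push_inverse)

lemma gen_in_Gam: "gen n \<in> carrier Gam"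
  by (simp add: gen_def Gam_def)


section \<open>The automorphism \<open>\<phi>\<^sub>\<beta>\<inverse>\<close>\<close>

text \<open>\<open>phi_gen n\<close> is the class of the loop \<open>\<beta>\<inverse> \<bullet> (\<phi>\<inverse> \<circ> \<gamma>\<^sub>n) \<bullet> \<beta>\<close>, where \<open>\<phi>\<close> is the affine automorphism
  with derivative \<open>diag (1/2, 2)\<close> and \<open>\<beta>\<close> joins \<open>\<phi>\<inverse> s\<^sub>0\<close> to the basepoint \<open>s\<^sub>0\<close> inside the square;
  \<open>phi_inv\<close> is its extension to a homomorphism (\<open>phi_inv_gen\<close> and \<open>phi_inv_hom\<close> below).\<close>

definition phi_gen :: "int \<Rightarrow> letter list" where
  "phi_gen n =
     (if n < 0 then gen (n + 1) \<otimes>\<^bsub>Gam\<^esub> inv\<^bsub>Gam\<^esub> (gen 1)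
      else if n = 0 then gen 1
      else gen 1 \<otimes>\<^bsub>Gam\<^esub> gen (n + 1))"

definition phi_letter :: "letter \<Rightarrow> letter list" where
  "phi_letter x = (if snd x then phi_gen (fst x) else inv\<^bsub>Gam\<^esub> (phi_gen (fst x)))"

definition phi_inv :: "letter list \<Rightarrow> letter list" where
  "phi_inv w = foldr (\<lambda>x v. phi_letter x \<otimes>\<^bsub>Gam\<^esub> v) w \<one>\<^bsub>Gam\<^esub>"

lemma phi_gen_in_Gam: "phi_gen n \<in> carrier Gam"
  by (auto simp: phi_gen_def intro!: monoid.m_closed group.is_monoid group_Gam
      group.inv_closed gen_in_Gam)

lemma phi_letter_in_Gam: "phi_letter x \<in> carrier Gam"
  by (auto simp: phi_letter_def intro!: group.inv_closed group_Gam phi_gen_in_Gam)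

lemma phi_inv_gen: "phi_inv (gen n) = phi_gen n"
  using phi_gen_in_Gam[of n] monoid.r_one[OF group.is_monoid[OF group_Gam]]
  by (simp add: phi_inv_def gen_def phi_letter_def)

lemma phi_inv_in_Gam: "phi_inv w \<in> carrier Gam"
  by (induction w)
    (auto simp: phi_inv_def phi_letter_in_Gam group_Gam group.is_monoid monoid.m_closed
      monoid.one_closed)

lemma phi_letter_inv_letter: "phi_letter x \<otimes>\<^bsub>Gam\<^esub> phi_letter (inv_letter x) = \<one>\<^bsub>Gam\<^esub>"
  by (cases x)
    (auto simp: phi_letter_def phi_gen_in_Gam group_Gam group.r_inv group.l_inv)

lemma phi_inv_push: "phi_inv (push x w) = phi_letter x \<otimes>\<^bsub>Gam\<^esub> phi_inv w"
proof (cases "\<exists>v. w = inv_letter x # v")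
  case True
  then obtain v where w: "w = inv_letter x # v" by blast
  interpret group Gam by (rule group_Gam)
  have "phi_letter x \<otimes>\<^bsub>Gam\<^esub> phi_inv w =
      (phi_letter x \<otimes>\<^bsub>Gam\<^esub> phi_letter (inv_letter x)) \<otimes>\<^bsub>Gam\<^esub> phi_inv v"
    using m_assoc phi_letter_in_Gam phi_inv_in_Gam[of v] by (simp add: w phi_inv_def)
  also have "\<dots> = phi_inv v"
    by (simp add: phi_letter_inv_letter phi_inv_in_Gam)
  finally show ?thesis by (simp add: w)
next
  case False
  then have "push x w = x # w" by (cases w) auto
  then show ?thesis by (simp add: phi_inv_def)
qed

lemma phi_inv_hom: "phi_inv \<in> hom Gam Gam"
proof (rule homI)
  interpret group Gam by (rule group_Gam)
  fix u v assume "u \<in> carrier Gam" "v \<in> carrier Gam"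
  have "phi_inv (foldr push u v) = phi_inv u \<otimes>\<^bsub>Gam\<^esub> phi_inv v"
  proof (induction u)
    case Nil
    show ?case using phi_inv_in_Gam[of v] by (simp add: phi_inv_def)
  next
    case (Cons x u)
    have "phi_inv (x # u) = phi_letter x \<otimes>\<^bsub>Gam\<^esub> phi_inv u" by (simp add: phi_inv_def)
    with Cons show ?case
      by (simp add: phi_inv_push m_assoc phi_letter_in_Gam phi_inv_in_Gam)
  qed
  then show "phi_inv (u \<otimes>\<^bsub>Gam\<^esub> v) = phi_inv u \<otimes>\<^bsub>Gam\<^esub> phi_inv v"
    by (simp add: Gam_def)
qed (rule phi_inv_in_Gam)


section \<open>The space of covers with monodromy in a subgroup of the symmetric group\<close>

definition acts_transitively :: "nat \<Rightarrow> (nat \<Rightarrow> nat) set \<Rightarrow> bool" where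
  "acts_transitively d H \<longleftrightarrow> (\<forall>i\<in>{1..d}. \<forall>j\<in>{1..d}. \<exists>p\<in>H. p i = j)"

definition Hom :: "nat \<Rightarrow> (nat \<Rightarrow> nat) set \<Rightarrow> (letter list \<Rightarrow> nat \<Rightarrow> nat) set" where
  "Hom d G = hom Gam (sym_group d \<lparr>carrier := G\<rparr>) \<inter> extensional (carrier Gam)"

definition Hom_topology ::
    "nat \<Rightarrow> (nat \<Rightarrow> nat) set \<Rightarrow> (letter list \<Rightarrow> nat \<Rightarrow> nat) topology" where
  "Hom_topology d G =
     subtopology (product_topology (\<lambda>_. discrete_topology G) (carrier Gam)) (Hom d G)"

text \<open>Conjugation by the full symmetric group need not preserve \<open>Hom d G\<close>; the class of \<open>h\<close> is
  the trace of its conjugacy class on \<open>Hom d G\<close>.\<close>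

definition cover_class ::
    "nat \<Rightarrow> (nat \<Rightarrow> nat) set \<Rightarrow> (letter list \<Rightarrow> nat \<Rightarrow> nat) \<Rightarrow> (letter list \<Rightarrow> nat \<Rightarrow> nat) set" where
  "cover_class d G h =
     {h' \<in> Hom d G. \<exists>s \<in> carrier (sym_group d). \<forall>g \<in> carrier Gam.
        h' g = s \<otimes>\<^bsub>sym_group d\<^esub> h g \<otimes>\<^bsub>sym_group d\<^esub> inv\<^bsub>sym_group d\<^esub> s}"

definition cover_space ::
    "nat \<Rightarrow> (nat \<Rightarrow> nat) set \<Rightarrow> (letter list \<Rightarrow> nat \<Rightarrow> nat) set topology" where
  "cover_space d G = quotient_topology (Hom_topology d G) (cover_class d G)"

definition phi_pullback ::
    "nat \<Rightarrow> (letter list \<Rightarrow> nat \<Rightarrow> nat) \<Rightarrow> letter list \<Rightarrow> nat \<Rightarrow> nat" where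
  "phi_pullback n h = restrict (h \<circ> (phi_inv ^^ n)) (carrier Gam)"


section \<open>Chamanara's surface and its finite covers\<close>

text \<open>The loop \<open>\<gamma>\<^sub>n\<close> leaves the square through \<open>exit_side n\<close> (on the right side of the square for
  \<open>n > 0\<close>, on its bottom side for \<open>n \<le> 0\<close>) and reenters it through \<open>entry_side n\<close>. The intervals
  are open because their endpoints are discarded.\<close>

definition exit_side :: "int \<Rightarrow> (real \<times> real) set" where
  "exit_side n =
     (if n > 0 then {1} \<times> {1 - 2 powi (1 - n) <..< 1 - 2 powi (- n)}
      else {2 powi (n - 1) <..< 2 powi n} \<times> {0})"

definition entry_side :: "int \<Rightarrow> (real \<times> real) set" where
  "entry_side n =
     (if n > 0 then {0} \<times> {2 powi (- n) <..< 2 powi (1 - n)}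
      else {1 - 2 powi n <..< 1 - 2 powi (n - 1)} \<times> {1})"

definition edge_translation :: "int \<Rightarrow> real \<times> real" where
  "edge_translation n =
     (if n > 0 then (- 1, 3 * 2 powi (- n) - 1) else (1 - 3 * 2 powi (n - 1), 1))"

lemma edge_translation_exit_side:
  "(\<lambda>p. p + edge_translation n) ` exit_side n = entry_side n"
proof -
  have e: "2 powi (1 - n) = 2 * (2 powi (- n) :: real)" "2 powi n = 2 * (2 powi (n - 1) :: real)"
    by (simp_all add: power_int_diff power_int_minus field_simps)
  show ?thesis
  proof (intro subset_antisym subsetI)
    fix q assume "q \<in> (\<lambda>p. p + edge_translation n) ` exit_side n"
    then show "q \<in> entry_side n"
      by (auto simp: exit_side_def entry_side_def edge_translation_def e split: if_splits)
  next
    fix q assume "q \<in> entry_side n"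
    then have "q - edge_translation n \<in> exit_side n"
      by (auto simp: exit_side_def entry_side_def edge_translation_def e split: if_splits)
    then show "q \<in> (\<lambda>p. p + edge_translation n) ` exit_side n"
      by (intro image_eqI[of _ _ "q - edge_translation n"]) auto
  qed
qed

definition punctured_square :: "(real \<times> real) set" where
  "punctured_square = {0<..<1} \<times> {0<..<1} \<union> (\<Union>n. exit_side n \<union> entry_side n)"

type_synonym sheet_point = "(real \<times> real) \<times> nat"

definition sheets :: "nat \<Rightarrow> sheet_point set" where
  "sheets d = punctured_square \<times> {1..d}"

text \<open>The lift of \<open>\<gamma>\<^sub>n\<close> starting in sheet \<open>h \<gamma>\<^sub>n j\<close> ends in sheet \<open>j\<close>. As \<open>sym_group d\<close> multiplies by
  composition of functions (right factor first) while the left factor of a product of loops is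
  traversed first, this is the convention under which the lift of every loop \<open>g\<close> starting in
  sheet \<open>h g j\<close> ends in sheet \<open>j\<close>, for a homomorphism \<open>h\<close>.\<close>

definition glued ::
    "nat \<Rightarrow> (letter list \<Rightarrow> nat \<Rightarrow> nat) \<Rightarrow> sheet_point \<Rightarrow> sheet_point \<Rightarrow> bool" where
  "glued d h a b \<longleftrightarrow>
     (\<exists>n. \<exists>p \<in> exit_side n. \<exists>j \<in> {1..d}. a = (p, h (gen n) j) \<and> b = (p + edge_translation n, j))"

definition cover_proj ::
    "nat \<Rightarrow> (letter list \<Rightarrow> nat \<Rightarrow> nat) \<Rightarrow> sheet_point \<Rightarrow> sheet_point set" where
  "cover_proj d h a = {b. equivclp (glued d h) a b}"

text \<open>The surface itself is the case \<open>d = 1\<close>.\<close>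

definition cover_surface ::
    "nat \<Rightarrow> (letter list \<Rightarrow> nat \<Rightarrow> nat) \<Rightarrow> sheet_point set topology" where
  "cover_surface d h = quotient_topology (top_of_set (sheets d)) (cover_proj d h)"

definition cover_borel ::
    "nat \<Rightarrow> (letter list \<Rightarrow> nat \<Rightarrow> nat) \<Rightarrow> sheet_point set measure" where
  "cover_borel d h =
     sigma (topspace (cover_surface d h)) {U. openin (cover_surface d h) U}"

text \<open>The sides of the square are null sets, so that pushing forward the measure of the \<open>d\<close>
  squares gives the area measure of the pulled-back 1-form, normalized to a probability measure.\<close>

definition normalized_lebesgue ::
    "nat \<Rightarrow> (letter list \<Rightarrow> nat \<Rightarrow> nat) \<Rightarrow> sheet_point set measure" where
  "normalized_lebesgue d h =
     distr (uniform_measure (restrict_space (lborel \<Otimes>\<^sub>M count_space UNIV) (sheets d)) (sheets d))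
       (cover_borel d h) (cover_proj d h)"


section \<open>The translation flow\<close>

text \<open>\<open>flows d h t u v\<close>: the unit speed rightward trajectory of \<open>u\<close> is defined up to time \<open>t \<ge> 0\<close>
  and is then at \<open>v\<close>. A trajectory over a finite time is a finite concatenation of horizontal
  segments of the squares (possibly contained in a horizontal edge); it passes from one square to
  another since points of vertical edges are identified by \<open>cover_proj\<close>.\<close>

inductive flows ::
    "nat \<Rightarrow> (letter list \<Rightarrow> nat \<Rightarrow> nat) \<Rightarrow> real \<Rightarrow> sheet_point set \<Rightarrow> sheet_point set \<Rightarrow> bool"
  for d h where
  segment: "0 \<le> t \<Longrightarrow> i \<in> {1..d} \<Longrightarrow> {x..x + t} \<times> {y} \<subseteq> punctured_square \<Longrightarrow>
     flows d h t (cover_proj d h ((x, y), i)) (cover_proj d h ((x + t, y), i))"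
| concat: "flows d h s u v \<Longrightarrow> flows d h t v w \<Longrightarrow> flows d h (s + t) u w"

text \<open>The preimage of \<open>A\<close> under the time \<open>t\<close> map, which is only partially defined: trajectories that
  run into discarded points die.\<close>

definition flow_preimage ::
    "nat \<Rightarrow> (letter list \<Rightarrow> nat \<Rightarrow> nat) \<Rightarrow> real \<Rightarrow> sheet_point set set \<Rightarrow> sheet_point set set" where
  "flow_preimage d h t A =
     {u \<in> topspace (cover_surface d h). \<exists>v\<in>A. if t \<ge> 0 then flows d h t u v else flows d h (- t) v u}"

text \<open>Taking for \<open>A\<close> the whole surface shows that trajectories with respect to an invariant
  probability measure are almost surely defined for all time.\<close>

definition flow_invariant ::
    "nat \<Rightarrow> (letter list \<Rightarrow> nat \<Rightarrow> nat) \<Rightarrow> sheet_point set measure \<Rightarrow> bool" where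
  "flow_invariant d h M \<longleftrightarrow>
     (\<forall>t. \<forall>A \<in> sets M. flow_preimage d h t A \<in> sets M \<and>
        emeasure M (flow_preimage d h t A) = emeasure M A)"

definition uniquely_ergodic :: "nat \<Rightarrow> (letter list \<Rightarrow> nat \<Rightarrow> nat) \<Rightarrow> bool" where
  "uniquely_ergodic d h \<longleftrightarrow>
     {M. space M = topspace (cover_surface d h) \<and> sets M = sets (cover_borel d h) \<and>
         prob_space M \<and> flow_invariant d h M} = {normalized_lebesgue d h}"

end

theory Submission
  imports Defs
begin

text \<open>The permutations \<open>a\<^sub>n = h (\<phi>\<^sub>\<beta>\<^sup>-\<^sup>n \<gamma>\<^sub>1)\<close> can be prescribed arbitrarily by the values of \<open>h\<close> on the positive
  generators. Let \<open>a\<^sub>n\<close> be trivial unless \<open>n\<close> is a square, and let it run periodically through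
  \<open>H1 \<union> H2\<close> along the squares. The restriction of \<open>h \<circ> \<phi>\<^sub>\<beta>\<^sup>-\<^sup>n\<close> to finitely many generators involves only
  the \<open>a\<^sub>l\<close> with \<open>l\<close> in a window of bounded length around \<open>n\<close>, which contains at most one
  square when \<open>n\<close> is large; so it takes values in \<open>H1\<close> or in \<open>H2\<close>.

  An invariant probability measure is determined by the transverse measures \<open>\<nu>\<^sub>j\<close> that it induces on
  the heights of the sheets \<open>j\<close>. The return map of the flow to the left sides of the squares is an
  extension of the dyadic odometer, and its first return map to the heights below \<open>1 / 2 ^ n\<close> is a copy
  of the return map of the cover \<open>h \<circ> \<phi>\<^sub>\<beta>\<^sup>-\<^sup>n\<close>. Hence \<open>u\<^sub>n(j) = 2 ^ n \<nu>\<^sub>j(0, 1 / 2 ^ n)\<close> satisfies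
  \<open>u\<^sub>n(j) = (u\<^sub>n\<^sub>+\<^sub>1(j) + u\<^sub>n\<^sub>+\<^sub>1(a\<^sub>n j)) / 2\<close>. As \<open>H1 \<union> H2\<close> generates a transitive group and
  each of its elements recurs, this averaging forces all \<open>u\<^sub>n\<close> to be the constant \<open>1 / d\<close>. Therefore
  \<open>\<nu>\<^sub>j\<close> is Lebesgue measure on dyadic intervals.\<close>

section \<open>The sides of the square\<close>

text \<open>Sparseness of the nontrivial permutations, which the accumulation points demand, does no
  harm to ergodicity: at a trivial permutation the recursion for u_n stands still, so only the
  number of averagings counts, not their density. The sum of u_n(j)^2 over j does not decrease in n
  and is bounded, so the discrepancies between the sheets compared at each averaging tend to 0 and
  u_n tends to a constant vector; since u_n is an average of u_(n+1), a bound at a late index then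
  holds at all earlier ones. Two obstacles shape the rest. Trajectories die at discarded points, so
  the time t maps are partial and invariance is used through preimages; an empty preimage is what
  shows that horizontal edges and dead heights carry no mass. Moreover the surface is a quotient, so
  images of planar Borel sets have to be shown Borel; this is done on one fundamental domain, the
  square with its left and top edges. Only times below 1, the width of the square, are analysed
  directly: in such a time at most one vertical edge is crossed, and longer times follow by
  iteration.\<close>

definition dyad :: "int \<Rightarrow> real set" where
  "dyad n = {2 powi (n - 1) <..< 2 powi n}"

lemma dyad_disjoint: "y \<in> dyad n \<Longrightarrow> y \<in> dyad m \<Longrightarrow> n = m"
proof (induction n m rule: linorder_wlog)
  case (le n m)
  show ?case
  proof (rule ccontr)
    assume "n \<noteq> m"
    then have "(2::real) powi n \<le> 2 powi (m - 1)"
      using le by (intro power_int_increasing) auto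
    then show False using le by (auto simp: dyad_def)
  qed
qed auto

lemma dyad_subset: "n \<le> 0 \<Longrightarrow> dyad n \<subseteq> {0<..<1}"
  using power_int_increasing[of n 0 "2::real"] zero_less_power_int[of "2::real" "n - 1"]
  unfolding dyad_def by (auto simp del: zero_less_power_int)

lemma dyad_cover:
  assumes "0 < y" "y < 1" "y \<notin> range (\<lambda>n::int. 2 powi n)"
  shows "\<exists>n\<le>0. y \<in> dyad n"
proof -
  \<comment> \<open>The least n with y \<le> 2^n; the excluded powers of 2 make this inequality
    strict.\<close>
  define n where "n = \<lceil>log 2 y\<rceil>"
  have y: "y = 2 powr (log 2 y)" using assms by simp
  have pw: "2 powi m = 2 powr real_of_int m" for m by (simp add: powr_real_of_int')
  have "y \<le> 2 powi n" unfolding pw by (subst y, intro powr_mono) (auto simp: n_def)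
  moreover have "2 powi (n - 1) < y"
    unfolding pw using assms(1) powr_less_mono[of "real_of_int (n - 1)" "log 2 y" 2] y
    by (simp add: n_def) linarith
  moreover have "log 2 y \<le> 0" using assms by simp
  then have "n \<le> 0" by (simp add: n_def)
  ultimately show ?thesis using assms(3) by (intro exI[of _ n]) (force simp: dyad_def)
qed

abbreviation open_square :: "(real \<times> real) set" where
  "open_square \<equiv> {0<..<1} \<times> {0<..<1}"

text \<open>One family of intervals serves all four sides: the reflection 1 - x exchanges the exit
  and the entry side of a label, and the vertical edge n > 0 has the length 2^-n of
  \<open>dyad (1 - n)\<close>.\<close>

lemma exit_side_iff:
  "(x, y) \<in> exit_side n \<longleftrightarrow> (if n > 0 then x = 1 \<and> 1 - y \<in> dyad (1 - n) else x \<in> dyad n \<and> y = 0)"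
  by (auto simp: exit_side_def dyad_def)

lemma entry_side_iff:
  "(x, y) \<in> entry_side n \<longleftrightarrow> (if n > 0 then x = 0 \<and> y \<in> dyad (1 - n) else 1 - x \<in> dyad n \<and> y = 1)"
  by (auto simp: entry_side_def dyad_def)

lemma dyad_bounds: "x \<in> dyad n \<Longrightarrow> n \<le> 0 \<Longrightarrow> 0 < x \<and> x < 1"
  using dyad_subset[of n] by auto

lemma exit_side_bounds:
  "(x, y) \<in> exit_side n \<Longrightarrow> (x = 1 \<and> 0 < y \<and> y < 1) \<or> (0 < x \<and> x < 1 \<and> y = 0)"
  using dyad_bounds[of "1 - y" "1 - n"] dyad_bounds[of x n] by (auto simp: exit_side_iff split: if_splits)

lemma entry_side_bounds:
  "(x, y) \<in> entry_side n \<Longrightarrow> (x = 0 \<and> 0 < y \<and> y < 1) \<or> (0 < x \<and> x < 1 \<and> y = 1)"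
  using dyad_bounds[of y "1 - n"] dyad_bounds[of "1 - x" n] by (auto simp: entry_side_iff split: if_splits)

lemma exit_side_inj: "p \<in> exit_side n \<Longrightarrow> p \<in> exit_side m \<Longrightarrow> n = m"
  using dyad_bounds[of "fst p" n] dyad_bounds[of "fst p" m] dyad_disjoint[of "1 - snd p" "1 - n" "1 - m"]
    dyad_disjoint[of "fst p" n m]
  by (cases p) (auto simp: exit_side_iff split: if_splits)

lemma entry_side_inj: "p \<in> entry_side n \<Longrightarrow> p \<in> entry_side m \<Longrightarrow> n = m"
  using dyad_bounds[of "1 - fst p" n] dyad_bounds[of "1 - fst p" m] dyad_disjoint[of "snd p" "1 - n" "1 - m"]
    dyad_disjoint[of "1 - fst p" n m]
  by (cases p) (auto simp: entry_side_iff split: if_splits)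

lemma exit_entry_side: "p \<in> exit_side n \<Longrightarrow> p \<notin> entry_side m"
  by (cases p) (auto dest!: exit_side_bounds entry_side_bounds)

lemma exit_side_not_square: "p \<in> exit_side n \<Longrightarrow> p \<notin> open_square"
  by (cases p) (auto dest!: exit_side_bounds)

lemma entry_side_not_square: "p \<in> entry_side n \<Longrightarrow> p \<notin> open_square"
  by (cases p) (auto dest!: entry_side_bounds)

text \<open>Every point of a cover has exactly one representative in a sheet over this set.\<close>

definition half_square :: "(real \<times> real) set" where
  "half_square = open_square \<union> (\<Union>n. entry_side n)"

lemma half_square_subset: "half_square \<subseteq> punctured_square"
  by (auto simp: half_square_def punctured_square_def)

lemma punctured_square_eq: "punctured_square = half_square \<union> (\<Union>n. exit_side n)"
  by (auto simp: half_square_def punctured_square_def)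

lemma translate_exit_side: "p \<in> exit_side n \<Longrightarrow> p + edge_translation n \<in> entry_side n"
  using edge_translation_exit_side[of n] by blast

lemma translate_entry_side: "p \<in> entry_side n \<Longrightarrow> p - edge_translation n \<in> exit_side n"
  using edge_translation_exit_side[of n] by force

lemma exit_half_square: "p \<in> exit_side n \<Longrightarrow> p \<notin> half_square"
  using exit_entry_side exit_side_not_square by (auto simp: half_square_def)

text \<open>The open strip spanned by an edge meets no other edge of the same side, and a bound on
  the other coordinate keeps it off the opposite side. Such strips isolate single edges, which is
  needed to see that edges are Borel in the quotient.\<close>

lemma open_exit_or_square:
  "\<exists>V. open V \<and> V \<inter> punctured_square \<subseteq> open_square \<union> exit_side n \<and> exit_side n \<subseteq> V"
proof (cases "n > 0")
  case True
  let ?V = "{p. fst p > 0 \<and> 1 - snd p > 2 powi (- n) \<and> 1 - snd p < (2::real) powi (1 - n)} :: (real \<times> real) set"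
  have "open ?V" by (intro open_Collect_conj open_Collect_less continuous_intros)
  moreover have "?V \<inter> punctured_square \<subseteq> open_square \<union> exit_side n"
  proof
    fix q assume q: "q \<in> ?V \<inter> punctured_square"
    obtain x y where [simp]: "q = (x, y)" by (cases q)
    have "1 - y \<in> dyad (1 - n)" "x > 0" using q by (auto simp: dyad_def)
    then have y: "0 < y" "y < 1" "1 - y \<in> dyad (1 - n)" "x > 0"
      using dyad_bounds[of "1 - y" "1 - n"] True by auto
    have "q \<in> open_square \<or> (\<exists>m. q \<in> exit_side m \<or> q \<in> entry_side m)" using q by (auto simp: punctured_square_def)
    then show "q \<in> open_square \<union> exit_side n"
    proof (elim disjE exE)
      fix m assume m: "q \<in> exit_side m"
      then have "m > 0" using y by (auto simp: exit_side_iff split: if_splits)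
      then have "x = 1" using m by (auto simp: exit_side_iff)
      then show ?thesis using y True by (auto simp: exit_side_iff)
    next
      fix m assume m: "q \<in> entry_side m"
      then show ?thesis using y entry_side_bounds by fastforce
    qed auto
  qed
  moreover have "exit_side n \<subseteq> ?V" using True by (auto simp: exit_side_def)
  ultimately show ?thesis by blast
next
  case False
  let ?V = "{p. snd p < 1 \<and> fst p > 2 powi (n - 1) \<and> fst p < (2::real) powi n} :: (real \<times> real) set"
  have "open ?V" by (intro open_Collect_conj open_Collect_less continuous_intros)
  moreover have "?V \<inter> punctured_square \<subseteq> open_square \<union> exit_side n"
  proof
    fix q assume q: "q \<in> ?V \<inter> punctured_square"
    obtain x y where [simp]: "q = (x, y)" by (cases q)
    have "x \<in> dyad n" "y < 1" using q by (auto simp: dyad_def)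
    then have y: "0 < x" "x < 1" "x \<in> dyad n" "y < 1"
      using dyad_bounds[of x n] False by auto
    have "q \<in> open_square \<or> (\<exists>m. q \<in> exit_side m \<or> q \<in> entry_side m)" using q by (auto simp: punctured_square_def)
    then show "q \<in> open_square \<union> exit_side n"
    proof (elim disjE exE)
      fix m assume m: "q \<in> exit_side m"
      then show ?thesis using y False by (auto simp: exit_side_iff split: if_splits)
    next
      fix m assume m: "q \<in> entry_side m"
      then show ?thesis using y entry_side_bounds by fastforce
    qed auto
  qed
  moreover have "exit_side n \<subseteq> ?V" using False by (auto simp: exit_side_def)
  ultimately show ?thesis by blast
qed

lemma open_entry_or_square:
  "\<exists>V. open V \<and> V \<inter> punctured_square \<subseteq> open_square \<union> entry_side n \<and> entry_side n \<subseteq> V"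
proof -
  \<comment> \<open>The half-turn of the square about its centre exchanges the two sides carrying the same label.\<close>
  have side: "(1, 1) - p \<in> exit_side m \<longleftrightarrow> p \<in> entry_side m" for p :: "real \<times> real" and m
    by (cases p) (auto simp: exit_side_iff entry_side_iff)
  have side': "(1, 1) - p \<in> entry_side m \<longleftrightarrow> p \<in> exit_side m" for p :: "real \<times> real" and m
    using side[of "(1, 1) - p" m] by simp
  have sq: "(1, 1) - p \<in> open_square \<longleftrightarrow> p \<in> open_square" for p :: "real \<times> real"
    by (cases p) auto
  have ps: "(1, 1) - p \<in> punctured_square \<longleftrightarrow> p \<in> punctured_square" for p :: "real \<times> real"
    by (simp only: punctured_square_def Un_iff UN_iff side side' sq) blast
  obtain V where V: "open V" "V \<inter> punctured_square \<subseteq> open_square \<union> exit_side n" "exit_side n \<subseteq> V"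
    using open_exit_or_square by blast
  let ?W = "(\<lambda>p. (1, 1) - p) -` V"
  have "open ?W" using V(1) by (intro open_vimage continuous_intros) auto
  moreover have "?W \<inter> punctured_square \<subseteq> open_square \<union> entry_side n"
  proof
    fix p assume "p \<in> ?W \<inter> punctured_square"
    then have "(1, 1) - p \<in> V \<inter> punctured_square" by (simp only: ps Int_iff vimage_eq)
    then have "(1, 1) - p \<in> open_square \<union> exit_side n" using V(2) by (rule rev_subsetD)
    then show "p \<in> open_square \<union> entry_side n" by (simp only: Un_iff sq side)
  qed
  moreover have "entry_side n \<subseteq> ?W" using V(3) side by (meson subsetI subset_iff vimageI2)
  ultimately show ?thesis by blast
qed

section \<open>Points and Borel sets of a cover\<close>

locale sheeted_cover =
  fixes d :: nat and h :: "letter list \<Rightarrow> nat \<Rightarrow> nat"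
  assumes d_pos: "0 < d"
    and perm: "h (gen n) permutes {1..d}"
begin

lemma perm_in: "h (gen n) i \<in> {1..d} \<longleftrightarrow> i \<in> {1..d}"
  using perm by (rule permutes_in_image)

lemma perm_inv_in: "inv' (h (gen n)) i \<in> {1..d} \<longleftrightarrow> i \<in> {1..d}"
  by (rule permutes_in_image[OF permutes_inv[OF perm]])

text \<open>Moves a point of an exit side across its edge into the fundamental domain. By the
  convention of \<open>glued\<close>, crossing edge n leads from sheet \<open>h (gen n) j\<close> to
  sheet j, hence the inverse permutation. The label n is determined because exit sides are
  disjoint.\<close>

definition base :: "sheet_point \<Rightarrow> sheet_point" where
  "base a =
     (if \<exists>n. fst a \<in> exit_side n
      then let n = THE n. fst a \<in> exit_side n
           in (fst a + edge_translation n, inv' (h (gen n)) (snd a))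
      else a)"

lemma base_exit:
  assumes "p \<in> exit_side n" shows "base (p, i) = (p + edge_translation n, inv' (h (gen n)) i)"
proof -
  have "(THE n. p \<in> exit_side n) = n" using assms exit_side_inj by blast
  then show ?thesis using assms by (auto simp: base_def)
qed

lemma base_half: "p \<in> half_square \<Longrightarrow> base (p, i) = (p, i)"
  using exit_half_square[of p] by (auto simp: base_def)

lemma entry_in_half: "p \<in> entry_side n \<Longrightarrow> p \<in> half_square"
  by (auto simp: half_square_def)

lemma base_glued:
  assumes "glued d h a b" shows "base a = base b"
proof -
  obtain n p j where *: "p \<in> exit_side n" "a = (p, h (gen n) j)" "b = (p + edge_translation n, j)"
    using assms unfolding glued_def by blast
  have "base a = (p + edge_translation n, j)"
    unfolding *(2) base_exit[OF *(1)] by (simp only: permutes_inverses(2)[OF perm])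
  also have "\<dots> = base b"
    unfolding *(3) by (rule base_half[OF entry_in_half[OF translate_exit_side[OF *(1)]], symmetric])
  finally show ?thesis .
qed

lemma base_equivclp: "equivclp (glued d h) a b \<Longrightarrow> base a = base b"
  by (induction rule: equivclp_induct) (metis base_glued)+

lemma equivclp_base:
  assumes "a \<in> sheets d" shows "equivclp (glued d h) a (base a)"
proof (cases "\<exists>n. fst a \<in> exit_side n")
  case True
  then obtain n where n: "fst a \<in> exit_side n" by blast
  have "a = (fst a, h (gen n) (inv' (h (gen n)) (snd a)))"
    by (simp add: permutes_inverses(1)[OF perm])
  moreover have "base a = (fst a + edge_translation n, inv' (h (gen n)) (snd a))"
    using base_exit[OF n, of "snd a"] by simp
  moreover have "inv' (h (gen n)) (snd a) \<in> {1..d}"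
    using assms perm_inv_in by (auto simp: sheets_def mem_Times_iff simp del: atLeastAtMost_iff)
  ultimately have "glued d h a (base a)" using n unfolding glued_def by blast
  then show ?thesis by auto
qed (auto simp: base_def)

text \<open>\<open>base\<close> is constant along gluings, and \<open>base a\<close> is itself
  equivalent to a, so it is a complete invariant of the classes.\<close>

lemma cover_proj_eq_iff:
  assumes "a \<in> sheets d" "b \<in> sheets d"
  shows "cover_proj d h a = cover_proj d h b \<longleftrightarrow> base a = base b"
proof
  assume eq: "cover_proj d h a = cover_proj d h b"
  have "b \<in> cover_proj d h b" unfolding cover_proj_def by simp
  then have "equivclp (glued d h) a b" unfolding eq[symmetric] by (simp add: cover_proj_def)
  then show "base a = base b" by (rule base_equivclp)
next
  assume "base a = base b"
  then have "equivclp (glued d h) a b"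
    using equivclp_base[OF assms(1)] equivclp_base[OF assms(2)]
    by (metis equivclp_sym equivclp_trans)
  then show "cover_proj d h a = cover_proj d h b"
    using equivp_evquivclp[of "glued d h"] unfolding cover_proj_def equivp_def by simp
qed

lemma base_in:
  assumes "a \<in> sheets d" shows "base a \<in> half_square \<times> {1..d}"
proof -
  obtain p i where a: "a = (p, i)" by (cases a)
  then have i: "i \<in> {1..d}" and p: "p \<in> half_square \<or> (\<exists>n. p \<in> exit_side n)"
    using assms by (auto simp: sheets_def punctured_square_eq)
  from p show ?thesis
  proof (elim disjE exE)
    fix n assume n: "p \<in> exit_side n"
    show ?thesis
      unfolding a base_exit[OF n]
      using entry_in_half[OF translate_exit_side[OF n]] i perm_inv_in by blast
  next
    assume "p \<in> half_square"
    then show ?thesis using a i by (simp add: base_half)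
  qed
qed

abbreviation emb :: "nat \<Rightarrow> real \<times> real \<Rightarrow> sheet_point set" where
  "emb i p \<equiv> cover_proj d h (p, i)"

abbreviation surface :: "sheet_point set set" where
  "surface \<equiv> topspace (cover_surface d h)"

lemma half_in_sheets: "p \<in> half_square \<Longrightarrow> i \<in> {1..d} \<Longrightarrow> (p, i) \<in> sheets d"
  using half_square_subset by (auto simp: sheets_def)

lemma emb_eq_iff:
  assumes "p \<in> half_square" "q \<in> half_square" "i \<in> {1..d}" "j \<in> {1..d}"
  shows "emb i p = emb j q \<longleftrightarrow> p = q \<and> i = j"
  using assms by (simp add: cover_proj_eq_iff half_in_sheets base_half)

lemma emb_base: "a \<in> sheets d \<Longrightarrow> cover_proj d h a = emb (snd (base a)) (fst (base a))"
  using base_in[of a] half_in_sheets[of "fst (base a)" "snd (base a)"] base_half[of "fst (base a)" "snd (base a)"]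
  by (subst cover_proj_eq_iff) (simp_all only: mem_Times_iff prod.collapse)

lemma emb_exit:
  assumes "p \<in> exit_side n" "j \<in> {1..d}"
  shows "emb (h (gen n) j) p = emb j (p + edge_translation n)"
proof -
  have "(p, h (gen n) j) \<in> sheets d" using assms perm_in by (auto simp: sheets_def punctured_square_def)
  then have "emb (h (gen n) j) p = emb (snd (base (p, h (gen n) j))) (fst (base (p, h (gen n) j)))"
    by (rule emb_base)
  then show ?thesis by (simp only: base_exit[OF assms(1)] permutes_inverses(2)[OF perm] fst_conv snd_conv)
qed

lemma topspace_surface: "surface = cover_proj d h ` sheets d"
  by (simp add: cover_surface_def topspace_quotient_topology)

lemma surfaceE:
  assumes "u \<in> surface"
  obtains i p where "i \<in> {1..d}" "p \<in> half_square" "u = emb i p"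
  using assms base_in emb_base unfolding topspace_surface by (metis imageE mem_Times_iff)

lemma emb_in_surface: "p \<in> half_square \<Longrightarrow> i \<in> {1..d} \<Longrightarrow> emb i p \<in> surface"
  by (auto simp: topspace_surface half_in_sheets)

section \<open>Open and Borel sets of the quotient\<close>

lemma openin_surface:
  "openin (cover_surface d h) U \<longleftrightarrow>
     U \<subseteq> surface \<and> (\<exists>T. open T \<and> {x \<in> sheets d. cover_proj d h x \<in> U} = T \<inter> sheets d)"
  unfolding cover_surface_def openin_quotient_topology topspace_quotient_topology openin_open
  by auto

text \<open>Nothing is glued to a point of the open square: if x were on an exit side,
  \<open>base x\<close> would lie on an entry side. So the preimage in the sheets is just the given
  open set in sheet i.\<close>

lemma openin_square:
  assumes "open V" "i \<in> {1..d}"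
  shows "openin (cover_surface d h) (emb i ` (V \<inter> open_square))"
proof -
  have sq: "open_square \<subseteq> half_square" by (auto simp: half_square_def)
  have "{x \<in> sheets d. cover_proj d h x \<in> emb i ` (V \<inter> open_square)} =
      ((V \<inter> open_square) \<times> {i}) \<inter> sheets d"
  proof (intro subset_antisym subsetI)
    fix x assume x: "x \<in> {x \<in> sheets d. cover_proj d h x \<in> emb i ` (V \<inter> open_square)}"
    then obtain p where p: "p \<in> V" "p \<in> open_square" "cover_proj d h x = emb i p" by blast
    then have b: "base x = (p, i)"
      using x assms sq by (subst (asm) cover_proj_eq_iff) (auto simp: half_in_sheets base_half simp del: mem_Times_iff)
    obtain q j where xq: "x = (q, j)" by (cases x)
    have "q \<in> half_square"
    proof (rule ccontr)
      assume "q \<notin> half_square"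
      then obtain n where n: "q \<in> exit_side n" using x xq by (auto simp: sheets_def punctured_square_eq)
      then show False
        using b p(2) entry_side_not_square translate_exit_side[OF n] base_exit[OF n] xq by auto
    qed
    then show "x \<in> ((V \<inter> open_square) \<times> {i}) \<inter> sheets d" using b p xq x by (auto simp: base_half)
  qed auto
  moreover have "open ((V \<inter> open_square) \<times> {i})"
    using assms by (intro open_Times open_Int) (auto simp: discrete_topology_class.open_discrete)
  ultimately show ?thesis
    unfolding openin_surface using sq assms by (blast intro: emb_in_surface)
qed

lemma sets_borelI: "openin (cover_surface d h) U \<Longrightarrow> U \<in> sets (cover_borel d h)"
  by (auto simp: cover_borel_def dest: openin_subset)

lemma space_cover_borel: "space (cover_borel d h) = surface"
  by (simp add: cover_borel_def space_measure_of_conv)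

text \<open>An edge is an open set minus two open sets. A neighbourhood of edge n in the quotient
  consists of a half-neighbourhood at the entry side in sheet i and one at the exit side in sheet
  \<open>h (gen n) i\<close>; removing their parts in the open squares leaves the edge.\<close>

lemma sets_emb_entry_side:
  assumes V: "open V" and i: "i \<in> {1..d}"
  shows "emb i ` (V \<inter> entry_side n) \<in> sets (cover_borel d h)"
proof -
  have sq: "open_square \<subseteq> half_square" by (auto simp: half_square_def)
  obtain E where E: "open E" "E \<inter> punctured_square \<subseteq> open_square \<union> entry_side n" "entry_side n \<subseteq> E"
    using open_entry_or_square by blast
  obtain W where W: "open W" "W \<inter> punctured_square \<subseteq> open_square \<union> exit_side n" "exit_side n \<subseteq> W"
    using open_exit_or_square by blast
  \<comment> \<open>The translation matches the two half-neighbourhoods: a point of the exit side is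
    kept only if its partner lies in V.\<close>
  define W' where "W' = W \<inter> (\<lambda>p. p + edge_translation n) -` V"
  have W': "open W'" unfolding W'_def using W V by (intro open_Int open_vimage continuous_intros) auto
  define k where "k = h (gen n) i"
  have k: "k \<in> {1..d}" using i perm_in by (simp add: k_def)
  define U where "U = emb i ` (V \<inter> E \<inter> half_square) \<union> emb k ` (W' \<inter> open_square)"
  have pre: "{x \<in> sheets d. cover_proj d h x \<in> U} = ((V \<inter> E) \<times> {i} \<union> W' \<times> {k}) \<inter> sheets d"
  proof (intro subset_antisym subsetI)
    fix x assume "x \<in> {x \<in> sheets d. cover_proj d h x \<in> U}"
    then have x: "x \<in> sheets d" and xU: "cover_proj d h x \<in> U" by auto
    obtain q j where xq: "x = (q, j)" by (cases x)
    from xU consider (1) p where "p \<in> V" "p \<in> E" "p \<in> half_square" "cover_proj d h x = emb i p"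
      | (2) p where "p \<in> W'" "p \<in> open_square" "cover_proj d h x = emb k p"
      unfolding U_def by blast
    then show "x \<in> ((V \<inter> E) \<times> {i} \<union> W' \<times> {k}) \<inter> sheets d"
    proof cases
      case 1
      then have b: "base x = (p, i)"
        using x i by (subst (asm) cover_proj_eq_iff) (auto simp: half_in_sheets base_half)
      show ?thesis
      proof (cases "q \<in> half_square")
        case True
        then show ?thesis using b 1 x xq by (auto simp: base_half)
      next
        case False
        then obtain m where m: "q \<in> exit_side m" using x xq by (auto simp: sheets_def punctured_square_eq)
        then have pm: "p \<in> entry_side m" "p = q + edge_translation m" "i = inv' (h (gen m)) j"
          using b translate_exit_side[OF m] base_exit[OF m] xq by auto
        have "p \<in> open_square \<union> entry_side n" using 1 E(2) half_square_subset by blast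
        then have "m = n" using pm(1) entry_side_not_square entry_side_inj by blast
        then have "q \<in> W'" using m W(3) 1 pm by (auto simp: W'_def)
        moreover have "j = k" using pm(3) \<open>m = n\<close> permutes_inverses(1)[OF perm] by (simp add: k_def)
        ultimately show ?thesis using x xq by auto
      qed
    next
      case 2
      then have b: "base x = (p, k)"
        using x k sq by (subst (asm) cover_proj_eq_iff) (auto simp: half_in_sheets base_half simp del: mem_Times_iff)
      have "q \<in> half_square"
      proof (rule ccontr)
        assume "q \<notin> half_square"
        then obtain n where n: "q \<in> exit_side n" using x xq by (auto simp: sheets_def punctured_square_eq)
        then show False
          using b 2(2) entry_side_not_square translate_exit_side[OF n] base_exit[OF n] xq by auto
      qed
      then show ?thesis using b 2 xq x by (auto simp: base_half)
    qed
  next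
    fix x assume xx: "x \<in> ((V \<inter> E) \<times> {i} \<union> W' \<times> {k}) \<inter> sheets d"
    obtain q j where xq: "x = (q, j)" by (cases x)
    have q: "q \<in> punctured_square" using xx xq by (auto simp: sheets_def)
    from xx xq consider (1) "q \<in> V" "q \<in> E" "j = i" | (2) "q \<in> W'" "j = k" by auto
    then have "cover_proj d h x \<in> U"
    proof cases
      case 1
      then have "q \<in> half_square" using E(2) q by (auto simp: half_square_def simp del: mem_Times_iff)
      then show ?thesis using 1 xq by (auto simp: U_def)
    next
      case 2
      then have "q \<in> open_square \<union> exit_side n" using W(2) q by (auto simp: W'_def simp del: mem_Times_iff)
      then show ?thesis
      proof
        assume e: "q \<in> exit_side n"
        then have t: "q + edge_translation n \<in> entry_side n" by (rule translate_exit_side)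
        have "cover_proj d h x = emb i (q + edge_translation n)"
          using emb_exit[OF e i] 2 xq by (simp add: k_def)
        moreover have "q + edge_translation n \<in> V \<inter> E \<inter> half_square"
          using t E(3) 2 entry_in_half by (auto simp: W'_def)
        ultimately show ?thesis unfolding U_def by blast
      qed (use 2 xq in \<open>auto simp: U_def\<close>)
    qed
    then show "x \<in> {x \<in> sheets d. cover_proj d h x \<in> U}" using xx by auto
  qed
  have "open ((V \<inter> E) \<times> {i} \<union> W' \<times> {k})"
    using V E W' by (intro open_Times open_Int open_Un) (auto simp: discrete_topology_class.open_discrete)
  moreover have "U \<subseteq> surface" unfolding U_def using i k sq emb_in_surface by blast
  ultimately have "openin (cover_surface d h) U" unfolding openin_surface using pre by blast
  then have "U - emb i ` ((V \<inter> E) \<inter> open_square) - emb k ` (W' \<inter> open_square) \<in> sets (cover_borel d h)"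
    using openin_square[of "V \<inter> E" i] openin_square[OF W' k] V E(1) i
    by (intro sets.Diff sets_borelI) auto
  also have "U - emb i ` ((V \<inter> E) \<inter> open_square) - emb k ` (W' \<inter> open_square) = emb i ` (V \<inter> entry_side n)"
  proof (intro subset_antisym subsetI)
    fix u assume u: "u \<in> U - emb i ` ((V \<inter> E) \<inter> open_square) - emb k ` (W' \<inter> open_square)"
    then obtain p where p: "p \<in> V \<inter> E \<inter> half_square" "u = emb i p" "p \<notin> open_square" by (auto simp: U_def)
    then have "p \<in> entry_side n" using E(2) half_square_subset by blast
    then show "u \<in> emb i ` (V \<inter> entry_side n)" using p by blast
  next
    fix u assume "u \<in> emb i ` (V \<inter> entry_side n)"
    then obtain p where p: "p \<in> V" "p \<in> entry_side n" "u = emb i p" by blast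
    have ph: "p \<in> half_square" "p \<notin> open_square" using p entry_in_half entry_side_not_square by blast+
    have "u \<in> U" using p ph E(3) by (auto simp: U_def)
    moreover have "emb i p \<noteq> emb l q" if "q \<in> open_square" "l \<in> {1..d}" for l q
      using ph that sq i emb_eq_iff[of p q i l] by blast
    ultimately show "u \<in> U - emb i ` ((V \<inter> E) \<inter> open_square) - emb k ` (W' \<inter> open_square)"
      using p(3) i k by blast
  qed
  finally show ?thesis .
qed

definition rep :: "sheet_point set \<Rightarrow> sheet_point" where
  "rep u = (SOME a. a \<in> half_square \<times> {1..d} \<and> cover_proj d h a = u)"

lemma rep_emb: "p \<in> half_square \<Longrightarrow> i \<in> {1..d} \<Longrightarrow> rep (emb i p) = (p, i)"
  unfolding rep_def by (rule some_equality) (auto simp: emb_eq_iff)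

lemma sets_emb_open:
  assumes "open V" "i \<in> {1..d}"
  shows "emb i ` (V \<inter> half_square) \<in> sets (cover_borel d h)"
proof -
  have "emb i ` (V \<inter> half_square) = emb i ` (V \<inter> open_square) \<union> (\<Union>n. emb i ` (V \<inter> entry_side n))"
    unfolding half_square_def by blast
  moreover have "emb i ` (V \<inter> open_square) \<in> sets (cover_borel d h)"
    using assms by (intro sets_borelI openin_square)
  moreover have "(\<Union>n. emb i ` (V \<inter> entry_side n)) \<in> sets (cover_borel d h)"
    using assms by (intro sets.countable_UN'' sets_emb_entry_side) auto
  ultimately show ?thesis by simp
qed

text \<open>The chart is injective on \<open>half_square\<close>, and its inverse
  \<open>fst \<circ> rep\<close> pulls open sets back to the Borel sets of
  \<open>sets_emb_open\<close>. It is therefore measurable, and its preimages of Borel sets are the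
  images in question.\<close>

lemma sets_emb:
  assumes "C \<in> sets borel" "i \<in> {1..d}"
  shows "emb i ` (C \<inter> half_square) \<in> sets (cover_borel d h)"
proof -
  let ?E = "emb i ` half_square"
  have E: "?E \<in> sets (cover_borel d h)" using sets_emb_open[of UNIV i] assms by auto
  then have Es: "?E \<inter> surface = ?E" "?E \<inter> space (cover_borel d h) = ?E"
    using sets.sets_into_space space_cover_borel by blast+
  have eq: "(fst \<circ> rep) -` S \<inter> ?E = emb i ` (S \<inter> half_square)" for S
    using assms(2) by (auto simp: rep_emb)
  have "fst \<circ> rep \<in> borel_measurable (restrict_space (cover_borel d h) ?E)"
  proof (rule borel_measurableI)
    fix S :: "(real \<times> real) set" assume "open S"
    then show "(fst \<circ> rep) -` S \<inter> space (restrict_space (cover_borel d h) ?E) \<in> sets (restrict_space (cover_borel d h) ?E)"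
      using E assms(2) sets_emb_open[of S i]
      by (subst sets_restrict_space_iff) (auto simp only: space_restrict_space Es eq)
  qed
  then have "(fst \<circ> rep) -` C \<inter> space (restrict_space (cover_borel d h) ?E) \<in> sets (restrict_space (cover_borel d h) ?E)"
    using assms(1) by (rule measurable_sets)
  then show ?thesis
    using E by (subst (asm) sets_restrict_space_iff) (auto simp only: space_restrict_space Es eq)
qed

lemma emb_measurable:
  assumes "i \<in> {1..d}"
  shows "emb i \<in> measurable (restrict_space borel punctured_square) (cover_borel d h)"
  unfolding cover_borel_def
proof (rule measurable_measure_of)
  show "{U. openin (cover_surface d h) U} \<subseteq> Pow surface" by (auto dest: openin_subset)
  show "emb i \<in> space (restrict_space borel punctured_square) \<rightarrow> surface"
    using assms by (auto simp: space_restrict_space topspace_surface sheets_def)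
  fix U assume "U \<in> {U. openin (cover_surface d h) U}"
  then obtain T where T: "open T" "{x \<in> sheets d. cover_proj d h x \<in> U} = T \<inter> sheets d"
    unfolding openin_surface by auto
  have "emb i -` U \<inter> punctured_square = (\<lambda>p. (p, i)) -` T \<inter> punctured_square"
    using T(2) assms unfolding set_eq_iff sheets_def by auto
  moreover have "open ((\<lambda>p :: real \<times> real. (p, i)) -` T)"
    using T(1) by (intro open_vimage continuous_intros) auto
  ultimately show "emb i -` U \<inter> space (restrict_space borel punctured_square) \<in> sets (restrict_space borel punctured_square)"
    by (auto simp: space_restrict_space sets_restrict_space)
qed

end

section \<open>The flow as a piecewise translation\<close>

text \<open>For \<open>0 \<le> t < 1\<close> the time \<open>t\<close> map of the flow is a piecewise translation. The piece
  \<open>None\<close> consists of the points that stay in their square, the piece \<open>Some n\<close> of those that cross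
  the vertical edge \<open>n\<close>.\<close>

fun piece_dom :: "real \<Rightarrow> int option \<Rightarrow> (real \<times> real) set" where
  "piece_dom t None = {p \<in> half_square. snd p < 1 \<and> fst p + t < 1} \<union>
     (\<Union>n. {p \<in> entry_side n. p + (t, 0) \<in> entry_side n})"
| "piece_dom t (Some n) = {p \<in> half_square. (1, snd p) \<in> exit_side n \<and> 1 \<le> fst p + t}"

fun piece_shift :: "real \<Rightarrow> int option \<Rightarrow> real \<times> real" where
  "piece_shift t None = (t, 0)"
| "piece_shift t (Some n) = (t, 0) + edge_translation n"

lemma half_square_iff:
  "(x, y) \<in> half_square \<longleftrightarrow> (0 < x \<and> x < 1 \<and> 0 < y \<and> y < 1) \<or> (\<exists>n. (x, y) \<in> entry_side n)"
  by (auto simp: half_square_def)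

lemma half_square_bounds:
  "(x, y) \<in> half_square \<Longrightarrow> 0 \<le> x \<and> x < 1 \<and> 0 < y \<and> y \<le> 1 \<and> (x = 0 \<longrightarrow> y < 1)"
  by (auto simp: half_square_iff dest!: entry_side_bounds)

lemma exit_right:
  assumes "(1, y) \<in> exit_side n"
  shows "n > 0" "edge_translation n = (- 1, snd (edge_translation n))"
    "0 < y" "y < 1" "(0, y + snd (edge_translation n)) \<in> entry_side n"
    "0 < y + snd (edge_translation n)" "y + snd (edge_translation n) < 1"
proof -
  show n: "n > 0" using assms dyad_bounds[of 1 n] by (auto simp: exit_side_iff split: if_splits)
  show e: "edge_translation n = (- 1, snd (edge_translation n))" using n by (simp add: edge_translation_def)
  show "0 < y" "y < 1" using exit_side_bounds[OF assms] by auto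
  have "(1, y) + edge_translation n = (0, y + snd (edge_translation n))" by (subst e) simp
  then show en: "(0, y + snd (edge_translation n)) \<in> entry_side n"
    using translate_exit_side[OF assms] by simp
  show "0 < y + snd (edge_translation n)" "y + snd (edge_translation n) < 1"
    using entry_side_bounds[OF en] by auto
qed

lemma square_or_zero:
  assumes "(x, y) \<in> half_square" "y < 1" "x \<le> x'" "x' < 1"
  shows "(x', y) \<in> half_square"
proof (cases "x' = x")
  case False
  then show ?thesis using assms half_square_bounds[OF assms(1)] by (auto simp: half_square_iff)
qed (use assms in simp)

lemma piece_dom_half: "p \<in> piece_dom t c \<Longrightarrow> p \<in> half_square"
  by (cases c) (auto simp: half_square_def)

lemma piece_image_half:
  assumes t: "0 \<le> t" "t < 1" and p: "p \<in> piece_dom t c"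
  shows "p + piece_shift t c \<in> half_square"
proof (cases c)
  case None
  obtain x y where p_eq: "p = (x, y)" by (cases p)
  from p None p_eq consider "(x, y) \<in> half_square" "y < 1" "x + t < 1"
    | n where "(x + t, y) \<in> entry_side n" by auto
  then show ?thesis
    using t None p_eq square_or_zero[of x y "x + t"] by cases (auto simp: half_square_iff)
next
  case (Some n)
  obtain x y where p_eq: "p = (x, y)" by (cases p)
  have e: "(1, y) \<in> exit_side n" "(x, y) \<in> half_square" "1 \<le> x + t" using p Some p_eq by auto
  note * = exit_right[OF e(1)]
  have sh: "p + piece_shift t c = (x + t - 1, y + snd (edge_translation n))"
    using *(2) by (simp add: Some p_eq prod_eq_iff)
  have "x < 1" using half_square_bounds[OF e(2)] by auto
  then have "x + t - 1 < 1" using t by simp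
  then show ?thesis unfolding sh
    using square_or_zero[of 0 "y + snd (edge_translation n)" "x + t - 1"] *(5,6,7) e(3)
    by (auto simp: half_square_iff)
qed

lemma entry_side_convex:
  assumes "(x, y) \<in> entry_side n" "(x', y) \<in> entry_side n" "x \<le> z" "z \<le> x'"
  shows "(z, y) \<in> entry_side n"
  using assms by (auto simp: entry_side_iff dyad_def split: if_splits)

text \<open>A segment running from one bottom edge into another contains the right endpoint 2^n of
  the first, and endpoints are discarded.\<close>

lemma punctured_line_exit:
  assumes "{x..x'} \<times> {0} \<subseteq> punctured_square" "x \<le> x'"
  shows "\<exists>n. (x, 0) \<in> exit_side n \<and> (x', 0) \<in> exit_side n"
proof -
  have ex: "\<exists>n\<le>0. z \<in> dyad n" if "z \<in> {x..x'}" for z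
  proof -
    have "(z, 0) \<in> punctured_square" using assms that by auto
    then obtain n where "(z, 0) \<in> exit_side n"
      by (auto simp: punctured_square_def dest: entry_side_bounds)
    then show ?thesis using dyad_bounds[of 1 "1 - n"]
      by (intro exI[of _ n]) (auto simp: exit_side_iff split: if_splits)
  qed
  obtain n where n: "n \<le> 0" "x \<in> dyad n" using ex[of x] assms(2) by auto
  obtain m where m: "m \<le> 0" "x' \<in> dyad m" using ex[of x'] assms(2) by auto
  have "n = m"
  proof (rule ccontr)
    assume "n \<noteq> m"
    moreover have "n \<le> m"
    proof (rule ccontr)
      assume "\<not> n \<le> m"
      then have "(2::real) powi m \<le> 2 powi (n - 1)" by (intro power_int_increasing) auto
      then show False using n m assms(2) by (auto simp: dyad_def)
    qed
    ultimately have "(2::real) powi n \<le> 2 powi (m - 1)" by (intro power_int_increasing) auto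
    then have "2 powi n \<in> {x..x'}" using n m by (auto simp: dyad_def)
    then obtain k where k: "2 powi n \<in> dyad k" using ex by blast
    have "k \<le> n \<or> n + 1 \<le> k" by linarith
    then show False
    proof
      assume "k \<le> n"
      then have "(2::real) powi k \<le> 2 powi n" by (intro power_int_increasing) auto
      then show False using k by (auto simp: dyad_def)
    next
      assume "n + 1 \<le> k"
      then have "(2::real) powi n \<le> 2 powi (k - 1)" by (intro power_int_increasing) auto
      then show False using k by (auto simp: dyad_def)
    qed
  qed
  then show ?thesis using n m by (intro exI[of _ n]) (simp add: exit_side_iff)
qed

section \<open>Trajectories of length below 1\<close>

context sheeted_cover
begin

text \<open>Pieces are indexed by the sheet of arrival j; the sheet of departure is then
  \<open>h (gen n) j\<close>, without an inverse, as in \<open>glued\<close>.\<close>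

fun piece_src :: "int option \<Rightarrow> nat \<Rightarrow> nat" where
  "piece_src None j = j"
| "piece_src (Some n) j = h (gen n) j"

lemma piece_src_in: "piece_src c j \<in> {1..d} \<longleftrightarrow> j \<in> {1..d}"
  by (cases c) (simp_all only: piece_src.simps perm_in)

lemma piece_src_inj: "piece_src c i = piece_src c j \<Longrightarrow> i = j"
  by (cases c) (auto dest: injD[OF permutes_inj[OF perm]])

definition piece_flow :: "real \<Rightarrow> sheet_point set \<Rightarrow> sheet_point set \<Rightarrow> bool" where
  "piece_flow t u v \<longleftrightarrow>
     (\<exists>c. \<exists>j\<in>{1..d}. \<exists>p\<in>piece_dom t c. u = emb (piece_src c j) p \<and> v = emb j (p + piece_shift t c))"

lemma piece_flowI:
  "p \<in> piece_dom t c \<Longrightarrow> j \<in> {1..d} \<Longrightarrow> u = emb (piece_src c j) p \<Longrightarrow>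
     v = emb j (p + piece_shift t c) \<Longrightarrow> piece_flow t u v"
  unfolding piece_flow_def by blast

lemma segment_piece_flow:
  assumes t: "0 \<le> t" "t < 1" and i: "i \<in> {1..d}" and seg: "{x..x + t} \<times> {y} \<subseteq> punctured_square"
  shows "piece_flow t (emb i (x, y)) (emb i (x + t, y))"
proof -
  have ends: "(x, y) \<in> punctured_square" "(x + t, y) \<in> punctured_square" using seg t by auto
  have bounds: "0 \<le> x \<and> x \<le> 1 \<and> 0 \<le> y \<and> y \<le> 1" if "(x, y) \<in> punctured_square" for x y
    using that by (auto simp: punctured_square_def dest!: entry_side_bounds exit_side_bounds)
  consider "y = 0" | "y = 1" | "0 < y" "y < 1" using bounds[OF ends(1)] by linarith
  then show ?thesis
  proof cases
    \<comment> \<open>Points of a bottom edge are represented by their translates on the top side;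
      motion along an edge is the second part of \<open>piece_dom t None\<close>.\<close>
    case 1
    then obtain n where n: "(x, 0) \<in> exit_side n" "(x + t, 0) \<in> exit_side n"
      using punctured_line_exit[of x "x + t"] seg t by auto
    define j where "j = inv' (h (gen n)) i"
    have j: "j \<in> {1..d}" using i perm_inv_in by (simp add: j_def del: atLeastAtMost_iff)
    have ij: "i = h (gen n) j" by (simp add: j_def permutes_inverses(1)[OF perm])
    let ?p = "(x, 0) + edge_translation n"
    have eq: "(x + t, 0) + edge_translation n = ?p + piece_shift t None" by (simp add: prod_eq_iff)
    have "?p \<in> entry_side n" "?p + (t, 0) \<in> entry_side n"
      using translate_exit_side[OF n(1)] translate_exit_side[OF n(2)] eq by simp_all
    then have "?p \<in> piece_dom t None" by auto
    then show ?thesis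
      by (rule piece_flowI[OF _ j]) (simp_all only: 1 ij emb_exit[OF n(1) j] emb_exit[OF n(2) j] eq piece_src.simps)
  next
    case 2
    have top: "\<exists>n\<le>0. 1 - z \<in> dyad n" if "z \<in> {x..x + t}" for z
    proof -
      have "(z, 1) \<in> punctured_square" using seg that 2 by auto
      then obtain n where "(z, 1) \<in> entry_side n"
        by (auto simp: punctured_square_def dest: exit_side_bounds)
      then show ?thesis using dyad_bounds[of 1 "1 - n"]
        by (intro exI[of _ n]) (auto simp: entry_side_iff split: if_splits)
    qed
    \<comment> \<open>The half-turn of the square makes the top segment a bottom one, to which
      \<open>punctured_line_exit\<close> applies.\<close>
    have "{1 - (x + t)..1 - x} \<times> {0} \<subseteq> punctured_square"
    proof
      fix q assume "q \<in> {1 - (x + t)..1 - x} \<times> {0::real}"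
      then have q: "q = (fst q, 0)" "1 - fst q \<in> {x..x + t}" by (auto simp: prod_eq_iff)
      then obtain n where "n \<le> 0" "fst q \<in> dyad n" using top[of "1 - fst q"] by auto
      then have "q \<in> exit_side n" by (subst q(1)) (auto simp: exit_side_iff)
      then show "q \<in> punctured_square" by (auto simp: punctured_square_def)
    qed
    then obtain n where n: "(1 - (x + t), 0) \<in> exit_side n" "(1 - x, 0) \<in> exit_side n"
      using punctured_line_exit[of "1 - (x + t)" "1 - x"] t by auto
    then have "(x, 1) \<in> entry_side n" "(x + t, 1) \<in> entry_side n"
      using dyad_bounds[of 1 "1 - n"] by (auto simp: entry_side_iff exit_side_iff split: if_splits)
    then have "(x, y) \<in> piece_dom t None" using 2 by auto
    then show ?thesis by (rule piece_flowI[OF _ i]) auto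
  next
    case 3
    have half: "(z, y) \<in> half_square" if "(z, y) \<in> punctured_square" "z < 1" for z
      using that 3 by (auto simp: punctured_square_eq dest!: exit_side_bounds)
    have exit: "\<exists>n. (1, y) \<in> exit_side n" if "(1, y) \<in> punctured_square"
      using that 3 by (auto simp: punctured_square_def dest!: entry_side_bounds)
    consider (a) "x + t < 1" | (b) "x + t = 1" using bounds[OF ends(2)] by linarith
    then show ?thesis
    proof cases
      case a
      then have "(x, y) \<in> piece_dom t None" using t 3 half[OF ends(1)] by auto
      then show ?thesis by (rule piece_flowI[OF _ i]) auto
    next
      \<comment> \<open>Arriving exactly on the right side counts as having crossed, because the end
        point is represented on the left side.\<close>
      case b
      then obtain n where n: "(1, y) \<in> exit_side n" using exit ends by auto
      define j where "j = inv' (h (gen n)) i"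
      have j: "j \<in> {1..d}" using i perm_inv_in by (simp add: j_def del: atLeastAtMost_iff)
      have ij: "i = h (gen n) j" by (simp add: j_def permutes_inverses(1)[OF perm])
      have e1: "emb i (1, y) = emb j ((1, y) + edge_translation n)"
        unfolding ij by (rule emb_exit[OF n j])
      show ?thesis
      proof (cases "x < 1")
        case True
        then have "(x, y) \<in> piece_dom t (Some n)" using n b half[OF ends(1)] by auto
        moreover have e2: "emb i (x + t, y) = emb j ((x, y) + piece_shift t (Some n))"
        proof -
          have "(x, y) + piece_shift t (Some n) = (x + t, y) + edge_translation n"
            by (simp add: prod_eq_iff)
          then show ?thesis by (simp only: b e1)
        qed
        ultimately show ?thesis
          by (intro piece_flowI[OF _ j, of "(x, y)" t "Some n"]) (simp_all only: ij[symmetric] piece_src.simps)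
      next
        case False
        then have x: "x = 1" "t = 0" using b t by auto
        have p: "(1, y) + edge_translation n \<in> entry_side n" using n by (rule translate_exit_side)
        then have "(1, y) + edge_translation n \<in> piece_dom 0 None"
          by (auto simp del: add_Pair simp add: zero_prod_def[symmetric])
        moreover have "(1, y) + edge_translation n + piece_shift 0 None = (1, y) + edge_translation n"
          by (simp add: prod_eq_iff)
        ultimately show ?thesis
          unfolding x using piece_flowI[OF _ j, of "(1, y) + edge_translation n" 0 None]
          by (simp only: piece_src.simps e1 add_0_right)
      qed
    qed
  qed
qed

text \<open>In total time below 1, the width of the square, at most one vertical edge is crossed:
  after a crossing the abscissa is x + s - 1, and the remaining time is too short to reach the right
  side again.\<close>

lemma piece_flow_add:
  assumes s: "0 \<le> s" "piece_flow s u v" and t: "0 \<le> t" "piece_flow t v w" and st: "s + t < 1"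
  shows "piece_flow (s + t) u w"
proof -
  obtain c i p where 1: "i \<in> {1..d}" "p \<in> piece_dom s c" "u = emb (piece_src c i) p" "v = emb i (p + piece_shift s c)"
    using s(2) unfolding piece_flow_def by blast
  obtain b j q where 2: "j \<in> {1..d}" "q \<in> piece_dom t b" "v = emb (piece_src b j) q" "w = emb j (q + piece_shift t b)"
    using t(2) unfolding piece_flow_def by blast
  have eq: "q = p + piece_shift s c" "i = piece_src b j"
    using emb_eq_iff[of "p + piece_shift s c" q i "piece_src b j"] 1 2 s t st
      piece_image_half[OF _ _ 1(2)] piece_dom_half[OF 2(2)] piece_src_in[of b j]
    by auto
  obtain x y where p_eq: "p = (x, y)" by (cases p)
  have xy: "(x, y) \<in> half_square" using piece_dom_half[OF 1(2)] p_eq by simp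
  note xyb = half_square_bounds[OF xy]
  show ?thesis
  proof (cases c)
    case None
    then have q: "q = (x + s, y)" using eq p_eq by simp
    show ?thesis
    proof (cases b)
      case None
      have "p \<in> piece_dom (s + t) None"
      proof (cases "y < 1")
        case True
        then have "x + s + t < 1 \<or> (\<exists>n. (x + s + t, y) \<in> entry_side n)"
          using 2(2) None q by auto
        then have "x + s + t < 1" using True by (auto dest!: entry_side_bounds)
        then show ?thesis using xy True p_eq by (auto simp: add.assoc)
      next
        \<comment> \<open>On the top side the intermediate point lies in the edges of both motions,
          so these edges agree.\<close>
        case False
        then obtain n m where "(x, y) \<in> entry_side n" "(x + s, y) \<in> entry_side n"
            "(x + s, y) \<in> entry_side m" "(x + s + t, y) \<in> entry_side m"
          using 1(2) 2(2) None \<open>c = None\<close> q p_eq by auto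
        moreover have "n = m" using calculation entry_side_inj by blast
        ultimately show ?thesis using p_eq by (auto simp: add.assoc)
      qed
      then show ?thesis
        by (rule piece_flowI[OF _ 2(1)])
          (use 1 2 eq None \<open>c = None\<close> in \<open>simp_all add: p_eq add.assoc\<close>)
    next
      case (Some m)
      have sh: "(x + s, y) + ((t, 0) + e) = (x, y) + ((s + t, 0) + e)" for e :: "real \<times> real"
        by (simp add: prod_eq_iff)
      have "p \<in> piece_dom (s + t) (Some m)" using Some 2(2) q xy p_eq by auto
      then show ?thesis
        by (rule piece_flowI[OF _ 2(1)])
          (use 1 2 eq None Some in \<open>simp_all add: p_eq sh\<close>)
    qed
  next
    case (Some n)
    then have e: "(1, y) \<in> exit_side n" "1 \<le> x + s" using 1(2) p_eq by auto
    note * = exit_right[OF e(1)]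
    have q: "q = (x + s - 1, y + snd (edge_translation n))"
      using eq(1) *(2) p_eq Some by (simp add: prod_eq_iff)
    have "b = None"
    proof (cases b)
      case (Some m)
      then show ?thesis using 2(2) q xyb st by auto
    qed
    have sh: "(x, y) + ((s, 0) + e) + (t, 0) = (x, y) + ((s + t, 0) + e)" for e :: "real \<times> real"
      by (simp add: prod_eq_iff)
    have "p \<in> piece_dom (s + t) (Some n)" using e xy p_eq t(1) by auto
    then show ?thesis
      by (intro piece_flowI[OF _ 2(1), of p "s + t" c u w])
        (use 1 2 eq Some \<open>b = None\<close> in \<open>simp_all add: p_eq sh\<close>)
  qed
qed

lemma flows_nonneg: "flows d h t u v \<Longrightarrow> 0 \<le> t"
  by (induction rule: flows.induct) auto

lemma flows_surface: "flows d h t u v \<Longrightarrow> u \<in> surface \<and> v \<in> surface"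
proof (induction rule: flows.induct)
  case (segment t i x y)
  then have "(x, y) \<in> punctured_square" "(x + t, y) \<in> punctured_square" by auto
  then show ?case using segment by (auto simp: topspace_surface sheets_def)
qed auto

lemma flows_imp_piece_flow: "flows d h t u v \<Longrightarrow> t < 1 \<Longrightarrow> piece_flow t u v"
proof (induction rule: flows.induct)
  case (segment t i x y)
  then show ?case by (intro segment_piece_flow)
next
  case (concat s u v t w)
  then show ?case using flows_nonneg[OF concat(1)] flows_nonneg[OF concat(2)]
    by (intro piece_flow_add) auto
qed

lemma piece_flow_imp_flows:
  assumes t: "0 \<le> t" "t < 1" and "piece_flow t u v"
  shows "flows d h t u v"
proof -
  obtain c j p where *: "j \<in> {1..d}" "p \<in> piece_dom t c" "u = emb (piece_src c j) p" "v = emb j (p + piece_shift t c)"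
    using assms unfolding piece_flow_def by blast
  obtain x y where p_eq: "p = (x, y)" by (cases p)
  show ?thesis
  proof (cases c)
    case None
    from *(2) None p_eq consider "(x, y) \<in> half_square" "y < 1" "x + t < 1"
      | n where "(x, y) \<in> entry_side n" "(x + t, y) \<in> entry_side n" by auto
    then have "(z, y) \<in> half_square" if "x \<le> z" "z \<le> x + t" for z
    proof cases
      case 1
      then show ?thesis using that by (intro square_or_zero[of x y z]) auto
    next
      case 2
      then show ?thesis using entry_side_convex[OF 2 that] by (auto simp: half_square_def)
    qed
    then have "{x..x + t} \<times> {y} \<subseteq> half_square" by auto
    then have "{x..x + t} \<times> {y} \<subseteq> punctured_square" using half_square_subset by blast
    then show ?thesis using flows.segment[OF t(1) *(1), of x y h] * None p_eq by simp
  next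
    case (Some n)
    then have e: "(1, y) \<in> exit_side n" "1 \<le> x + t" "(x, y) \<in> half_square" using *(2) p_eq by auto
    note ex = exit_right[OF e(1)]
    let ?z = "y + snd (edge_translation n)"
    have x: "0 \<le> x" "x < 1" using half_square_bounds[OF e(3)] by auto
    have hj: "h (gen n) j \<in> {1..d}" using *(1) perm_in by (simp del: atLeastAtMost_iff)
    have "(z, y) \<in> punctured_square" if "x \<le> z" "z \<le> 1" for z
    proof (cases "z = 1")
      case True
      then show ?thesis using e(1) by (auto simp: punctured_square_def)
    next
      case False
      then have "(z, y) \<in> half_square" using that by (intro square_or_zero[OF e(3) ex(4)]) auto
      then show ?thesis using half_square_subset by blast
    qed
    then have "{x..x + (1 - x)} \<times> {y} \<subseteq> punctured_square" by auto
    from flows.segment[OF _ hj this] x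
    have f1: "flows d h (1 - x) u (emb (h (gen n) j) (1, y))" unfolding *(3) Some p_eq by simp
    have "emb (h (gen n) j) (1, y) = emb j ((1, y) + edge_translation n)"
      by (rule emb_exit[OF e(1) *(1)])
    also have "(1, y) + edge_translation n = (0, ?z)" by (subst ex(2)) simp
    finally have f2: "emb (h (gen n) j) (1, y) = emb j (0, ?z)" .
    have "(0, ?z) \<in> half_square" using ex(5) by (auto simp: half_square_iff)
    then have "(z, ?z) \<in> half_square" if "0 \<le> z" "z \<le> x + t - 1" for z
      using that x t by (intro square_or_zero[OF _ ex(7) that(1)]) auto
    then have "{0..0 + (x + t - 1)} \<times> {?z} \<subseteq> punctured_square"
      using half_square_subset by auto
    from flows.segment[OF _ *(1) this] e(2)
    have f3: "flows d h (x + t - 1) (emb j (0, ?z)) (emb j (x + t - 1, ?z))" by simp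
    have "p + piece_shift t c = (x + t - 1, ?z)" using ex(2) by (simp add: Some p_eq prod_eq_iff)
    then show ?thesis using flows.concat[OF f1 f3[folded f2]] * by simp
  qed
qed

lemma flows_iff_piece_flow: "0 \<le> t \<Longrightarrow> t < 1 \<Longrightarrow> flows d h t u v \<longleftrightarrow> piece_flow t u v"
  using flows_imp_piece_flow piece_flow_imp_flows by blast

lemma flows_split:
  assumes "flows d h t u w" "0 \<le> s" "s \<le> t"
  shows "\<exists>v. flows d h s u v \<and> flows d h (t - s) v w"
  using assms
proof (induction arbitrary: s rule: flows.induct)
  case (segment t i x y)
  have "{x..x + s} \<times> {y} \<subseteq> punctured_square" "{x + s..(x + s) + (t - s)} \<times> {y} \<subseteq> punctured_square"
    using segment by (auto simp: subset_iff)
  from flows.segment[OF segment(4,2) this(1), of h] flows.segment[OF _ segment(2) this(2), of h] segment(5)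
  show ?case by (intro exI conjI) simp_all
next
  case (concat r u v t w)
  show ?case
  proof (cases "s \<le> r")
    case True
    then obtain v' where "flows d h s u v'" "flows d h (r - s) v' v" using concat by blast
    then show ?thesis using flows.concat[OF _ concat(2), of "r - s" v'] by (intro exI[of _ v']) (simp add: algebra_simps)
  next
    case False
    then have "0 \<le> s - r" "s - r \<le> t" using concat.prems by auto
    then obtain v' where v': "flows d h (s - r) v v'" "flows d h (t - (s - r)) v' w"
      using concat.IH(2) by blast
    then show ?thesis using flows.concat[OF concat(1) v'(1)] by (intro exI[of _ v']) (simp add: algebra_simps)
  qed
qed

lemma flows_add:
  assumes "0 \<le> s" "0 \<le> t"
  shows "flows d h (s + t) u w \<longleftrightarrow> (\<exists>v. flows d h s u v \<and> flows d h t v w)"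
  using flows_split[of "s + t" u w s] flows.concat[of d h s u _ t w] assms by force

text \<open>The time maps are partial, so only times of the same sign are composed: flowing forward
  and back loses the points whose trajectories die. This suffices to reduce invariance to short
  times.\<close>

lemma flow_preimage_add:
  assumes "0 \<le> s \<and> 0 \<le> t \<or> s < 0 \<and> t < 0"
  shows "flow_preimage d h (s + t) A = flow_preimage d h s (flow_preimage d h t A)"
  using assms
proof
  assume st: "0 \<le> s \<and> 0 \<le> t"
  then have "flow_preimage d h (s + t) A = {u \<in> surface. \<exists>w\<in>A. \<exists>v. flows d h s u v \<and> flows d h t v w}"
    by (simp add: flow_preimage_def flows_add)
  also have "\<dots> = flow_preimage d h s (flow_preimage d h t A)"
    using st flows_surface by (simp add: flow_preimage_def) blast
  finally show ?thesis .
next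
  assume st: "s < 0 \<and> t < 0"
  have "flows d h (- (s + t)) v u \<longleftrightarrow> (\<exists>z. flows d h (- t) v z \<and> flows d h (- s) z u)" for v u
    using flows_add[of "- t" "- s" v u] st by (simp add: add.commute)
  then have "flow_preimage d h (s + t) A = {u \<in> surface. \<exists>w\<in>A. \<exists>z. flows d h (- t) w z \<and> flows d h (- s) z u}"
    using st by (simp add: flow_preimage_def)
  also have "\<dots> = flow_preimage d h s (flow_preimage d h t A)"
    using st flows_surface by (simp add: flow_preimage_def) blast
  finally show ?thesis .
qed

end

section \<open>Invariance of the area\<close>

lemma null_sets_strips:
  assumes "countable N"
  shows "UNIV \<times> N \<in> null_sets (lborel :: (real \<times> real) measure)"
    and "N \<times> UNIV \<in> null_sets (lborel :: (real \<times> real) measure)"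
proof -
  have N: "N \<in> sets lborel" "emeasure lborel N = 0"
    using countable_imp_null_set_lborel[OF assms] by auto
  have "emeasure (lborel \<Otimes>\<^sub>M lborel) (UNIV \<times> N) = 0" "emeasure (lborel \<Otimes>\<^sub>M lborel) (N \<times> UNIV) = 0"
    using N by (subst lborel.emeasure_pair_measure_Times; simp)+
  moreover have "UNIV \<times> N \<in> sets (lborel \<Otimes>\<^sub>M lborel)" "N \<times> UNIV \<in> sets (lborel \<Otimes>\<^sub>M lborel)"
    using N by (auto intro!: pair_measureI)
  ultimately show "UNIV \<times> N \<in> null_sets (lborel :: (real \<times> real) measure)"
    and "N \<times> UNIV \<in> null_sets (lborel :: (real \<times> real) measure)"
    unfolding lborel_prod by auto
qed

lemma sets_exit_side: "exit_side n \<in> sets borel"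
  by (auto simp: exit_side_def intro!: borel_Times)

lemma sets_entry_side: "entry_side n \<in> sets borel"
  by (auto simp: entry_side_def intro!: borel_Times)

lemma sets_half_square: "half_square \<in> sets borel"
  unfolding half_square_def
  by (intro sets.Un sets.countable_UN'' sets_entry_side borel_Times) auto

lemma sets_punctured_square: "punctured_square \<in> sets borel"
  unfolding punctured_square_eq
  by (intro sets.Un sets.countable_UN'' sets_half_square sets_exit_side) auto

lemma emeasure_open_square: "emeasure lborel open_square = 1"
proof -
  have "emeasure (lborel \<Otimes>\<^sub>M lborel) ({0<..<1::real} \<times> {0<..<1::real}) = 1"
    by (subst lborel.emeasure_pair_measure_Times) auto
  then show ?thesis by (simp add: lborel_prod)
qed

lemma sides_null: "(\<Union>n. exit_side n) \<in> null_sets lborel" "(\<Union>n. entry_side n) \<in> null_sets lborel"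
proof -
  have N: "UNIV \<times> {0, 1} \<union> {0, 1} \<times> UNIV \<in> null_sets (lborel :: (real \<times> real) measure)"
    by (intro null_sets.Un null_sets_strips) auto
  show "(\<Union>n. exit_side n) \<in> null_sets lborel"
    by (rule null_sets_subset[OF N])
      (auto intro!: sets.countable_UN'' sets_exit_side dest!: exit_side_bounds)
  show "(\<Union>n. entry_side n) \<in> null_sets lborel"
    by (rule null_sets_subset[OF N])
      (auto intro!: sets.countable_UN'' sets_entry_side dest!: entry_side_bounds)
qed

lemma emeasure_punctured_square: "emeasure lborel punctured_square = 1"
proof -
  have "punctured_square = open_square \<union> ((\<Union>n. exit_side n) \<union> (\<Union>n. entry_side n))"
    by (auto simp: punctured_square_def)
  then show ?thesis
    using emeasure_Un_null_set[of open_square lborel "(\<Union>n. exit_side n) \<union> (\<Union>n. entry_side n)"]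
      sides_null by (simp add: emeasure_open_square null_sets.Un borel_Times)
qed

lemma sets_vimage_translate:
  fixes a :: "real \<times> real"
  assumes "S \<in> sets borel"
  shows "(\<lambda>p. p + a) -` S \<in> sets borel"
proof -
  have "(\<lambda>p. p + a) \<in> borel_measurable borel"
    by (intro borel_measurable_continuous_onI continuous_intros)
  from measurable_sets[OF this assms] show ?thesis by simp
qed

lemma emeasure_lborel_translate:
  fixes a :: "real \<times> real"
  assumes "S \<in> sets borel"
  shows "(\<lambda>p. p + a) ` S \<in> sets borel" "emeasure lborel ((\<lambda>p. p + a) ` S) = emeasure lborel S"
proof -
  have eq: "(\<lambda>p. p + a) ` S = (\<lambda>p. p + - a) -` S"
  proof (intro subset_antisym subsetI)
    fix x assume "x \<in> (\<lambda>p. p + - a) -` S"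
    then show "x \<in> (\<lambda>p. p + a) ` S" by (intro image_eqI[of _ _ "x + - a"]) simp_all
  next
    fix x assume "x \<in> (\<lambda>p. p + a) ` S"
    then obtain q where "q \<in> S" "x = q + a" by blast
    then show "x \<in> (\<lambda>p. p + - a) -` S" by simp
  qed
  show *: "(\<lambda>p. p + a) ` S \<in> sets borel" unfolding eq by (rule sets_vimage_translate[OF assms])
  have "emeasure lborel ((\<lambda>p. p + a) ` S) = emeasure (distr lborel borel ((+) a)) ((\<lambda>p. p + a) ` S)"
    by (simp add: lborel_distr_plus)
  also have "\<dots> = emeasure lborel ((+) a -` (\<lambda>p. p + a) ` S \<inter> space lborel)"
    using * by (intro emeasure_distr) auto
  also have "(+) a -` (\<lambda>p. p + a) ` S \<inter> space lborel = S"
    by (auto simp: image_iff add.commute[of a] simp del: add_Pair split_paired_Ex)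
  finally show "emeasure lborel ((\<lambda>p. p + a) ` S) = emeasure lborel S" .
qed

lemma sets_piece_dom: "piece_dom t c \<in> sets borel"
proof (cases c)
  case None
  have "{p \<in> entry_side n. p + (t, 0) \<in> entry_side n} =
      entry_side n \<inter> (\<lambda>p. p + (t, 0)) -` entry_side n" for n
    by (simp only: vimage_def Int_def mem_Collect_eq)
  then have 1: "{p \<in> entry_side n. p + (t, 0) \<in> entry_side n} \<in> sets borel" for n
    using sets.Int[OF sets_entry_side sets_vimage_translate[OF sets_entry_side]] by simp
  have "{p :: real \<times> real. snd p < 1 \<and> fst p + t < 1} \<in> sets borel"
    by (intro borel_open open_Collect_conj open_Collect_less continuous_intros)
  then have "half_square \<inter> {p. snd p < 1 \<and> fst p + t < 1} \<in> sets borel"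
    by (rule sets.Int[OF sets_half_square])
  then have 2: "{p \<in> half_square. snd p < 1 \<and> fst p + t < 1} \<in> sets borel"
    by (simp only: Int_def mem_Collect_eq)
  show ?thesis unfolding None piece_dom.simps
    by (intro sets.Un 2 sets.countable_UN'' 1) auto
next
  case (Some n)
  have "(\<lambda>p. (1, snd p)) -` exit_side n \<inter> space borel \<in> sets (borel :: (real \<times> real) measure)"
    using sets_exit_side by (intro measurable_sets[of _ borel borel])
      (auto intro!: borel_measurable_continuous_onI continuous_intros)
  moreover have "{p :: real \<times> real. 1 \<le> fst p + t} \<in> sets borel"
    by (intro borel_closed closed_Collect_le continuous_intros)
  ultimately have "half_square \<inter> ((\<lambda>p. (1, snd p)) -` exit_side n \<inter> space borel) \<inter> {p. 1 \<le> fst p + t} \<in> sets borel"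
    using sets_half_square by auto
  also have "half_square \<inter> ((\<lambda>p. (1, snd p)) -` exit_side n \<inter> space borel) \<inter> {p. 1 \<le> fst p + t} = piece_dom t c"
    unfolding Some piece_dom.simps by auto
  finally show ?thesis .
qed

lemma piece_dom_disjoint:
  assumes "p \<in> piece_dom t b" "p \<in> piece_dom t c"
  shows "b = c"
proof -
  obtain x y where p: "p = (x, y)" by (cases p)
  have *: "\<not> (p \<in> piece_dom t None \<and> p \<in> piece_dom t (Some n))" for n
    using exit_right[of y n] by (auto simp: p dest!: entry_side_bounds)
  show ?thesis
    using assms *  by (cases b; cases c) (auto dest: exit_side_inj)
qed

lemma piece_image_disjoint:
  assumes "0 \<le> t" "p \<in> piece_dom t b" "q \<in> piece_dom t c" "p + piece_shift t b = q + piece_shift t c"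
  shows "b = c"
proof -
  have *: False if "p \<in> piece_dom t None" "q \<in> piece_dom t (Some n)" "p + piece_shift t None = q + piece_shift t (Some n)"
    for p q n
  proof -
    have "fst p + t = fst q + (t - 1)"
      using arg_cong[OF that(3), of fst] that(2) exit_right(2)[of "snd q" n]
      by (cases "edge_translation n") auto
    moreover have "0 \<le> fst p" "fst q < 1"
      using half_square_bounds[of "fst p" "snd p"] half_square_bounds[of "fst q" "snd q"]
        piece_dom_half[OF that(1)] piece_dom_half[OF that(2)] by simp_all
    ultimately show False by simp
  qed
  show ?thesis
  proof (cases b)
    case None
    note b = None
    show ?thesis
    proof (cases c)
      case (Some m)
      have False by (rule *[OF assms(2)[unfolded b] assms(3)[unfolded Some] assms(4)[unfolded b Some]])
      then show ?thesis ..
    qed (simp add: b)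
  next
    case (Some n)
    note n = Some
    show ?thesis
    proof (cases c)
      case None
      have False by (rule *[OF assms(3)[unfolded None] assms(2)[unfolded n] assms(4)[symmetric, unfolded n None]])
      then show ?thesis ..
    next
      case (Some m)
      have e: "(1, snd p) \<in> exit_side n" "(1, snd q) \<in> exit_side m" using assms n Some by auto
      have "snd p + snd (edge_translation n) = snd q + snd (edge_translation m)"
        using arg_cong[OF assms(4), of snd] n Some by simp
      then have "n = m"
        using entry_side_inj[OF exit_right(5)[OF e(1)], of m] exit_right(5)[OF e(2)] by simp
      then show ?thesis using n Some by simp
    qed
  qed
qed

text \<open>1 is the height of the top side; the two families contain the endpoints of the left and
  of the right edges. A horizontal line in the square at any other height starts on a left edge and
  ends on a right edge. The bad heights are countable and so carry no area.\<close>

definition bad_heights :: "real set" where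
  "bad_heights = {1} \<union> range (\<lambda>n::int. 2 powi n) \<union> range (\<lambda>n::int. 1 - 2 powi n)"

lemma countable_bad_heights: "countable bad_heights"
  by (auto simp: bad_heights_def)

lemma dyad_edges:
  assumes "y \<notin> bad_heights" "0 < y" "y \<le> 1"
  shows "\<exists>n. (1, y) \<in> exit_side n" "\<exists>n. (0, y) \<in> entry_side n"
proof -
  have y: "y < 1" using assms by (auto simp: bad_heights_def)
  obtain n where "n \<le> 0" "y \<in> dyad n"
    using dyad_cover[of y] assms y by (auto simp: bad_heights_def)
  then show "\<exists>n. (0, y) \<in> entry_side n" by (intro exI[of _ "1 - n"]) (simp add: entry_side_iff)
  have "1 - y \<notin> range (\<lambda>n::int. 2 powi n)"
  proof
    assume "1 - y \<in> range (\<lambda>n::int. 2 powi n)"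
    then obtain n :: int where "1 - y = 2 powi n" by blast
    then have "y = 1 - 2 powi n" by simp
    then show False using assms(1) by (simp add: bad_heights_def)
  qed
  then obtain n where "n \<le> 0" "1 - y \<in> dyad n"
    using dyad_cover[of "1 - y"] assms y by auto
  then show "\<exists>n. (1, y) \<in> exit_side n" by (intro exI[of _ "1 - n"]) (simp add: exit_side_iff)
qed

lemma piece_dom_cover:
  assumes "p \<in> half_square" "snd p \<notin> bad_heights"
  shows "\<exists>c. p \<in> piece_dom t c"
proof -
  obtain x y where p: "p = (x, y)" by (cases p)
  have y: "0 < y" "y < 1" using assms half_square_bounds[of x y] by (auto simp: p bad_heights_def)
  show ?thesis
  proof (cases "x + t < 1")
    case True
    then show ?thesis using assms y by (intro exI[of _ None]) (simp add: p)
  next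
    case False
    obtain n where "(1, y) \<in> exit_side n" using dyad_edges(1)[of y] assms y by (auto simp: p)
    then show ?thesis using assms False by (intro exI[of _ "Some n"]) (simp add: p)
  qed
qed

lemma piece_image_cover:
  assumes t: "0 \<le> t" "t < 1" and q: "q \<in> half_square" "snd q \<notin> bad_heights"
  shows "\<exists>c. \<exists>p \<in> piece_dom t c. q = p + piece_shift t c"
proof -
  obtain x y where q_eq: "q = (x, y)" by (cases q)
  have xy: "0 < y" "y < 1" "0 \<le> x" "x < 1"
    using q half_square_bounds[of x y] by (auto simp: q_eq bad_heights_def)
  obtain n where n: "(0, y) \<in> entry_side n" using dyad_edges(2)[of y] q xy by (auto simp: q_eq)
  then have n0: "n > 0" using xy by (auto simp: entry_side_iff split: if_splits)
  then have e: "edge_translation n = (- 1, snd (edge_translation n))" by (simp add: edge_translation_def)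
  show ?thesis
  proof (cases "t \<le> x")
    case True
    have "(x - t, y) \<in> half_square"
      using square_or_zero[of 0 y "x - t"] n xy t True by (auto simp: half_square_iff)
    then have "(x - t, y) \<in> piece_dom t None" using xy by auto
    then show ?thesis by (intro exI[of _ None] bexI[of _ "(x - t, y)"]) (simp_all add: q_eq)
  next
    case False
    let ?z = "y - snd (edge_translation n)"
    have "(0, y) - edge_translation n = (1, ?z)" by (subst e) simp
    then have ex: "(1, ?z) \<in> exit_side n" using translate_entry_side[OF n] by simp
    have "(x + 1 - t, ?z) \<in> half_square"
      using exit_right(3,4)[OF ex] xy t False by (auto simp: half_square_iff)
    then have "(x + 1 - t, ?z) \<in> piece_dom t (Some n)" using ex xy by auto
    moreover have "q = (x + 1 - t, ?z) + piece_shift t (Some n)"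
      using arg_cong[OF e, of fst] by (simp add: q_eq prod_eq_iff)
    ultimately show ?thesis by blast
  qed
qed

section \<open>The area measure in terms of the sheets\<close>

context sheeted_cover
begin

abbreviation area :: "sheet_point set measure" where
  "area \<equiv> normalized_lebesgue d h"

definition sheet_part :: "nat \<Rightarrow> sheet_point set set \<Rightarrow> (real \<times> real) set" where
  "sheet_part i A = {p \<in> half_square. emb i p \<in> A}"

lemma sets_punctured_part:
  assumes "A \<in> sets (cover_borel d h)" "i \<in> {1..d}"
  shows "{p \<in> punctured_square. emb i p \<in> A} \<in> sets borel"
proof -
  have "emb i -` A \<inter> space (restrict_space borel punctured_square) \<in> sets (restrict_space borel punctured_square)"
    using emb_measurable[OF assms(2)] assms(1) by (rule measurable_sets)
  also have "emb i -` A \<inter> space (restrict_space borel punctured_square) = {p \<in> punctured_square. emb i p \<in> A}"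
    by (auto simp: space_restrict_space)
  finally show ?thesis using sets_punctured_square by (simp add: sets_restrict_space_iff)
qed

lemma sets_sheet_part:
  assumes "A \<in> sets (cover_borel d h)" "i \<in> {1..d}"
  shows "sheet_part i A \<in> sets borel"
proof -
  have "sheet_part i A = {p \<in> punctured_square. emb i p \<in> A} \<inter> half_square"
    using half_square_subset by (auto simp: sheet_part_def)
  then show ?thesis using sets_punctured_part[OF assms] sets_half_square by simp
qed

lemma sets_emb':
  "C \<in> sets borel \<Longrightarrow> C \<subseteq> half_square \<Longrightarrow> i \<in> {1..d} \<Longrightarrow> emb i ` C \<in> sets (cover_borel d h)"
  using sets_emb[of C i] by (simp add: Int_absorb2)

lemma surface_part_eq:
  assumes "A \<subseteq> surface" shows "A = (\<Union>i\<in>{1..d}. emb i ` sheet_part i A)"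
proof (intro subset_antisym subsetI)
  fix u assume u: "u \<in> A"
  then obtain i p where "i \<in> {1..d}" "p \<in> half_square" "u = emb i p"
    using surfaceE assms by blast
  then show "u \<in> (\<Union>i\<in>{1..d}. emb i ` sheet_part i A)" using u unfolding sheet_part_def by blast
qed (auto simp: sheet_part_def)

abbreviation sheet_measure :: "sheet_point measure" where
  "sheet_measure \<equiv> lborel \<Otimes>\<^sub>M count_space UNIV"

lemma emeasure_sheet_Times:
  assumes "C \<in> sets borel"
  shows "C \<times> J \<in> sets sheet_measure"
    "emeasure sheet_measure (C \<times> J) = emeasure lborel C * emeasure (count_space UNIV) J"
proof -
  interpret sigma_finite_measure "count_space (UNIV :: nat set)"
    by (rule sigma_finite_measure_count_space_countable) auto
  show "C \<times> J \<in> sets sheet_measure" using assms by (intro pair_measureI) auto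
  show "emeasure sheet_measure (C \<times> J) = emeasure lborel C * emeasure (count_space UNIV) J"
    using assms by (intro emeasure_pair_measure_Times) auto
qed

lemma sets_sheets: "sheets d \<in> sets sheet_measure"
  unfolding sheets_def by (intro emeasure_sheet_Times sets_punctured_square)

lemma emeasure_sheets: "emeasure sheet_measure (sheets d) = of_nat d"
  unfolding sheets_def
  by (subst emeasure_sheet_Times(2)[OF sets_punctured_square])
    (simp add: emeasure_punctured_square emeasure_count_space)

lemma cover_proj_measurable:
  "cover_proj d h \<in> measurable (restrict_space sheet_measure (sheets d)) (cover_borel d h)"
proof (rule measurableI)
  fix x assume "x \<in> space (restrict_space sheet_measure (sheets d))"
  then show "cover_proj d h x \<in> space (cover_borel d h)"
    by (auto simp: space_restrict_space space_cover_borel topspace_surface)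
next
  fix A assume A: "A \<in> sets (cover_borel d h)"
  have "(\<Union>i\<in>{1..d}. {p \<in> punctured_square. emb i p \<in> A} \<times> {i}) \<in> sets sheet_measure"
    using A by (intro sets.finite_UN emeasure_sheet_Times sets_punctured_part) auto
  also have "(\<Union>i\<in>{1..d}. {p \<in> punctured_square. emb i p \<in> A} \<times> {i}) = cover_proj d h -` A \<inter> sheets d"
    by (auto simp: sheets_def)
  finally show "cover_proj d h -` A \<inter> space (restrict_space sheet_measure (sheets d))
      \<in> sets (restrict_space sheet_measure (sheets d))"
    using sets_sheets by (simp add: sets_restrict_space_iff space_restrict_space space_pair_measure)
qed

lemma sets_area: "sets area = sets (cover_borel d h)"
  by (simp add: normalized_lebesgue_def)

lemma space_area: "space area = surface"
  by (simp add: normalized_lebesgue_def space_cover_borel)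

lemma emeasure_area:
  assumes A: "A \<in> sets (cover_borel d h)"
  shows "emeasure area A = emeasure sheet_measure {x \<in> sheets d. cover_proj d h x \<in> A} / of_nat d"
proof -
  let ?R = "restrict_space sheet_measure (sheets d)"
  have sR: "space ?R = sheets d" by (simp add: space_restrict_space space_pair_measure)
  have sd: "sheets d \<in> sets ?R" using sets.top[of ?R] unfolding sR .
  have pre: "cover_proj d h -` A \<inter> sheets d \<in> sets ?R"
    using measurable_sets[OF cover_proj_measurable A] unfolding sR .
  have "measurable (uniform_measure ?R (sheets d)) (cover_borel d h) = measurable ?R (cover_borel d h)"
    by (rule measurable_cong_sets) simp_all
  then have "cover_proj d h \<in> measurable (uniform_measure ?R (sheets d)) (cover_borel d h)"
    using cover_proj_measurable by simp
  from emeasure_distr[OF this A]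
  have "emeasure area A = emeasure (uniform_measure ?R (sheets d)) (cover_proj d h -` A \<inter> sheets d)"
    unfolding normalized_lebesgue_def by (simp only: space_uniform_measure sR)
  also have "\<dots> = emeasure ?R (sheets d \<inter> (cover_proj d h -` A \<inter> sheets d)) / emeasure ?R (sheets d)"
    by (rule emeasure_uniform_measure[OF sd pre])
  also have "\<dots> = emeasure sheet_measure (sheets d \<inter> (cover_proj d h -` A \<inter> sheets d)) / of_nat d"
    using sets_sheets by (simp add: emeasure_restrict_space emeasure_sheets)
  also have "sheets d \<inter> (cover_proj d h -` A \<inter> sheets d) = {x \<in> sheets d. cover_proj d h x \<in> A}"
    by auto
  finally show ?thesis .
qed

text \<open>Over the image of C lie C in sheet i and otherwise only points of exit sides, which form
  a null set.\<close>

lemma emeasure_area_emb: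
  assumes C: "C \<in> sets borel" "C \<subseteq> half_square" and i: "i \<in> {1..d}"
  shows "emeasure area (emb i ` C) = emeasure lborel C / of_nat d"
proof -
  let ?T = "{x \<in> sheets d. cover_proj d h x \<in> emb i ` C}"
  let ?N = "(\<Union>n. exit_side n) \<times> {1..d}"
  have "?T = cover_proj d h -` (emb i ` C) \<inter> space (restrict_space sheet_measure (sheets d))"
    by (auto simp: space_restrict_space space_pair_measure)
  then have T: "?T \<in> sets sheet_measure"
    using measurable_sets[OF cover_proj_measurable sets_emb'[OF C i]] sets_sheets
    by (simp add: sets_restrict_space_iff space_pair_measure)
  have N: "?N \<in> null_sets sheet_measure"
    using emeasure_sheet_Times[of "\<Union>n. exit_side n" "{1..d}"] null_setsD1[OF sides_null(1)]
      null_setsD2[OF sides_null(1)]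
    by (intro null_setsI) (simp_all only: sets_lborel mult_zero_left)
  have sub: "C \<times> {i} \<subseteq> ?T" using C i half_in_sheets by blast
  have "?T \<subseteq> C \<times> {i} \<union> ?N"
  proof
    fix x assume x: "x \<in> ?T"
    obtain q k where xq: "x = (q, k)" by (cases x)
    show "x \<in> C \<times> {i} \<union> ?N"
    proof (cases "q \<in> half_square")
      case True
      then have "q \<in> C \<and> k = i" using x xq C i emb_eq_iff[of q _ k i] by (auto simp: sheets_def)
      then show ?thesis using xq by auto
    next
      case False
      then show ?thesis using x xq by (auto simp: sheets_def punctured_square_eq)
    qed
  qed
  then have "emeasure sheet_measure ?T \<le> emeasure sheet_measure (C \<times> {i} \<union> ?N)"
    using T N emeasure_sheet_Times(1)[OF C(1)] by (intro emeasure_mono) auto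
  also have "\<dots> = emeasure sheet_measure (C \<times> {i})"
    using N emeasure_sheet_Times(1)[OF C(1)] by (intro emeasure_Un_null_set)
  finally have "emeasure sheet_measure ?T = emeasure sheet_measure (C \<times> {i})"
    using emeasure_mono[OF sub T] by (rule antisym)
  also have "\<dots> = emeasure lborel C" using emeasure_sheet_Times(2)[OF C(1), of "{i}"] by simp
  finally show ?thesis using emeasure_area[OF sets_emb'[OF C i]] by simp
qed

lemma prob_space_area: "prob_space area"
proof (rule prob_spaceI)
  have "{x \<in> sheets d. cover_proj d h x \<in> surface} = sheets d" by (auto simp: topspace_surface)
  then have "emeasure area surface = of_nat d / of_nat d"
    using emeasure_area[of surface] sets.top[of "cover_borel d h"]
    by (simp add: emeasure_sheets space_cover_borel)
  then show "emeasure area (space area) = 1"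
    using d_pos ennreal_divide_self[of "of_nat d"] by (simp add: space_area of_nat_less_top)
qed

text \<open>The flow moves disjoint pieces by translations onto disjoint pieces. With arbitrary
  Borel parts \<open>B c j\<close> of the pieces this applies both to preimages and to images of
  sets.\<close>

lemma piece_unions:
  assumes t: "0 \<le> t" "t < 1"
    and B: "\<And>c j. j \<in> {1..d} \<Longrightarrow> B c j \<in> sets borel" "\<And>c j. j \<in> {1..d} \<Longrightarrow> B c j \<subseteq> piece_dom t c"
  shows "(\<Union>(c, j)\<in>UNIV \<times> {1..d}. emb (piece_src c j) ` B c j) \<in> sets (cover_borel d h)" (is "?X \<in> _")
    and "(\<Union>(c, j)\<in>UNIV \<times> {1..d}. emb j ` (\<lambda>p. p + piece_shift t c) ` B c j) \<in> sets (cover_borel d h)" (is "?Y \<in> _")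
    and "emeasure area (\<Union>(c, j)\<in>UNIV \<times> {1..d}. emb (piece_src c j) ` B c j) =
      emeasure area (\<Union>(c, j)\<in>UNIV \<times> {1..d}. emb j ` (\<lambda>p. p + piece_shift t c) ` B c j)"
proof -
  let ?I = "(UNIV :: int option set) \<times> {1..d}"
  have I: "countable ?I" by auto
  have Bh: "B c j \<subseteq> half_square" if "j \<in> {1..d}" for c j
    using B(2)[OF that] piece_dom_half by blast
  have Sh: "(\<lambda>p. p + piece_shift t c) ` B c j \<subseteq> half_square" if "j \<in> {1..d}" for c j
    using B(2)[OF that] piece_image_half[OF t] by blast
  have X: "emb (piece_src c j) ` B c j \<in> sets (cover_borel d h)"
      "emeasure area (emb (piece_src c j) ` B c j) = emeasure lborel (B c j) / of_nat d"
    if "j \<in> {1..d}" for c j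
    using B(1)[OF that] Bh[OF that] that piece_src_in
    by (intro sets_emb' emeasure_area_emb; blast)+
  have Y: "emb j ` (\<lambda>p. p + piece_shift t c) ` B c j \<in> sets (cover_borel d h)"
      "emeasure area (emb j ` (\<lambda>p. p + piece_shift t c) ` B c j) = emeasure lborel (B c j) / of_nat d"
    if "j \<in> {1..d}" for c j
    using sets_emb'[OF emeasure_lborel_translate(1)[OF B(1)[OF that]] Sh[OF that] that]
      emeasure_area_emb[OF emeasure_lborel_translate(1)[OF B(1)[OF that]] Sh[OF that] that]
    by (simp_all only: emeasure_lborel_translate(2)[OF B(1)[OF that]])
  show "?X \<in> sets (cover_borel d h)" "?Y \<in> sets (cover_borel d h)"
    using X(1) Y(1) I by (auto intro!: sets.countable_UN')
  have dX: "disjoint_family_on (\<lambda>(c, j). emb (piece_src c j) ` B c j) ?I"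
    unfolding disjoint_family_on_def
  proof (intro ballI impI)
    fix x y :: "int option \<times> nat" assume "x \<in> ?I" "y \<in> ?I" "x \<noteq> y"
    then obtain c j b k where xy: "x = (c, j)" "y = (b, k)"
      and jk: "j \<in> {1..d}" "k \<in> {1..d}" and ne: "\<not> (c = b \<and> j = k)"
      by (cases x; cases y) auto
    have False if "p \<in> B c j" "q \<in> B b k" "emb (piece_src c j) p = emb (piece_src b k) q" for p q
    proof -
      have pq: "p = q" "piece_src c j = piece_src b k"
        using that jk Bh piece_src_in emb_eq_iff[of p q "piece_src c j" "piece_src b k"] by blast+
      then have "c = b" using that B(2) jk piece_dom_disjoint[of p t c b] by blast
      then show False using pq(2) ne piece_src_inj by blast
    qed
    then show "(case x of (c, j) \<Rightarrow> emb (piece_src c j) ` B c j) \<inter>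
        (case y of (c, j) \<Rightarrow> emb (piece_src c j) ` B c j) = {}"
      unfolding xy prod.case by blast
  qed
  have dY: "disjoint_family_on (\<lambda>(c, j). emb j ` (\<lambda>p. p + piece_shift t c) ` B c j) ?I"
    unfolding disjoint_family_on_def
  proof (intro ballI impI)
    fix x y :: "int option \<times> nat" assume "x \<in> ?I" "y \<in> ?I" "x \<noteq> y"
    then obtain c j b k where xy: "x = (c, j)" "y = (b, k)"
      and jk: "j \<in> {1..d}" "k \<in> {1..d}" and ne: "\<not> (c = b \<and> j = k)"
      by (cases x; cases y) auto
    have False if "p \<in> B c j" "q \<in> B b k" "emb j (p + piece_shift t c) = emb k (q + piece_shift t b)" for p q
    proof -
      have pq: "p + piece_shift t c = q + piece_shift t b" "j = k"
        using that jk Sh emb_eq_iff[of "p + piece_shift t c" "q + piece_shift t b" j k] by blast+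
      then have "c = b" using that B(2) jk piece_image_disjoint[OF t(1), of p c q b] by blast
      then show False using pq(2) ne by blast
    qed
    then show "(case x of (c, j) \<Rightarrow> emb j ` (\<lambda>p. p + piece_shift t c) ` B c j) \<inter>
        (case y of (c, j) \<Rightarrow> emb j ` (\<lambda>p. p + piece_shift t c) ` B c j) = {}"
      unfolding xy prod.case by blast
  qed
  have "emeasure area ?X = (\<integral>\<^sup>+ x. emeasure area (case x of (c, j) \<Rightarrow> emb (piece_src c j) ` B c j) \<partial>count_space ?I)"
    using X(1) by (intro emeasure_UN_countable I dX) (auto simp: sets_area)
  also have "\<dots> = (\<integral>\<^sup>+ x. emeasure area (case x of (c, j) \<Rightarrow> emb j ` (\<lambda>p. p + piece_shift t c) ` B c j) \<partial>count_space ?I)"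
    using X(2) Y(2) by (intro nn_integral_cong) auto
  also have "\<dots> = emeasure area ?Y"
    using Y(1) by (intro emeasure_UN_countable[symmetric] I dY) (auto simp: sets_area)
  finally show "emeasure area ?X = emeasure area ?Y" .
qed

lemma emeasure_area_up_to_bad_heights:
  assumes "A \<in> sets (cover_borel d h)" "A' \<in> sets (cover_borel d h)" "A' \<subseteq> A"
    and cover: "\<And>i p. i \<in> {1..d} \<Longrightarrow> p \<in> half_square \<Longrightarrow> snd p \<notin> bad_heights \<Longrightarrow> emb i p \<in> A \<Longrightarrow> emb i p \<in> A'"
  shows "emeasure area A = emeasure area A'"
proof -
  let ?C = "half_square \<inter> (UNIV \<times> bad_heights)"
  have C: "?C \<in> null_sets lborel"
    using null_set_Int1[OF null_sets_strips(1)[OF countable_bad_heights], of half_square] sets_half_square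
    by (simp add: Int_commute)
  have "emb i ` ?C \<in> null_sets area" if "i \<in> {1..d}" for i
    using null_setsD1[OF C] null_setsD2[OF C] emeasure_area_emb[of ?C i] sets_emb'[of ?C i] that
    by (intro null_setsI) (simp_all only: sets_lborel sets_area Int_lower1 ennreal_zero_divide)
  then have N: "(\<Union>i\<in>{1..d}. emb i ` ?C) \<in> null_sets area" by (intro null_sets_UN') auto
  have "A \<subseteq> A' \<union> (\<Union>i\<in>{1..d}. emb i ` ?C)"
  proof
    fix u assume u: "u \<in> A"
    then have "u \<in> surface" using assms(1) sets.sets_into_space space_cover_borel by blast
    then obtain i p where ip: "i \<in> {1..d}" "p \<in> half_square" "u = emb i p" by (rule surfaceE)
    show "u \<in> A' \<union> (\<Union>i\<in>{1..d}. emb i ` ?C)"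
    proof (cases "snd p \<in> bad_heights")
      case True
      then have "p \<in> ?C" using ip(2) by (cases p) simp
      then show ?thesis using ip(1,3) by blast
    next
      case False
      then show ?thesis using cover[of i p] ip u by simp
    qed
  qed
  then have "emeasure area A \<le> emeasure area (A' \<union> (\<Union>i\<in>{1..d}. emb i ` ?C))"
    using assms N by (intro emeasure_mono) (auto simp: sets_area)
  also have "\<dots> = emeasure area A'" using N assms by (intro emeasure_Un_null_set) (auto simp: sets_area)
  finally show ?thesis using emeasure_mono[OF assms(3)] assms(1) sets_area by (intro antisym) auto
qed

lemma flow_preimage_eq:
  assumes t: "0 \<le> t" "t < 1"
  shows "flow_preimage d h t A =
     (\<Union>(c, j)\<in>UNIV \<times> {1..d}. emb (piece_src c j) ` {p \<in> piece_dom t c. emb j (p + piece_shift t c) \<in> A})"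
    (is "_ = ?R")
proof -
  have "flow_preimage d h t A = {u. \<exists>v\<in>A. piece_flow t u v}"
    using t flows_surface by (auto simp: flow_preimage_def flows_iff_piece_flow[symmetric])
  also have "\<dots> = ?R"
  proof (intro subset_antisym subsetI)
    fix u assume "u \<in> {u. \<exists>v\<in>A. piece_flow t u v}"
    then obtain c j p where "j \<in> {1..d}" "p \<in> piece_dom t c" "u = emb (piece_src c j) p" "emb j (p + piece_shift t c) \<in> A"
      unfolding piece_flow_def by blast
    then show "u \<in> ?R" by (intro UN_I[of "(c, j)"]) auto
  next
    fix u assume "u \<in> ?R"
    then obtain c j p where *: "j \<in> {1..d}" "p \<in> piece_dom t c" "u = emb (piece_src c j) p" "emb j (p + piece_shift t c) \<in> A"
      by auto
    then show "u \<in> {u. \<exists>v\<in>A. piece_flow t u v}" unfolding piece_flow_def by blast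
  qed
  finally show ?thesis .
qed

lemma flow_image_eq:
  assumes t: "0 < t" "t < 1"
  shows "flow_preimage d h (- t) A =
     (\<Union>(c, j)\<in>UNIV \<times> {1..d}. emb j ` (\<lambda>p. p + piece_shift t c) ` {p \<in> piece_dom t c. emb (piece_src c j) p \<in> A})"
    (is "_ = ?R")
proof -
  have "flow_preimage d h (- t) A = {u. \<exists>v\<in>A. piece_flow t v u}"
    using t flows_surface by (auto simp: flow_preimage_def flows_iff_piece_flow[symmetric])
  also have "\<dots> = ?R"
  proof (intro subset_antisym subsetI)
    fix u assume "u \<in> {u. \<exists>v\<in>A. piece_flow t v u}"
    then obtain c j p where "j \<in> {1..d}" "p \<in> piece_dom t c" "u = emb j (p + piece_shift t c)" "emb (piece_src c j) p \<in> A"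
      unfolding piece_flow_def by blast
    then show "u \<in> ?R" by (intro UN_I[of "(c, j)"]) auto
  next
    fix u assume "u \<in> ?R"
    then obtain c j p where *: "j \<in> {1..d}" "p \<in> piece_dom t c" "u = emb j (p + piece_shift t c)" "emb (piece_src c j) p \<in> A"
      by auto
    then show "u \<in> {u. \<exists>v\<in>A. piece_flow t v u}" unfolding piece_flow_def by blast
  qed
  finally show ?thesis .
qed

lemma sets_piece_part:
  assumes t: "0 \<le> t" "t < 1" and A: "A \<in> sets (cover_borel d h)" and j: "j \<in> {1..d}"
  shows "{p \<in> piece_dom t c. emb j (p + piece_shift t c) \<in> A} \<in> sets borel"
    and "{p \<in> piece_dom t c. emb (piece_src c j) p \<in> A} \<in> sets borel"
proof -
  have "{p \<in> piece_dom t c. emb j (p + piece_shift t c) \<in> A} =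
      piece_dom t c \<inter> (\<lambda>p. p + piece_shift t c) -` sheet_part j A"
    using piece_image_half[OF t] by (auto simp: sheet_part_def)
  moreover have "(\<lambda>p. p + piece_shift t c) -` sheet_part j A \<in> sets borel"
    using sets_sheet_part[OF A j] by (rule sets_vimage_translate)
  ultimately show "{p \<in> piece_dom t c. emb j (p + piece_shift t c) \<in> A} \<in> sets borel"
    using sets_piece_dom by auto
  have "{p \<in> piece_dom t c. emb (piece_src c j) p \<in> A} = piece_dom t c \<inter> sheet_part (piece_src c j) A"
    using piece_dom_half by (auto simp: sheet_part_def)
  then show "{p \<in> piece_dom t c. emb (piece_src c j) p \<in> A} \<in> sets borel"
    using sets_piece_dom sets_sheet_part[OF A] j piece_src_in by auto
qed

text \<open>Moving the preimage forward piece by piece recovers A up to the points whose backward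
  trajectory dies, and these lie at bad heights.\<close>

lemma area_invariant_small:
  assumes t: "0 \<le> t" "t < 1" and A: "A \<in> sets (cover_borel d h)"
  shows "flow_preimage d h t A \<in> sets (cover_borel d h)" "emeasure area (flow_preimage d h t A) = emeasure area A"
proof -
  let ?B = "\<lambda>c j. {p \<in> piece_dom t c. emb j (p + piece_shift t c) \<in> A}"
  note * = piece_unions[OF t, of ?B, OF sets_piece_part(1)[OF t A]]
  show "flow_preimage d h t A \<in> sets (cover_borel d h)"
    unfolding flow_preimage_eq[OF t] by (rule *) auto
  have "emeasure area (flow_preimage d h t A) =
      emeasure area (\<Union>(c, j)\<in>UNIV \<times> {1..d}. emb j ` (\<lambda>p. p + piece_shift t c) ` ?B c j)"
    unfolding flow_preimage_eq[OF t] by (rule *) auto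
  also have "\<dots> = emeasure area A"
  proof (rule emeasure_area_up_to_bad_heights[symmetric, OF A])
    show "(\<Union>(c, j)\<in>UNIV \<times> {1..d}. emb j ` (\<lambda>p. p + piece_shift t c) ` ?B c j) \<in> sets (cover_borel d h)"
      by (rule *) auto
    fix i p assume i: "i \<in> {1..d}" and p: "p \<in> half_square" "snd p \<notin> bad_heights" "emb i p \<in> A"
    obtain c q where "q \<in> piece_dom t c" "p = q + piece_shift t c"
      using piece_image_cover[OF t p(1,2)] by blast
    then show "emb i p \<in> (\<Union>(c, j)\<in>UNIV \<times> {1..d}. emb j ` (\<lambda>p. p + piece_shift t c) ` ?B c j)"
      using i p(3) by (intro UN_I[of "(c, i)"]) auto
  qed auto
  finally show "emeasure area (flow_preimage d h t A) = emeasure area A" .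
qed

text \<open>For negative times the preimage is the image under the forward map; the points of A that
  are lost are those whose forward trajectory dies.\<close>

lemma area_invariant_small_neg:
  assumes t: "0 < t" "t < 1" and A: "A \<in> sets (cover_borel d h)"
  shows "flow_preimage d h (- t) A \<in> sets (cover_borel d h)" "emeasure area (flow_preimage d h (- t) A) = emeasure area A"
proof -
  have t': "0 \<le> t" using t by simp
  let ?B = "\<lambda>c j. {p \<in> piece_dom t c. emb (piece_src c j) p \<in> A}"
  note * = piece_unions[OF t' t(2), of ?B, OF sets_piece_part(2)[OF t' t(2) A]]
  show "flow_preimage d h (- t) A \<in> sets (cover_borel d h)"
    unfolding flow_image_eq[OF t] by (rule *) auto
  have "emeasure area (flow_preimage d h (- t) A) =
      emeasure area (\<Union>(c, j)\<in>UNIV \<times> {1..d}. emb (piece_src c j) ` ?B c j)"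
    unfolding flow_image_eq[OF t] by (rule *(3)[symmetric]) auto
  also have "\<dots> = emeasure area A"
  proof (rule emeasure_area_up_to_bad_heights[symmetric, OF A])
    show "(\<Union>(c, j)\<in>UNIV \<times> {1..d}. emb (piece_src c j) ` ?B c j) \<in> sets (cover_borel d h)"
      by (rule *) auto
    fix i p assume i: "i \<in> {1..d}" and p: "p \<in> half_square" "snd p \<notin> bad_heights" "emb i p \<in> A"
    obtain c where c: "p \<in> piece_dom t c" using piece_dom_cover[OF p(1,2)] by blast
    obtain j where j: "j \<in> {1..d}" "i = piece_src c j"
    proof (cases c)
      case None
      then show ?thesis using that i by auto
    next
      case (Some n)
      show ?thesis
      proof (rule that)
        show "inv' (h (gen n)) i \<in> {1..d}" using i perm_inv_in by blast
        show "i = piece_src c (inv' (h (gen n)) i)"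
          by (simp add: Some permutes_inverses(1)[OF perm])
      qed
    qed
    then show "emb i p \<in> (\<Union>(c, j)\<in>UNIV \<times> {1..d}. emb (piece_src c j) ` ?B c j)"
      using c p(3) by (intro UN_I[of "(c, j)"]) auto
  qed auto
  finally show "emeasure area (flow_preimage d h (- t) A) = emeasure area A" .
qed

lemma flow_invariantI:
  assumes M: "sets M = sets (cover_borel d h)"
    and small: "\<And>t A. \<bar>t\<bar> < 1 \<Longrightarrow> A \<in> sets M \<Longrightarrow>
      flow_preimage d h t A \<in> sets M \<and> emeasure M (flow_preimage d h t A) = emeasure M A"
  shows "flow_invariant d h M"
  unfolding flow_invariant_def
proof (intro allI)
  fix t :: real
  \<comment> \<open>The time is cut into N equal steps, each shorter than 1.\<close>
  obtain N :: nat where N: "\<bar>t\<bar> < N" using reals_Archimedean2 by blast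
  then have N0: "N > 0" by (cases N) auto
  define s where "s = t / N"
  have s: "\<bar>s\<bar> < 1" using N N0 by (simp add: s_def abs_divide)
  \<comment> \<open>Counting starts with one step: for negative s the time 0 would not have the sign
    that \<open>flow_preimage_add\<close> requires.\<close>
  have "\<forall>A\<in>sets M. flow_preimage d h (real (Suc k) * s) A \<in> sets M \<and>
      emeasure M (flow_preimage d h (real (Suc k) * s) A) = emeasure M A" for k
  proof (induction k)
    case 0
    then show ?case using small[OF s] by simp
  next
    case (Suc k)
    have "0 \<le> s \<and> 0 \<le> real (Suc k) * s \<or> s < 0 \<and> real (Suc k) * s < 0"
      by (cases "0 \<le> s") (auto simp: mult_pos_neg)
    from flow_preimage_add[OF this]
    have "flow_preimage d h (real (Suc (Suc k)) * s) A = flow_preimage d h s (flow_preimage d h (real (Suc k) * s) A)" for A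
      by (simp add: algebra_simps)
    then show ?case using Suc small[OF s] by auto
  qed
  from this[of "N - 1"]
  show "\<forall>A\<in>sets M. flow_preimage d h t A \<in> sets M \<and> emeasure M (flow_preimage d h t A) = emeasure M A"
    using N0 by (simp add: s_def)
qed

lemma flow_invariant_area: "flow_invariant d h area"
proof (rule flow_invariantI[OF sets_area])
  fix t A assume "\<bar>t\<bar> < (1::real)" "A \<in> sets area"
  then show "flow_preimage d h t A \<in> sets area \<and> emeasure area (flow_preimage d h t A) = emeasure area A"
    using area_invariant_small[of t A] area_invariant_small_neg[of "- t" A]
    by (cases "0 \<le> t") (auto simp: sets_area)
qed

end

section \<open>Two uniqueness criteria\<close>

text \<open>The sum of squares of \<open>w k\<close> is nondecreasing in \<open>k\<close> and increases by the sum of the squares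
  of half the differences \<open>w (k + 1) j - w (k + 1) (s (k mod m) j)\<close>, which therefore tend to \<open>0\<close>.\<close>

lemma averaging_constant:
  fixes w :: "nat \<Rightarrow> nat \<Rightarrow> real" and s :: "nat \<Rightarrow> nat \<Rightarrow> nat"
  assumes m: "0 < m"
    and perm: "\<And>r. s r permutes {1..d}"
    and step: "\<And>k j. j \<in> {1..d} \<Longrightarrow> w k j = (w (Suc k) j + w (Suc k) (s (k mod m) j)) / 2"
    and nonneg: "\<And>k j. j \<in> {1..d} \<Longrightarrow> 0 \<le> w k j"
    and total: "\<And>k. (\<Sum>j\<in>{1..d}. w k j) = 1"
    and trans: "acts_transitively d (generate (sym_group d) (s ` {..<m}))"
    and j: "j \<in> {1..d}"
  shows "w k j = 1 / d"
proof -
  let ?J = "{1..d}"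
  have sJ: "s r i \<in> ?J" if "i \<in> ?J" for r i using permutes_in_image[OF perm] that by blast
  have w1: "w k i \<le> 1" if "i \<in> ?J" for k i
    using member_le_sum[of i ?J "w k"] that nonneg total by auto
  define q where "q k = (\<Sum>i\<in>?J. (w k i)\<^sup>2)" for k
  define e where "e k i = w (Suc k) i - w (Suc k) (s (k mod m) i)" for k i
  have q_step: "q (Suc k) - q k = (\<Sum>i\<in>?J. (e k i)\<^sup>2) / 4" for k
  proof -
    have "(\<Sum>i\<in>?J. (w (Suc k) (s (k mod m) i))\<^sup>2) = (\<Sum>i\<in>?J. (w (Suc k) i)\<^sup>2)"
      using sum.permute[OF perm, of "\<lambda>i. (w (Suc k) i)\<^sup>2" "k mod m"] by (simp add: comp_def)
    then have "q (Suc k) = (\<Sum>i\<in>?J. ((w (Suc k) i)\<^sup>2 + (w (Suc k) (s (k mod m) i))\<^sup>2) / 2)"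
      by (simp add: q_def sum_divide_distrib[symmetric] sum.distrib)
    moreover have "q k = (\<Sum>i\<in>?J. ((w (Suc k) i + w (Suc k) (s (k mod m) i)) / 2)\<^sup>2)"
      unfolding q_def by (intro sum.cong refl arg_cong[of _ _ "\<lambda>x. x\<^sup>2"] step)
    ultimately show ?thesis
      unfolding e_def sum_divide_distrib
      by (simp add: sum_subtractf[symmetric]) (intro sum.cong refl, simp add: power2_eq_square field_simps)
  qed
  then have q_mono: "q k \<le> q (Suc k)" for k
  proof -
    have "0 \<le> (\<Sum>i\<in>?J. (e k i)\<^sup>2) / 4" by (intro divide_nonneg_nonneg sum_nonneg) auto
    then show ?thesis using q_step[of k] by linarith
  qed
  have q_le: "q k \<le> 1" for k
  proof -
    have "q k \<le> (\<Sum>i\<in>?J. w k i)"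
      unfolding q_def using w1 nonneg by (intro sum_mono) (simp add: power2_eq_square mult_left_le_one_le)
    then show ?thesis using total by simp
  qed
  obtain L where L: "q \<longlonglongrightarrow> L"
    by (rule incseq_convergent[of q 1]) (use q_le incseq_SucI[of q, OF q_mono] in auto)
  have "(\<lambda>k. 4 * (q (Suc k) - q k)) \<longlonglongrightarrow> 4 * (L - L)"
    by (intro tendsto_intros LIMSEQ_Suc L)
  then have lim: "(\<lambda>k. \<Sum>i\<in>?J. (e k i)\<^sup>2) \<longlonglongrightarrow> 0" by (simp add: q_step)
  have e0: "(\<lambda>k. e k i) \<longlonglongrightarrow> 0" if i: "i \<in> ?J" for i
  proof -
    have "(\<lambda>k. (e k i)\<^sup>2) \<longlonglongrightarrow> 0"
    proof (rule tendsto_sandwich[OF _ _ tendsto_const lim])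
      show "\<forall>\<^sub>F k in sequentially. (e k i)\<^sup>2 \<le> (\<Sum>i\<in>?J. (e k i)\<^sup>2)"
        using i by (intro always_eventually allI member_le_sum[of i ?J "\<lambda>i. (e k i)\<^sup>2" for k]) auto
    qed simp
    from tendsto_real_sqrt[OF this] have "(\<lambda>k. \<bar>e k i\<bar>) \<longlonglongrightarrow> 0" by simp
    then show ?thesis by (rule tendsto_rabs_zero_cancel)
  qed
  \<comment> \<open>\<open>e k\<close> compares two sheets at index \<open>Suc k\<close> through the
    permutation of residue \<open>k mod m\<close> only. Slow variation in k transports the
    comparisons for all residues to the common indices \<open>k * m\<close>.\<close>
  have diff: "(\<lambda>k. w (k + r) i - w k i) \<longlonglongrightarrow> 0" if i: "i \<in> ?J" for i r
  proof (induction r)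
    case (Suc r)
    have eq: "w (Suc k) i - w k i = e k i / 2" for k using step[OF i, of k] by (simp add: e_def field_simps)
    have "(\<lambda>k. e k i / 2) \<longlonglongrightarrow> 0" using tendsto_divide[OF e0[OF i] tendsto_const[of 2]] by simp
    then have "(\<lambda>k. w (Suc k) i - w k i) \<longlonglongrightarrow> 0" unfolding eq .
    then have "(\<lambda>k. w (Suc (k + r)) i - w (k + r) i) \<longlonglongrightarrow> 0" by (rule LIMSEQ_ignore_initial_segment)
    from tendsto_add[OF this Suc.IH] show ?case by simp
  qed simp
  have gen_lim: "(\<lambda>k. w (k * m) i - w (k * m) (p i)) \<longlonglongrightarrow> 0"
    if p: "p \<in> generate (sym_group d) (s ` {..<m})" and i: "i \<in> ?J" for p i
  proof -
    have filt: "filterlim (\<lambda>k. k * m) sequentially sequentially"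
      using m by (intro filterlim_subseq strict_monoI) simp
    have s_lim: "(\<lambda>k. w (k * m) i - w (k * m) (s r i)) \<longlonglongrightarrow> 0" if r: "r < m" and i: "i \<in> ?J" for r i
    proof -
      have "filterlim (\<lambda>k. k * m + r) sequentially sequentially"
        using m by (intro filterlim_subseq strict_monoI) simp
      from filterlim_compose[OF e0[OF i] this]
      have 1: "(\<lambda>k. w (k * m + Suc r) i - w (k * m + Suc r) (s r i)) \<longlonglongrightarrow> 0"
        using r by (simp add: e_def)
      note 2 = filterlim_compose[OF diff[OF i, of "Suc r"] filt]
      note 3 = filterlim_compose[OF diff[OF sJ[OF i], of "Suc r" r] filt]
      from tendsto_add[OF tendsto_diff[OF 1 2] 3] show ?thesis by simp
    qed
    \<comment> \<open>The permutations for which the limit holds are closed under products and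
      inverses; \<open>p permutes ?J\<close> is carried along to keep sheets in range.\<close>
    have "p permutes ?J \<and> (\<forall>i\<in>?J. (\<lambda>k. w (k * m) i - w (k * m) (p i)) \<longlonglongrightarrow> 0)"
      using p
    proof (induction rule: generate.induct)
      case one
      then show ?case using permutes_id[of ?J] by (simp add: sym_group_one id_def)
    next
      case (incl p)
      then show ?case using s_lim perm by auto
    next
      case (inv p)
      then obtain r where r: "r < m" "p = s r" by auto
      have inv_eq: "inv\<^bsub>sym_group d\<^esub> p = inv' p"
        using perm r by (simp add: sym_group_inv_equality sym_group_carrier)
      have "(\<lambda>k. w (k * m) i - w (k * m) (inv' p i)) \<longlonglongrightarrow> 0" if i: "i \<in> ?J" for i
      proof -
        have "inv' p i \<in> ?J" using permutes_in_image[OF permutes_inv[OF perm]] i r by blast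
        from tendsto_minus[OF s_lim[OF r(1) this]] show ?thesis
          using permutes_inverses(1)[OF perm[of r]] r by simp
      qed
      then show ?case using permutes_inv[OF perm] r inv_eq by simp
    next
      case (eng p1 p2)
      have 1: "p1 permutes ?J" "p2 permutes ?J" using eng.IH by simp_all
      have "(\<lambda>k. w (k * m) i - w (k * m) (p1 (p2 i))) \<longlonglongrightarrow> 0" if i: "i \<in> ?J" for i
      proof -
        have "p2 i \<in> ?J" using permutes_in_image[OF 1(2)] i by simp
        then have a: "(\<lambda>k. w (k * m) (p2 i) - w (k * m) (p1 (p2 i))) \<longlonglongrightarrow> 0" using eng.IH(1) by simp
        have b: "(\<lambda>k. w (k * m) i - w (k * m) (p2 i)) \<longlonglongrightarrow> 0" using eng.IH(2) i by simp
        from tendsto_add[OF b a] show ?thesis by simp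
      qed
      then show ?case using permutes_compose[OF 1(2,1)] by (simp add: sym_group_mult comp_def)
    qed
    then show ?thesis using i by blast
  qed
  have all_lim: "(\<lambda>k. w (k * m) i - w (k * m) i') \<longlonglongrightarrow> 0" if i: "i \<in> ?J" "i' \<in> ?J" for i i'
  proof -
    obtain p where p: "p \<in> generate (sym_group d) (s ` {..<m})" "p i = i'"
      using trans[unfolded acts_transitively_def, rule_format, OF i] by blast
    then show ?thesis using gen_lim[OF p(1) i(1)] by simp
  qed
  have d: "0 < d" using j by auto
  have lim_w: "(\<lambda>k. w (k * m) i) \<longlonglongrightarrow> 1 / d" if i: "i \<in> ?J" for i
  proof -
    have "(\<lambda>k. (\<Sum>i'\<in>?J. w (k * m) i - w (k * m) i')) \<longlonglongrightarrow> (\<Sum>i'\<in>?J. 0)"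
      using i by (intro tendsto_sum all_lim)
    then have "(\<lambda>k. d * w (k * m) i - 1) \<longlonglongrightarrow> 0"
      by (simp add: sum_subtractf total[unfolded One_nat_def])
    then have "(\<lambda>k. (d * w (k * m) i - 1 + 1) / d) \<longlonglongrightarrow> (0 + 1) / d"
      using d by (intro tendsto_intros) auto
    then show ?thesis using d by simp
  qed
  \<comment> \<open>An average of later values cannot exceed their maximum, so a bound at a late
    index descends to all earlier ones. With total 1, no value can then lie below 1 / d
    either.\<close>
  have upper: "w k i \<le> 1 / d" if i: "i \<in> ?J" for k i
  proof (rule ccontr)
    assume "\<not> w k i \<le> 1 / d"
    then have "1 / d < w k i" by simp
    then obtain c where c: "1 / d < c" "c < w k i" using dense by blast
    have ev: "\<forall>\<^sub>F l in sequentially. \<forall>i\<in>?J. w (l * m) i < c"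
      using order_tendstoD(2)[OF lim_w c(1)] by (intro eventually_ball_finite) auto
    obtain l where l: "\<forall>i\<in>?J. w (l * m) i < c" "l \<ge> k"
      using eventually_conj[OF ev eventually_ge_at_top[of k]]
      unfolding eventually_sequentially by (meson order_refl)
    have "k \<le> l * m" using l(2) m mult_le_mono[of k l 1 m] by simp
    moreover have "\<forall>i\<in>?J. w k' i < c" if "k' \<le> l * m" for k'
      using that
    proof (induction rule: inc_induct)
      case (step k')
      show ?case
      proof
        fix i assume i: "i \<in> ?J"
        then have "w (Suc k') i < c" "w (Suc k') (s (k' mod m) i) < c" using step.IH i sJ[OF i] by blast+
        then show "w k' i < c" using assms(3)[OF i, of k'] by simp
      qed
    qed (use l in auto)
    ultimately have "w k i < c" using i by blast
    then show False using c(2) by simp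
  qed
  show ?thesis
  proof (rule ccontr)
    assume "w k j \<noteq> 1 / d"
    then have "w k j < 1 / d" using upper[OF j, of k] by simp
    then have "(\<Sum>i\<in>?J. w k i) < (\<Sum>i\<in>?J. 1 / d)"
      using upper j by (intro sum_strict_mono_ex1) auto
    then show False using total d by simp
  qed
qed

text \<open>The mass of a half-line is trapped between those of two dyadic tails that differ by c /
  2^m, and half-lines determine a measure that is finite on them. The criterion serves across the
  flow, for heights, and along it, for abscissae in a strip.\<close>

lemma measure_eq_dyadic:
  fixes \<mu> :: "real measure" and c :: real
  assumes sets: "sets \<mu> = sets borel"
    and supp: "emeasure \<mu> (- {0..<1}) = 0"
    and c: "0 \<le> c"
    and dyadic: "\<And>m k. k < 2 ^ m \<Longrightarrow> emeasure \<mu> {real k / 2 ^ m ..< real (Suc k) / 2 ^ m} = ennreal (c / 2 ^ m)"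
  shows "\<mu> = scale_measure (ennreal c) (uniform_measure lborel {0..<1})"
proof (rule measure_eqI_lessThan)
  have tail: "emeasure \<mu> {real k / 2 ^ m ..< 1} = ennreal (c * (1 - real k / 2 ^ m))" if "k \<le> 2 ^ m" for k m
    using that
  proof (induction rule: inc_induct)
    case base
    then show ?case by simp
  next
    case (step k)
    have split: "{real k / 2 ^ m ..< 1} = {real k / 2 ^ m ..< real (Suc k) / 2 ^ m} \<union> {real (Suc k) / 2 ^ m ..< 1}"
    proof -
      have "real (Suc k) \<le> 2 ^ m" using step by (metis Suc_leI of_nat_le_iff of_nat_numeral of_nat_power)
      then have "real k / 2 ^ m \<le> real (Suc k) / 2 ^ m" "real (Suc k) / 2 ^ m \<le> 1"
        by (auto simp: field_simps)
      then show ?thesis by (simp add: ivl_disj_un)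
    qed
    have "emeasure \<mu> {real k / 2 ^ m ..< 1} = ennreal (c / 2 ^ m) + ennreal (c * (1 - real (Suc k) / 2 ^ m))"
      unfolding split using step dyadic[of k m]
      by (subst plus_emeasure[symmetric]) (auto simp: sets)
    also have "\<dots> = ennreal (c / 2 ^ m + c * (1 - real (Suc k) / 2 ^ m))"
    proof (rule ennreal_plus[symmetric])
      have "real (Suc k) \<le> 2 ^ m" using step by (metis Suc_leI of_nat_le_iff of_nat_numeral of_nat_power)
      then show "0 \<le> c * (1 - real (Suc k) / 2 ^ m)" using c by (intro mult_nonneg_nonneg) auto
    qed (use c in simp)
    also have "c / 2 ^ m + c * (1 - real (Suc k) / 2 ^ m) = c * (1 - real k / 2 ^ m)"
      by (simp add: field_simps)
    finally show ?case .
  qed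
  have total: "emeasure \<mu> {0..<1} = ennreal c" using tail[of 0 0] by simp
  have cut: "emeasure \<mu> A = emeasure \<mu> (A \<inter> {0..<1})" if "A \<in> sets borel" for A
  proof -
    have "emeasure \<mu> A = emeasure \<mu> (A \<inter> {0..<1} \<union> A \<inter> - {0..<1})" by (rule arg_cong[of _ _ "emeasure \<mu>"]) auto
    also have "\<dots> = emeasure \<mu> (A \<inter> {0..<1})"
    proof (rule emeasure_Un_null_set)
      have "- {0..<1::real} \<in> null_sets \<mu>" using supp by (intro null_setsI) (auto simp: sets)
      then show "A \<inter> - {0..<1} \<in> null_sets \<mu>" using that null_set_Int1[of "- {0..<1}" \<mu> A] sets by (simp add: Int_commute)
    qed (use that in \<open>auto simp: sets\<close>)
    finally show ?thesis .
  qed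
  have le_c: "emeasure \<mu> A \<le> ennreal c" if "A \<in> sets borel" for A
    unfolding cut[OF that] total[symmetric] by (intro emeasure_mono) (auto simp: sets)
  show "emeasure \<mu> {x<..} < \<infinity>" for x
    using le_c[of "{x<..}"] by (simp add: order.strict_trans1)
  show "emeasure \<mu> {x<..} = emeasure (scale_measure (ennreal c) (uniform_measure lborel {0..<1})) {x<..}" for x
  proof -
    have rhs: "emeasure (scale_measure (ennreal c) (uniform_measure lborel {0..<1})) {x<..} =
        ennreal c * emeasure lborel ({0..<1} \<inter> {x<..})"
      by (simp add: divide_ennreal_def)
    consider "x < 0" | "0 \<le> x" "x < 1" | "1 \<le> x" by linarith
    then show ?thesis
    proof cases
      case 1
      then have "{x<..} \<inter> {0..<1} = {0..<1}" by auto
      then show ?thesis using cut[of "{x<..}"] total by (simp add: rhs Int_commute)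
    next
      case 3
      then have "{x<..} \<inter> {0..<1} = {}" by auto
      then show ?thesis using cut[of "{x<..}"] by (simp add: rhs Int_commute)
    next
      case 2
      have fin: "emeasure \<mu> {x<..} \<noteq> \<infinity>" using le_c[of "{x<..}"] by (auto simp: top_unique)
      define v where "v = measure \<mu> {x<..}"
      have v: "emeasure \<mu> {x<..} = ennreal v" using fin by (simp add: v_def emeasure_eq_ennreal_measure)
      have v0: "0 \<le> v" by (simp add: v_def)
      have bound: "\<bar>v - c * (1 - x)\<bar> \<le> c * (1 / 2) ^ m" for m
      proof -
        \<comment> \<open>\<open>k\<close> numbers the dyadic interval of level m containing x, so
          that x lies between the left ends of consecutive tails.\<close>
        define k where "k = nat \<lfloor>x * 2 ^ m\<rfloor>"
        have k: "real k \<le> x * 2 ^ m" "x * 2 ^ m < real (Suc k)"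
          using 2 by (auto simp: k_def) linarith+
        have kx: "real k / 2 ^ m \<le> x" "x < real (Suc k) / 2 ^ m" using k by (auto simp: field_simps)
        have "x * 2 ^ m < 2 ^ m" using 2 by simp
        then have "real k < real (2 ^ m)" using k(1) unfolding of_nat_power of_nat_numeral by linarith
        then have km: "Suc k \<le> 2 ^ m" by (simp only: of_nat_less_iff)
        have km': "real (Suc k) / 2 ^ m \<le> 1"
        proof -
          have "real (Suc k) \<le> real (2 ^ m)" using km by (simp only: of_nat_le_iff)
          then show ?thesis by simp
        qed
        have "emeasure \<mu> {real (Suc k) / 2 ^ m ..< 1} \<le> emeasure \<mu> {x<..}"
          using kx by (intro emeasure_mono) (auto simp: sets)
        then have "ennreal (c * (1 - real (Suc k) / 2 ^ m)) \<le> ennreal v" using tail[OF km] v by simp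
        then have lo: "c * (1 - real (Suc k) / 2 ^ m) \<le> v" using v0 by (simp add: ennreal_le_iff)
        have "emeasure \<mu> {x<..} \<le> emeasure \<mu> {real k / 2 ^ m ..< 1}"
          unfolding cut[of "{x<..}", simplified] using kx by (intro emeasure_mono) (auto simp: sets)
        then have "ennreal v \<le> ennreal (c * (1 - real k / 2 ^ m))" using tail[OF Suc_leD[OF km]] v by simp
        moreover have "0 \<le> c * (1 - real k / 2 ^ m)" proof (rule mult_nonneg_nonneg[OF c])
          show "0 \<le> 1 - real k / 2 ^ m" using kx 2 by linarith
        qed
        ultimately have hi: "v \<le> c * (1 - real k / 2 ^ m)" by (simp add: ennreal_le_iff)
        have suc: "real (Suc k) / 2 ^ m = real k / 2 ^ m + (1 / 2) ^ m"
          by (simp add: power_one_over add_divide_distrib)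
        have "c * (1 - real k / 2 ^ m) \<le> c * (1 - x) + c * (1 / 2) ^ m"
          using mult_left_mono[OF less_imp_le[OF kx(2)[unfolded suc]] c] by (simp add: algebra_simps)
        moreover have "c * (1 - x) - c * (1 / 2) ^ m \<le> c * (1 - real (Suc k) / 2 ^ m)"
          unfolding suc using mult_left_mono[OF kx(1) c] by (simp add: algebra_simps)
        ultimately show ?thesis using lo hi by linarith
      qed
      have "(\<lambda>m. c * (1 / 2) ^ m) \<longlonglongrightarrow> c * 0"
        by (intro tendsto_intros LIMSEQ_realpow_zero) auto
      then have "\<bar>v - c * (1 - x)\<bar> \<le> 0"
        using bound by (intro LIMSEQ_le_const[of "\<lambda>m. c * (1 / 2) ^ m" 0]) auto
      then have "v = c * (1 - x)" by simp
      moreover have "{0..<1} \<inter> {x<..} = {x<..<1}" using 2 by auto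
      ultimately show ?thesis unfolding rhs using 2 c v by (simp add: ennreal_mult)
    qed
  qed
qed (simp_all add: sets)

section \<open>Transverse measures of an invariant measure\<close>

lemma power_notin_dyad: "2 powi n \<notin> dyad k"
proof
  assume k: "2 powi n \<in> dyad k"
  have "k \<le> n \<or> n \<le> k - 1" by linarith
  then have "(2::real) powi k \<le> 2 powi n \<or> (2::real) powi n \<le> 2 powi (k - 1)"
    using power_int_increasing[of k n "2::real"] power_int_increasing[of n "k - 1" "2::real"] by auto
  then show False using k by (auto simp: dyad_def)
qed

lemma powi_double: "2 powi n = 2 * (2 powi (n - 1) :: real)"
  by (simp add: power_int_diff)

lemma dyad_double: "2 * x \<in> dyad n \<longleftrightarrow> x \<in> dyad (n - 1)"
  using powi_double[of n] powi_double[of "n - 1"] by (auto simp: dyad_def)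

text \<open>Top edges are open intervals of length at most 1/2, so every trajectory along one dies
  within time 1/2.\<close>

lemma top_entry_width: "\<not> ((x, 1) \<in> entry_side n \<and> (x + 1 / 2, 1) \<in> entry_side n)"
proof
  assume *: "(x, 1) \<in> entry_side n \<and> (x + 1 / 2, 1) \<in> entry_side n"
  then have n: "n \<le> 0" by (auto simp: entry_side_iff split: if_splits)
  have "2 powi (n - 1) \<le> (2::real) powi (- 1)" using n by (intro power_int_increasing) auto
  then have "2 powi (n - 1) \<le> (1 / 2 :: real)" by (simp add: power_int_minus)
  then show False using * n powi_double[of n] by (auto simp: entry_side_iff dyad_def)
qed

lemma add_piece_shift_Some:
  assumes "(1, y) \<in> exit_side n"
  shows "(x, y) + piece_shift t (Some n) = (x + t - 1, y + snd (edge_translation n))"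
  using exit_right(2)[OF assms] by (simp add: prod_eq_iff)

locale invariant_measure = sheeted_cover +
  fixes M :: "sheet_point set measure"
  assumes sets_M: "sets M = sets (cover_borel d h)"
    and prob_M: "prob_space M"
    and invariant: "flow_invariant d h M"
begin

lemma space_M: "space M = surface"
  using sets_eq_imp_space_eq[OF sets_M] space_cover_borel by simp

text \<open>The part of M on sheet j as a measure on the plane. Points of bottom and right sides are
  counted through their representatives on the top and left sides.\<close>

definition sheet_law :: "nat \<Rightarrow> (real \<times> real) measure" where
  "sheet_law j = distr (restrict_space M (emb j ` half_square)) borel (fst \<circ> rep)"

lemma sets_sheet_law [simp]: "sets (sheet_law j) = sets borel" and space_sheet_law [simp]: "space (sheet_law j) = UNIV"
  by (simp_all add: sheet_law_def)

lemma emeasure_sheet_law: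
  assumes C: "C \<in> sets borel" and j: "j \<in> {1..d}"
  shows "emeasure (sheet_law j) C = emeasure M (emb j ` (C \<inter> half_square))"
proof -
  let ?R = "restrict_space M (emb j ` half_square)"
  have E: "emb j ` half_square \<in> sets M"
    using sets_emb[of UNIV j] j sets_M by simp
  have "emb j ` half_square \<subseteq> space M" using E by (rule sets.sets_into_space)
  then have sp: "space ?R = emb j ` half_square" by (auto simp: space_restrict_space)
  have pre: "(fst \<circ> rep) -` S \<inter> space ?R = emb j ` (S \<inter> half_square)" for S
    using j by (auto simp: sp rep_emb)
  have sets_R: "emb j ` (S \<inter> half_square) \<in> sets ?R" if "S \<in> sets borel" for S
    using sets_emb[OF that j] E by (subst sets_restrict_space_iff) (auto simp: sets_M)
  have "fst \<circ> rep \<in> measurable ?R borel"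
    by (rule measurableI) (auto simp only: pre sets_R space_borel UNIV_I)
  then have "emeasure (sheet_law j) C = emeasure ?R (emb j ` (C \<inter> half_square))"
    unfolding sheet_law_def using C by (simp only: emeasure_distr pre)
  also have "\<dots> = emeasure M (emb j ` (C \<inter> half_square))"
    using E by (subst emeasure_restrict_space) auto
  finally show ?thesis .
qed

lemma sheet_law_cong:
  assumes "C \<in> sets borel" "D \<in> sets borel" "j \<in> {1..d}" "C \<inter> half_square = D \<inter> half_square"
  shows "emeasure (sheet_law j) C = emeasure (sheet_law j) D"
  using assms by (simp add: emeasure_sheet_law)

lemma sheet_law_le_1: "j \<in> {1..d} \<Longrightarrow> emeasure (sheet_law j) C \<le> 1"
  by (cases "C \<in> sets borel")
    (simp_all add: emeasure_sheet_law prob_space.emeasure_le_1[OF prob_M] emeasure_notin_sets)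

lemma finite_measure_sheet_law: "j \<in> {1..d} \<Longrightarrow> finite_measure (sheet_law j)"
  using sheet_law_le_1[of j UNIV] by (intro finite_measureI) (auto simp: top_unique)

text \<open>Invariance for a set whose preimage under the time \<open>t\<close> map lies in a single piece.\<close>

lemma sheet_law_pullback:
  assumes t: "0 \<le> t" "t < 1" and C: "C \<in> sets borel" and D: "D \<in> sets borel" and j: "j \<in> {1..d}"
    and into: "\<And>c p. p \<in> piece_dom t c \<Longrightarrow> p + piece_shift t c \<in> C \<Longrightarrow> c = b \<and> p \<in> D"
    and onto: "\<And>p. p \<in> half_square \<Longrightarrow> p \<in> D \<Longrightarrow> p \<in> piece_dom t b \<and> p + piece_shift t b \<in> C"
  shows "emeasure (sheet_law j) C = emeasure (sheet_law (piece_src b j)) D"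
proof -
  let ?C = "emb j ` (C \<inter> half_square)"
  have "flow_preimage d h t ?C = emb (piece_src b j) ` (D \<inter> half_square)"
    unfolding flow_preimage_eq[OF t]
  proof (intro subset_antisym subsetI)
    fix u assume "u \<in> (\<Union>(c, j')\<in>UNIV \<times> {1..d}. emb (piece_src c j') ` {p \<in> piece_dom t c. emb j' (p + piece_shift t c) \<in> ?C})"
    then obtain c j' p where *: "j' \<in> {1..d}" "p \<in> piece_dom t c" "u = emb (piece_src c j') p"
      "emb j' (p + piece_shift t c) \<in> ?C" by auto
    then obtain q where q: "q \<in> C" "q \<in> half_square" "emb j' (p + piece_shift t c) = emb j q" by blast
    then have "p + piece_shift t c = q" "j' = j"
      using emb_eq_iff[OF piece_image_half[OF t *(2)] q(2) *(1) j] by simp_all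
    then show "u \<in> emb (piece_src b j) ` (D \<inter> half_square)"
      using into[OF *(2)] q *(3) piece_dom_half[OF *(2)] by blast
  next
    fix u assume "u \<in> emb (piece_src b j) ` (D \<inter> half_square)"
    then obtain p where p: "p \<in> D" "p \<in> half_square" "u = emb (piece_src b j) p" by blast
    then have "p \<in> piece_dom t b" "p + piece_shift t b \<in> C" using onto by auto
    then show "u \<in> (\<Union>(c, j')\<in>UNIV \<times> {1..d}. emb (piece_src c j') ` {p \<in> piece_dom t c. emb j' (p + piece_shift t c) \<in> ?C})"
      using p(3) j piece_image_half[OF t] by (intro UN_I[of "(b, j)"]) auto
  qed
  moreover have "emeasure M (flow_preimage d h t ?C) = emeasure M ?C"
    using invariant sets_emb[OF C j] unfolding flow_invariant_def sets_M by blast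
  ultimately show ?thesis
    using piece_src_in[of b j] j C D by (simp only: emeasure_sheet_law)
qed

section \<open>Invariance at particular times\<close>

lemma sets_Times_borel [simp]: "A \<in> sets borel \<Longrightarrow> B \<in> sets borel \<Longrightarrow> A \<times> B \<in> sets (borel :: (real \<times> real) measure)"
  by (rule borel_Times)

text \<open>Time 1/2 leads nothing into the top side: trajectories along an edge are too short, and
  all others stay below height 1. The preimage is empty.\<close>

lemma sheet_law_top: 
  assumes "j \<in> {1..d}" shows "emeasure (sheet_law j) (UNIV \<times> {1}) = 0"
proof -
  have "emeasure (sheet_law j) (UNIV \<times> {1}) = emeasure (sheet_law (piece_src None j)) {}"
  proof (rule sheet_law_pullback[of "1 / 2", OF _ _ _ _ assms])
    fix c p assume p: "p \<in> piece_dom (1 / 2) c" "p + piece_shift (1 / 2) c \<in> UNIV \<times> {1}"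
    obtain x y where p_eq: "p = (x, y)" by (cases p)
    have False
    proof (cases c)
      case None
      then show ?thesis using p top_entry_width[of x] by (auto simp: p_eq)
    next
      case (Some n)
      then have "(1, y) \<in> exit_side n" using p by (simp add: p_eq)
      then show ?thesis
        using p(2) exit_right(7)[of y n] add_piece_shift_Some[of y n x "1/2"] by (simp add: p_eq Some)
    qed
    then show "c = None \<and> p \<in> {}" ..
  qed auto
  then show ?thesis by simp
qed

text \<open>Time a moves the slice at the left side onto the slice at a in the same sheet, and
  points that cross an edge in time a end to the left of a. Equal mass of equal slices will yield
  Lebesgue measure along the flow.\<close>

lemma sheet_law_slice:
  assumes a: "0 \<le> a" "0 < w" "a + w \<le> 1" and B: "B \<in> sets borel" "B \<subseteq> {0<..<1}" and j: "j \<in> {1..d}"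
  shows "emeasure (sheet_law j) ({a..<a + w} \<times> B) = emeasure (sheet_law j) ({0..<w} \<times> B)"
proof -
  have "emeasure (sheet_law j) ({a..<a + w} \<times> B) = emeasure (sheet_law (piece_src None j)) ({0..<w} \<times> B)"
  proof (rule sheet_law_pullback[of a, OF _ _ _ _ j])
    fix c p assume p: "p \<in> piece_dom a c" "p + piece_shift a c \<in> {a..<a + w} \<times> B"
    obtain x y where p_eq: "p = (x, y)" by (cases p)
    have xy: "0 \<le> x" "x < 1" using half_square_bounds[of x y] piece_dom_half[OF p(1)] p_eq by auto
    show "c = None \<and> p \<in> {0..<w} \<times> B"
    proof (cases c)
      case None
      then show ?thesis using p xy by (auto simp: p_eq)
    next
      case (Some n)
      then have "(1, y) \<in> exit_side n" using p p_eq by auto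
      from p(2)[unfolded Some p_eq add_piece_shift_Some[OF this]] show ?thesis using xy by simp
    qed
  next
    fix p assume "p \<in> half_square" "p \<in> {0..<w} \<times> B"
    then show "p \<in> piece_dom a None \<and> p + piece_shift a None \<in> {a..<a + w} \<times> B"
      using a B(2) by (cases p) auto
  qed (use a B in auto)
  then show ?thesis by simp
qed

abbreviation height :: "int \<Rightarrow> real" where
  "height n \<equiv> snd (edge_translation n)"

lemma sets_vimage_height: "B \<in> sets borel \<Longrightarrow> (\<lambda>y. y - s :: real) -` B \<in> sets borel"
  using measurable_sets[of "\<lambda>y. y - s" borel borel B] by simp

text \<open>Time 1/2 carries the right half of a strip that ends in edge n onto the left half of the
  strip that starts there; \<open>height n\<close> is the vertical shift of the gluing.\<close>

lemma sheet_law_edge: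
  assumes B: "B \<in> sets borel" "\<And>y. y \<in> B \<Longrightarrow> (1, y) \<in> exit_side n" and j: "j \<in> {1..d}"
  shows "emeasure (sheet_law j) ({0..<1/2} \<times> (\<lambda>y. y - height n) -` B) =
    emeasure (sheet_law (h (gen n) j)) ({1/2..<1} \<times> B)"
proof -
  have "emeasure (sheet_law j) ({0..<1/2} \<times> (\<lambda>y. y - height n) -` B) =
    emeasure (sheet_law (piece_src (Some n) j)) ({1/2..<1} \<times> B)"
  proof (rule sheet_law_pullback[of "1 / 2", OF _ _ _ _ j])
    fix c p assume p: "p \<in> piece_dom (1 / 2) c"
      "p + piece_shift (1 / 2) c \<in> {0..<1/2} \<times> (\<lambda>y. y - height n) -` B"
    obtain x y where p_eq: "p = (x, y)" by (cases p)
    have xy: "0 \<le> x" "x < 1" using half_square_bounds[of x y] piece_dom_half[OF p(1)] p_eq by auto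
    show "c = Some n \<and> p \<in> {1/2..<1} \<times> B"
    proof (cases c)
      case None
      then show ?thesis using p xy by (auto simp: p_eq)
    next
      case (Some m)
      then have m: "(1, y) \<in> exit_side m" using p p_eq by auto
      note p2 = p(2)[unfolded Some p_eq add_piece_shift_Some[OF this]]
      then have yB: "y + height m - height n \<in> B" by simp
      have "(0, y + height m) \<in> entry_side n" using exit_right(5)[OF B(2)[OF yB]] by simp
      then have "m = n" using entry_side_inj exit_right(5)[OF m] by blast
      then show ?thesis using p2 xy Some yB by (auto simp: p_eq)
    qed
  next
    fix p assume p: "p \<in> half_square" "p \<in> {1/2..<1} \<times> B"
    obtain x y where p_eq: "p = (x, y)" by (cases p)
    have n: "(1, y) \<in> exit_side n" using p B(2) by (simp add: p_eq)
    then show "p \<in> piece_dom (1/2) (Some n) \<and>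
        p + piece_shift (1/2) (Some n) \<in> {0..<1/2} \<times> (\<lambda>y. y - height n) -` B"
      unfolding p_eq add_piece_shift_Some[OF n] using p by (simp add: p_eq)
  qed (use B sets_vimage_height in auto)
  then show ?thesis by simp
qed

text \<open>Points in the left half that have flowed for time 1/2 have just crossed a vertical edge.
  No edge arrives at height y, so the preimage is empty.\<close>

lemma sheet_law_dead:
  assumes y: "\<And>n. (0, y) \<notin> entry_side n" and j: "j \<in> {1..d}"
  shows "emeasure (sheet_law j) ({0..<1/2} \<times> {y}) = 0"
proof -
  have "emeasure (sheet_law j) ({0..<1/2} \<times> {y}) = emeasure (sheet_law (piece_src None j)) {}"
  proof (rule sheet_law_pullback[of "1 / 2", OF _ _ _ _ j])
    fix c p assume p: "p \<in> piece_dom (1 / 2) c" "p + piece_shift (1 / 2) c \<in> {0..<1/2} \<times> {y}"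
    obtain x z where p_eq: "p = (x, z)" by (cases p)
    have x: "0 \<le> x" using half_square_bounds[of x z] piece_dom_half[OF p(1)] p_eq by auto
    have False
    proof (cases c)
      case None
      then show ?thesis using p x by (auto simp: p_eq)
    next
      case (Some n)
      then have z: "(1, z) \<in> exit_side n" using p by (simp add: p_eq)
      from p(2)[unfolded Some p_eq add_piece_shift_Some[OF z]] show ?thesis
        using y[of n] exit_right(5)[OF z] by simp
    qed
    then show "c = None \<and> p \<in> {}" ..
  qed auto
  then show ?thesis by simp
qed

lemma sheet_law_halves:
  assumes B: "B \<in> sets borel" "B \<subseteq> {0<..<1}" and j: "j \<in> {1..d}"
  shows "emeasure (sheet_law j) (UNIV \<times> B) = 2 * emeasure (sheet_law j) ({0..<1/2} \<times> B)"
    and "emeasure (sheet_law j) ({1/2..<1} \<times> B) = emeasure (sheet_law j) ({0..<1/2} \<times> B)"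
proof -
  show *: "emeasure (sheet_law j) ({1/2..<1} \<times> B) = emeasure (sheet_law j) ({0..<1/2} \<times> B)"
    using sheet_law_slice[of "1/2" "1/2", OF _ _ _ B j] by simp
  have "emeasure (sheet_law j) (UNIV \<times> B) = emeasure (sheet_law j) ({0..<1/2} \<times> B \<union> {1/2..<1} \<times> B)"
    using B by (intro sheet_law_cong j) (auto dest: half_square_bounds)
  also have "\<dots> = emeasure (sheet_law j) ({0..<1/2} \<times> B) + emeasure (sheet_law j) ({1/2..<1} \<times> B)"
    using B by (intro plus_emeasure[symmetric]) auto
  finally show "emeasure (sheet_law j) (UNIV \<times> B) = 2 * emeasure (sheet_law j) ({0..<1/2} \<times> B)"
    by (simp add: * mult_2)
qed

text \<open>Strips have width 1 in the direction of the flow, so the mass of the strip over a set of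
  heights is its transverse measure.\<close>

definition nu :: "nat \<Rightarrow> real measure" where
  "nu j = distr (sheet_law j) borel snd"

lemma sets_nu [simp]: "sets (nu j) = sets borel" and space_nu [simp]: "space (nu j) = UNIV"
  by (simp_all add: nu_def)

lemma emeasure_nu: "B \<in> sets borel \<Longrightarrow> emeasure (nu j) B = emeasure (sheet_law j) (UNIV \<times> B)"
proof -
  assume B: "B \<in> sets borel"
  have "snd \<in> measurable (sheet_law j) borel"
    by (subst measurable_cong_sets[OF sets_sheet_law refl])
      (intro borel_measurable_continuous_onI continuous_intros)
  moreover have "snd -` B \<inter> space (sheet_law j) = UNIV \<times> B" by auto
  ultimately show ?thesis unfolding nu_def using B by (simp only: emeasure_distr)
qed

text \<open>Holonomy invariance across edge n: each side is twice the mass of a half strip, and time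
  1/2 carries one of these half strips onto the other.\<close>

lemma nu_edge:
  assumes B: "B \<in> sets borel" "\<And>y. y \<in> B \<Longrightarrow> (1, y) \<in> exit_side n" and j: "j \<in> {1..d}"
  shows "emeasure (nu j) ((\<lambda>y. y - height n) -` B) = emeasure (nu (h (gen n) j)) B"
proof -
  have 1: "B \<subseteq> {0<..<1}" using exit_right(3,4)[OF B(2)] by auto
  have 2: "(\<lambda>y. y - height n) -` B \<subseteq> {0<..<1}"
  proof
    fix y assume "y \<in> (\<lambda>y. y - height n) -` B"
    then show "y \<in> {0<..<1}" using exit_right(6,7)[OF B(2), of "y - height n"] by simp
  qed
  have hj: "h (gen n) j \<in> {1..d}" using j perm_in by blast
  note sB = sets_vimage_height[OF B(1), of "height n"]
  have "emeasure (nu j) ((\<lambda>y. y - height n) -` B) =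
      2 * emeasure (sheet_law j) ({0..<1/2} \<times> (\<lambda>y. y - height n) -` B)"
    unfolding emeasure_nu[OF sB] by (rule sheet_law_halves(1)[OF sB 2 j])
  also have "\<dots> = 2 * emeasure (sheet_law (h (gen n) j)) ({0..<1/2} \<times> B)"
    using sheet_law_edge[OF B j] sheet_law_halves(2)[OF B(1) 1 hj] by simp
  also have "\<dots> = emeasure (nu (h (gen n) j)) B"
    unfolding emeasure_nu[OF B(1)] by (rule sheet_law_halves(1)[OF B(1) 1 hj, symmetric])
  finally show ?thesis .
qed

lemma nu_outside:
  assumes j: "j \<in> {1..d}" shows "emeasure (nu j) (- {0<..<1}) = 0"
proof -
  have "emeasure (nu j) (- {0<..<1}) = emeasure (sheet_law j) (UNIV \<times> - {0<..<1})"
    by (rule emeasure_nu) auto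
  also have "\<dots> = emeasure (sheet_law j) (UNIV \<times> {1})"
    using j by (intro sheet_law_cong) (auto dest: half_square_bounds)
  finally show ?thesis using sheet_law_top[OF j] by simp
qed

lemma nu_dead:
  assumes y: "\<And>n. (0, y) \<notin> entry_side n" and j: "j \<in> {1..d}"
  shows "emeasure (nu j) {y} = 0"
proof (cases "y \<in> {0<..<1}")
  case True
  then show ?thesis using sheet_law_halves(1)[of "{y}" j] sheet_law_dead[OF y j] j by (simp add: emeasure_nu)
next
  case False
  then have "emeasure (nu j) {y} \<le> emeasure (nu j) (- {0<..<1})" by (intro emeasure_mono) auto
  then show ?thesis using nu_outside[OF j] by simp
qed

text \<open>These heights are endpoints of left edges or their limit 0, so no edge arrives there. As
  they are null, half-open dyadic intervals can replace the open edges.\<close>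

lemma nu_power: "j \<in> {1..d} \<Longrightarrow> emeasure (nu j) {1 / 2 ^ n} = 0"
  and nu_zero: "j \<in> {1..d} \<Longrightarrow> emeasure (nu j) {0} = 0"
proof -
  assume j: "j \<in> {1..d}"
  have p: "1 / 2 ^ n = (2::real) powi (- int n)" by (simp add: power_int_minus divide_inverse)
  show "emeasure (nu j) {1 / 2 ^ n} = 0"
    using power_notin_dyad[of "- int n"] by (intro nu_dead j) (auto simp: entry_side_iff p)
next
  assume j: "j \<in> {1..d}"
  show "emeasure (nu j) {0} = 0"
    by (intro nu_dead j) (auto dest!: entry_side_bounds)
qed

lemma sum_nu: "(\<Sum>j\<in>{1..d}. emeasure (nu j) UNIV) = 1"
proof -
  have "emeasure M (space M) = emeasure M (\<Union>j\<in>{1..d}. emb j ` half_square)"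
    unfolding space_M by (rule arg_cong[of _ _ "emeasure M"]) (auto elim!: surfaceE intro: emb_in_surface)
  also have "\<dots> = (\<Sum>j\<in>{1..d}. emeasure M (emb j ` half_square))"
  proof (rule sum_emeasure[symmetric])
    show "(\<lambda>j. emb j ` half_square) ` {1..d} \<subseteq> sets M"
      using sets_emb[of UNIV] by (auto simp: sets_M)
    show "disjoint_family_on (\<lambda>j. emb j ` half_square) {1..d}"
      unfolding disjoint_family_on_def using emb_eq_iff by blast
  qed auto
  also have "\<dots> = (\<Sum>j\<in>{1..d}. emeasure (nu j) UNIV)"
    by (intro sum.cong refl) (simp add: emeasure_nu emeasure_sheet_law)
  finally show ?thesis using prob_space.emeasure_space_1[OF prob_M] by simp
qed

end

section \<open>Renormalization and unique ergodicity\<close>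

text \<open>\<open>mon n k\<close> stands for the monodromy of the loop \<open>\<gamma>\<^sub>k\<close> of the \<open>n\<close>-th renormalized cover.\<close>

locale renormalized_cover = sheeted_cover +
  fixes mon :: "nat \<Rightarrow> int \<Rightarrow> nat \<Rightarrow> nat"
    and s :: "nat \<Rightarrow> nat \<Rightarrow> nat" and m :: nat
  assumes mon_0: "0 < i \<Longrightarrow> mon 0 i = h (gen i)"
    and mon_Suc: "0 < i \<Longrightarrow> mon (Suc n) i = mon n 1 \<circ> mon n (i + 1)"
    and mon_perm: "0 < i \<Longrightarrow> mon n i permutes {1..d}"
    and m_pos: "0 < m" and s_perm: "s r permutes {1..d}"
    and mon_square: "mon (k\<^sup>2) 1 = s (k mod m)"
    and mon_nonsquare: "(\<And>k. n \<noteq> k\<^sup>2) \<Longrightarrow> mon n 1 = id"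
    and s_trans: "acts_transitively d (generate (sym_group d) (s ` {..<m}))"

locale renormalized_measure = renormalized_cover + invariant_measure
begin

text \<open>The vertical holonomy of the formula for \<open>phi_inv (gen k)\<close>: the inverse of
  \<phi> halves heights, so half the rise across edge k is the sum of the rises across the edges 1
  and k + 1.\<close>

lemma height_renorm:
  assumes "0 < k" shows "height k = 2 * (height (k + 1) + height 1)"
proof -
  have "(2 :: real) powi (- 1) = 1 / 2" by (simp add: power_int_minus)
  then show ?thesis using assms powi_double[of "- k"] by (simp add: edge_translation_def)
qed

lemma exit_side_1: "0 < k \<Longrightarrow> 1 - 2 * z \<in> dyad (1 - k) \<Longrightarrow> (1, z) \<in> exit_side 1"
  using dyad_bounds[of "1 - 2 * z" "1 - k"] by (simp add: exit_side_iff dyad_def power_int_minus)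

lemma mon_in: "0 < k \<Longrightarrow> mon n k j \<in> {1..d} \<longleftrightarrow> j \<in> {1..d}"
  using permutes_in_image[OF mon_perm] .

text \<open>The first return map of the flow to the lower part of height \<open>1 / 2 ^ n\<close> of the left side is a
  scaled copy of the return map to the whole side, with the renormalized monodromy.\<close>

lemma nu_renorm:
  assumes "0 < k" "B \<in> sets borel" "\<And>y. y \<in> B \<Longrightarrow> (1, 2 ^ n * y) \<in> exit_side k" "j \<in> {1..d}"
  shows "emeasure (nu j) ((\<lambda>y. y - height k / 2 ^ n) -` B) = emeasure (nu (mon n k j)) B"
  using assms
proof (induction n arbitrary: k B j)
  case 0
  then show ?case using nu_edge[of B k j] by (simp add: mon_0)
next
  case (Suc n)
  \<comment> \<open>The return to the lower half passes first through edge 1 of level n, which lifts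
    B by 1 / 2^(n+1) to the heights \<open>B1\<close> in the upper half, and then through edge k + 1
    of level n.\<close>
  define B1 where "B1 = (\<lambda>y. y - height 1 / 2 ^ n) -` B"
  have B1: "B1 \<in> sets borel" unfolding B1_def by (rule sets_vimage_height[OF Suc.prems(2)])
  have h1: "height 1 = 1 / 2" by (simp add: edge_translation_def power_int_minus)
  have dy: "1 - 2 * (2 ^ n * y) \<in> dyad (1 - k)" if "y \<in> B" for y
    using Suc.prems(3)[OF that] Suc.prems(1) by (simp add: exit_side_iff mult.assoc)
  have 1: "(1, 2 ^ n * y) \<in> exit_side 1" if "y \<in> B" for y
    using Suc.prems(1) dy[OF that] by (rule exit_side_1)
  have 2: "(1, 2 ^ n * y) \<in> exit_side (k + 1)" if "y \<in> B1" for y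
  proof -
    have "1 - 2 * (2 ^ n * (y - (1 / 2) / 2 ^ n)) \<in> dyad (1 - k)"
      using dy that by (simp add: B1_def h1)
    moreover have eq: "1 - 2 * (2 ^ n * (y - (1 / 2) / 2 ^ n)) = 2 * (1 - 2 ^ n * y)"
      by (simp add: right_diff_distrib)
    ultimately have "2 * (1 - 2 ^ n * y) \<in> dyad (1 - k)" by (simp only: eq)
    then have "1 - 2 ^ n * y \<in> dyad (1 - (k + 1))" unfolding dyad_double by (simp add: algebra_simps)
    then show ?thesis using Suc.prems(1) by (simp add: exit_side_iff)
  qed
  have jn: "mon n (k + 1) j \<in> {1..d}" using mon_in[of "k + 1"] Suc.prems by simp
  have "(\<lambda>y. y - height k / 2 ^ Suc n) -` B = (\<lambda>y. y - height (k + 1) / 2 ^ n) -` B1"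
  proof -
    have eq: "y - height k / 2 ^ Suc n = y - height (k + 1) / 2 ^ n - height 1 / 2 ^ n" for y
      unfolding height_renorm[OF Suc.prems(1)] by (simp add: field_simps)
    show ?thesis unfolding B1_def vimage_def eq by simp
  qed
  then have "emeasure (nu j) ((\<lambda>y. y - height k / 2 ^ Suc n) -` B) = emeasure (nu (mon n (k + 1) j)) B1"
    using Suc.IH[of "k + 1" B1 j] B1 2 Suc.prems by simp
  also have "\<dots> = emeasure (nu (mon n 1 (mon n (k + 1) j))) B"
    unfolding B1_def using Suc.IH[OF _ Suc.prems(2) 1 jn] by simp
  finally show ?case using Suc.prems(1) by (simp add: mon_Suc)
qed

lemma emeasure_nu_Diff:
  assumes "B \<in> sets borel" "y \<in> {0} \<union> range (\<lambda>n. 1 / 2 ^ n)" "j \<in> {1..d}"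
  shows "emeasure (nu j) (B - {y}) = emeasure (nu j) B"
proof -
  have "emeasure (nu j) {y} = 0" using assms nu_zero nu_power by blast
  then show ?thesis using assms by (intro emeasure_Diff_null_set null_setsI) auto
qed

text \<open>Edge 1 of level n lifts the lower half of the heights below 1 / 2^n onto the upper half.
  This is \<open>nu_renorm\<close> for k = 1, with the null endpoints put back.\<close>

lemma nu_half:
  assumes B: "B \<in> sets borel" "B \<subseteq> {0..<1 / 2 ^ Suc n}" and j: "j \<in> {1..d}"
  shows "emeasure (nu j) ((\<lambda>y. y - 1 / 2 ^ Suc n) -` B) = emeasure (nu (mon n 1 j)) B"
proof -
  let ?v = "\<lambda>B. (\<lambda>y :: real. y - 1 / 2 ^ Suc n) -` B"
  have h1: "height 1 / 2 ^ n = 1 / 2 ^ Suc n" by (simp add: edge_translation_def power_int_minus)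
  have jn: "mon n 1 j \<in> {1..d}" using mon_in j by simp
  have "(1, 2 ^ n * y) \<in> exit_side 1" if "y \<in> B - {0}" for y
  proof -
    have "0 < y" "y < 1 / 2 ^ Suc n" using B(2) that by auto
    then have "0 < 2 ^ n * y" "2 ^ n * y < 1 / 2" by (auto simp: field_simps)
    then show ?thesis by (auto simp: exit_side_iff dyad_def power_int_minus)
  qed
  then have "emeasure (nu j) (?v (B - {0})) = emeasure (nu (mon n 1 j)) (B - {0})"
    using nu_renorm[of 1 "B - {0}" n j] B(1) j unfolding h1 by simp
  moreover have "?v (B - {0}) = ?v B - {1 / 2 ^ Suc n}" by auto
  moreover have "?v B \<in> sets borel" by (rule sets_vimage_height[OF B(1)])
  ultimately have "emeasure (nu j) (?v B - {1 / 2 ^ Suc n}) = emeasure (nu (mon n 1 j)) (B - {0})"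
    "emeasure (nu j) (?v B - {1 / 2 ^ Suc n}) = emeasure (nu j) (?v B)"
    using emeasure_nu_Diff[of "?v B" "1 / 2 ^ Suc n" j, OF _ UnI2[OF rangeI]] j by simp_all
  moreover have "emeasure (nu (mon n 1 j)) (B - {0}) = emeasure (nu (mon n 1 j)) B"
    using B(1) jn by (intro emeasure_nu_Diff) auto
  ultimately show ?thesis by simp
qed

lemma finite_nu: "j \<in> {1..d} \<Longrightarrow> emeasure (nu j) B = ennreal (measure (nu j) B)"
proof -
  assume "j \<in> {1..d}"
  then have "emeasure (nu j) UNIV \<le> 1" by (simp add: emeasure_nu sheet_law_le_1)
  then have "emeasure (nu j) B \<le> 1" using emeasure_mono[of B UNIV "nu j"] by (simp add: order_trans)
  then have "emeasure (nu j) B \<noteq> \<infinity>" by (auto simp: top_unique)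
  then show ?thesis by (simp add: emeasure_eq_ennreal_measure)
qed

section \<open>The averaging recursion\<close>

definition level :: "nat \<Rightarrow> nat \<Rightarrow> real" where
  "level n j = 2 ^ n * measure (nu j) {0..<1 / 2 ^ n}"

text \<open>The lower half of the interval belongs to the next level; the upper half is by
  \<open>nu_half\<close> a copy of the lower half in sheet \<open>mon n 1 j\<close>. The factor 2^n
  turns the sum into a mean.\<close>

lemma level_step:
  assumes j: "j \<in> {1..d}"
  shows "level n j = (level (Suc n) j + level (Suc n) (mon n 1 j)) / 2"
proof -
  let ?B = "{0..<1 / 2 ^ Suc n} :: real set"
  have jn: "mon n 1 j \<in> {1..d}" using mon_in j by simp
  have v: "(\<lambda>y. y - 1 / 2 ^ Suc n) -` ?B = {1 / 2 ^ Suc n..<1 / 2 ^ n}"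
    by (auto simp: field_simps)
  have "(0::real) \<le> 1 / 2 ^ Suc n" "(1::real) / 2 ^ Suc n \<le> 1 / 2 ^ n" by (auto simp: field_simps)
  then have "?B \<union> {1 / 2 ^ Suc n..<1 / 2 ^ n} = {0..<1 / 2 ^ n}" by (rule ivl_disj_un)
  then have "emeasure (nu j) {0..<1 / 2 ^ n} = emeasure (nu j) (?B \<union> {1 / 2 ^ Suc n..<1 / 2 ^ n})" by simp
  also have "\<dots> = emeasure (nu j) ?B + emeasure (nu j) {1 / 2 ^ Suc n..<1 / 2 ^ n}"
    by (intro plus_emeasure[symmetric]) auto
  also have "\<dots> = emeasure (nu j) ?B + emeasure (nu (mon n 1 j)) ?B"
    using nu_half[of ?B n j] j by (simp only: v) simp
  finally have "measure (nu j) {0..<1 / 2 ^ n} = measure (nu j) ?B + measure (nu (mon n 1 j)) ?B"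
    using j jn by (simp add: finite_nu flip: ennreal_plus)
  then show ?thesis by (simp add: level_def algebra_simps)
qed

lemma level_sum: "(\<Sum>j\<in>{1..d}. level n j) = 1"
proof (induction n)
  case 0
  have "emeasure (nu j) UNIV = emeasure (nu j) {0..<1}" if j: "j \<in> {1..d}" for j
  proof -
    have N: "- {0<..<1} \<in> null_sets (nu j)" using nu_outside[OF j] by (intro null_setsI) auto
    have "emeasure (nu j) UNIV = emeasure (nu j) ({0..<1} \<union> - {0<..<1})"
      by (rule arg_cong[of _ _ "emeasure (nu j)"]) auto
    then show ?thesis using emeasure_Un_null_set[OF _ N, of "{0..<1}"] by simp
  qed
  then have "(\<Sum>j\<in>{1..d}. ennreal (level 0 j)) = (\<Sum>j\<in>{1..d}. emeasure (nu j) UNIV)"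
    by (intro sum.cong refl) (simp only: level_def finite_nu power_0 div_by_1 mult_1)
  then have "(\<Sum>j\<in>{1..d}. ennreal (level 0 j)) = 1" using sum_nu by simp
  then have "ennreal (\<Sum>j\<in>{1..d}. level 0 j) = 1" by (subst sum_ennreal[symmetric]) (auto simp: level_def)
  then show ?case by (simp add: level_def)
next
  case (Suc n)
  have "(\<Sum>j\<in>{1..d}. level (Suc n) (mon n 1 j)) = (\<Sum>j\<in>{1..d}. level (Suc n) j)"
    using sum.permute[OF mon_perm, of 1 "level (Suc n)" n] by (simp add: comp_def)
  moreover have "(\<Sum>j\<in>{1..d}. level n j) = (\<Sum>j\<in>{1..d}. (level (Suc n) j + level (Suc n) (mon n 1 j)) / 2)"
    by (intro sum.cong refl level_step)
  ultimately show ?case using Suc by (simp add: sum_divide_distrib[symmetric] sum.distrib)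
qed

lemma not_square_between:
  fixes k l n :: nat
  assumes "k\<^sup>2 < n" "n < (Suc k)\<^sup>2" shows "n \<noteq> l\<^sup>2"
proof
  assume "n = l\<^sup>2"
  then have "k < l" "l < Suc k"
    using assms power_less_imp_less_base[of k 2 l] power_less_imp_less_base[of l 2 "Suc k"] by blast+
  then show False by simp
qed

lemma level_after_square:
  assumes "j \<in> {1..d}" shows "level (Suc (k\<^sup>2)) j = level ((Suc k)\<^sup>2) j"
proof -
  have "Suc (k\<^sup>2) \<le> (Suc k)\<^sup>2" by (simp add: power2_eq_square)
  then show ?thesis
  proof (induction rule: inc_induct)
    case (step n)
    have "mon n 1 = id" by (intro mon_nonsquare not_square_between[of k n]) (use step.hyps in linarith)+
    then have "level n j = level (Suc n) j" using level_step[OF assms, of n] by simp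
    then show ?case using step.IH by simp
  qed simp
qed

lemma level_const:
  assumes j: "j \<in> {1..d}" shows "level n j = 1 / d"
proof -
  \<comment> \<open>One step of \<open>averaging_constant\<close> is the passage from a square to
    the next: by \<open>level_after_square\<close> only its first index averages.\<close>
  have sq: "level (k\<^sup>2) j = 1 / d" if j: "j \<in> {1..d}" for k j
  proof (rule averaging_constant[of m s d "\<lambda>k. level (k\<^sup>2)" j k, OF m_pos s_perm _ _ level_sum s_trans j])
    fix k i assume i: "i \<in> {1..d}"
    then have "mon (k\<^sup>2) 1 i \<in> {1..d}" using mon_in by simp
    then have si: "s (k mod m) i \<in> {1..d}" by (simp only: mon_square)
    show "level (k\<^sup>2) i = (level ((Suc k)\<^sup>2) i + level ((Suc k)\<^sup>2) (s (k mod m) i)) / 2"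
      using level_step[OF i, of "k\<^sup>2"] level_after_square[OF i, of k] level_after_square[OF si, of k]
      by (simp only: mon_square)
    show "0 \<le> level (k\<^sup>2) i" by (simp add: level_def)
  qed
  \<comment> \<open>The constant is carried down from the square n^2 \<ge> n to n by the
    averaging.\<close>
  have "n \<le> n\<^sup>2" by (simp add: power2_eq_square)
  then have "\<forall>j\<in>{1..d}. level n j = 1 / d"
  proof (induction rule: inc_induct)
    case (step n)
    show ?case
    proof
      fix j assume j: "j \<in> {1..d}"
      then have "mon n 1 j \<in> {1..d}" using mon_in by simp
      then show "level n j = 1 / d" using level_step[OF j, of n] step.IH j by simp
    qed
  qed (use sq in blast)
  then show ?thesis using j by blast
qed

text \<open>Strip the leading binary digit 2^r of k: by \<open>nu_half\<close> the interval is a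
  copy of the one for k - 2^r in some other sheet or the same one. When no digit is left,
  \<open>level_const\<close> gives the mass.\<close>

lemma nu_dyadic:
  assumes "k < 2 ^ l" "j \<in> {1..d}"
  shows "emeasure (nu j) {real k / 2 ^ l..<real (Suc k) / 2 ^ l} = ennreal (1 / d / 2 ^ l)"
  using assms
proof (induction k arbitrary: j rule: less_induct)
  case (less k)
  show ?case
  proof (cases "k = 0")
    case True
    have "measure (nu j) {0..<1 / 2 ^ l} = 1 / d / 2 ^ l"
      using level_const[OF less.prems(2), of l] unfolding level_def
      by (metis nonzero_mult_div_cancel_left power_not_zero zero_neq_numeral)
    then show ?thesis using True finite_nu[OF less.prems(2)] by simp
  next
    case False
    then obtain r where r: "2 ^ r \<le> k" "k < 2 ^ (r + 1)" using ex_power_ivl1[of 2 k] by auto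
    have "(2::nat) ^ r < 2 ^ l" by (rule le_less_trans[OF r(1) less.prems(1)])
    then have "r < l" by simp
    \<comment> \<open>Chosen so that 1 / 2^(n+1) equals 2^r / 2^l, the contribution of the leading
      digit.\<close>
    define n where "n = l - r - 1"
    have n: "(1::real) / 2 ^ Suc n = 2 ^ r / 2 ^ l"
      using \<open>r < l\<close> power_diff[of "2::real" r l] by (simp add: n_def Suc_diff_Suc field_simps)
    let ?k = "k - 2 ^ r"
    let ?B = "{real ?k / 2 ^ l..<real (Suc ?k) / 2 ^ l}"
    have rk: "real ?k = real k - 2 ^ r" using r by (simp add: of_nat_diff)
    have "real (Suc ?k) \<le> 2 ^ r"
    proof -
      have "Suc ?k \<le> 2 ^ r" using r by simp
      then have "real (Suc ?k) \<le> real (2 ^ r)" by (simp only: of_nat_le_iff)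
      then show ?thesis by simp
    qed
    then have "real (Suc ?k) / 2 ^ l \<le> 1 / 2 ^ Suc n"
      unfolding n by (intro divide_right_mono) auto
    then have sub: "?B \<subseteq> {0..<1 / 2 ^ Suc n}" by auto
    have "(\<lambda>y. y - 1 / 2 ^ Suc n) -` ?B = {real k / 2 ^ l..<real (Suc k) / 2 ^ l}"
    proof -
      have v: "(\<lambda>y. y - c) -` {a..<b} = {a + c..<b + c}" for a b c :: real by auto
      have "real k / 2 ^ l = real ?k / 2 ^ l + 2 ^ r / 2 ^ l" "real (Suc k) / 2 ^ l = real (Suc ?k) / 2 ^ l + 2 ^ r / 2 ^ l"
        using rk by (simp_all add: add_divide_distrib[symmetric])
      then show ?thesis by (simp only: n v)
    qed
    then have "emeasure (nu j) {real k / 2 ^ l..<real (Suc k) / 2 ^ l} = emeasure (nu (mon n 1 j)) ?B"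
      using nu_half[OF _ sub less.prems(2)] by simp
    also have "\<dots> = ennreal (1 / d / 2 ^ l)"
      using less.IH[of ?k "mon n 1 j"] less.prems r(1) mon_in False by simp
    finally show ?thesis .
  qed
qed

section \<open>Recovering the measure from its transverse measures\<close>

abbreviation unit_law :: "real measure" where
  "unit_law \<equiv> uniform_measure lborel {0..<1}"

lemma prob_unit_law: "prob_space unit_law"
  by (rule prob_space_uniform_measure) auto

lemma nu_eq:
  assumes j: "j \<in> {1..d}" shows "nu j = scale_measure (ennreal (1 / d)) unit_law"
proof (rule measure_eq_dyadic)
  have "emeasure (nu j) (- {0..<1}) \<le> emeasure (nu j) (- {0<..<1})" by (intro emeasure_mono) auto
  then show "emeasure (nu j) (- {0..<1}) = 0" using nu_outside[OF j] by simp
qed (use j nu_dyadic in auto)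

text \<open>With the heights B fixed, slices of equal width have equal mass, so the law of the
  abscissa is a multiple of Lebesgue measure.\<close>

lemma sheet_law_strip:
  assumes B: "B \<in> sets borel" "B \<subseteq> {0<..<1}" and j: "j \<in> {1..d}" and A: "A \<in> sets borel"
  shows "emeasure (sheet_law j) (A \<times> B) = emeasure unit_law A * emeasure (nu j) B"
proof -
  let ?R = "restrict_space (sheet_law j) (UNIV \<times> B)"
  let ?S = "distr ?R borel fst"
  have sB: "UNIV \<times> B \<in> sets (sheet_law j)" using B by simp
  have fst: "fst \<in> measurable ?R borel"
  proof (rule measurable_restrict_space1)
    show "fst \<in> measurable (sheet_law j) borel"
      by (subst measurable_cong_sets[OF sets_sheet_law refl])
        (intro borel_measurable_continuous_onI continuous_intros)
  qed
  have S: "emeasure ?S C = emeasure (sheet_law j) (C \<times> B)" if "C \<in> sets borel" for C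
  proof -
    have "fst -` C \<inter> space ?R = C \<times> B" by (auto simp: space_restrict_space)
    then have "emeasure ?S C = emeasure ?R (C \<times> B)" using that fst by (simp only: emeasure_distr)
    also have "\<dots> = emeasure (sheet_law j) (C \<times> B)" using sB by (subst emeasure_restrict_space) auto
    finally show ?thesis .
  qed
  define c where "c = measure (nu j) B"
  have c: "emeasure (nu j) B = ennreal c" "0 \<le> c" using finite_nu[OF j] by (simp_all add: c_def)
  have "?S = scale_measure (ennreal c) unit_law"
  proof (rule measure_eq_dyadic)
    have "emeasure ?S (- {0..<1}) = emeasure (sheet_law j) ((- {0..<1}) \<times> B)" by (rule S) simp
    also have "\<dots> = emeasure (sheet_law j) {}"
      using B j by (intro sheet_law_cong) (auto dest: half_square_bounds)
    finally show "emeasure ?S (- {0..<1}) = 0" by simp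
    fix l k :: nat assume k: "k < 2 ^ l"
    let ?e = "emeasure (sheet_law j) ({0..<1 / 2 ^ l} \<times> B)"
    have slice: "emeasure (sheet_law j) ({real k / 2 ^ l..<real (Suc k) / 2 ^ l} \<times> B) = ?e" if k: "k < 2 ^ l" for k
    proof -
      have "real (Suc k) \<le> real (2 ^ l)" using k by (simp only: of_nat_le_iff Suc_le_eq)
      then have "real k / 2 ^ l + 1 / 2 ^ l \<le> 1" by (simp add: field_simps)
      from sheet_law_slice[OF _ _ this B j] show ?thesis by (simp add: add_divide_distrib algebra_simps)
    qed
    \<comment> \<open>Adding up 2^l slices identifies the mass of a single one as c / 2^l.\<close>
    have "emeasure (sheet_law j) ({0..<real k / 2 ^ l} \<times> B) = of_nat k * ?e" if "k \<le> 2 ^ l" for k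
      using that
    proof (induction k)
      case (Suc k)
      have "0 \<le> real k / 2 ^ l" "real k / 2 ^ l \<le> real (Suc k) / 2 ^ l" by (auto intro: divide_right_mono)
      then have "{0..<real k / 2 ^ l} \<union> {real k / 2 ^ l..<real (Suc k) / 2 ^ l} = {0..<real (Suc k) / 2 ^ l}"
        by (rule ivl_disj_un)
      then have "{0..<real (Suc k) / 2 ^ l} \<times> B = {0..<real k / 2 ^ l} \<times> B \<union> {real k / 2 ^ l..<real (Suc k) / 2 ^ l} \<times> B"
        by blast
      then have "emeasure (sheet_law j) ({0..<real (Suc k) / 2 ^ l} \<times> B) =
          emeasure (sheet_law j) ({0..<real k / 2 ^ l} \<times> B) + emeasure (sheet_law j) ({real k / 2 ^ l..<real (Suc k) / 2 ^ l} \<times> B)"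
        using B by (simp only:) (intro plus_emeasure[symmetric], auto)
      then show ?case using Suc slice[of k] by (simp add: algebra_simps)
    qed simp
    from this[of "2 ^ l"] have "emeasure (sheet_law j) ({0..<1} \<times> B) = of_nat (2 ^ l) * ?e" by simp
    moreover have "emeasure (sheet_law j) ({0..<1} \<times> B) = ennreal c"
      unfolding c(1)[symmetric] emeasure_nu[OF B(1)]
      using B j by (intro sheet_law_cong) (auto dest: half_square_bounds)
    ultimately have e: "ennreal c = of_nat (2 ^ l) * ?e" by simp
    have fe: "?e = ennreal (measure (sheet_law j) ({0..<1 / 2 ^ l} \<times> B))" (is "_ = ennreal ?m")
      using finite_measure.emeasure_eq_measure[OF finite_measure_sheet_law[OF j]] .
    have "ennreal c = ennreal (2 ^ l * ?m)" using e fe by (simp add: ennreal_mult ennreal_of_nat_eq_real_of_nat ennreal_power)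
    then have "c = 2 ^ l * ?m" using c(2) by simp
    then have "?e = ennreal (c / 2 ^ l)" using fe by simp
    then show "emeasure ?S {real k / 2 ^ l..<real (Suc k) / 2 ^ l} = ennreal (c / 2 ^ l)"
      using slice[OF k] by (simp add: S)
  qed (use c in simp_all)
  then have "emeasure (sheet_law j) (A \<times> B) = emeasure (scale_measure (ennreal c) unit_law) A"
    using S[OF A] by simp
  then show ?thesis by (simp add: c(1) mult.commute)
qed

lemma sheet_law_eq:
  assumes j: "j \<in> {1..d}"
  shows "sheet_law j = unit_law \<Otimes>\<^sub>M scale_measure (ennreal (1 / d)) unit_law"
proof -
  interpret U: prob_space unit_law by (rule prob_unit_law)
  have "emeasure (nu j) (space (nu j)) \<noteq> \<infinity>" using finite_nu[OF j, of UNIV] by simp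
  then have fin: "finite_measure (nu j)" by (rule finite_measureI)
  have "unit_law \<Otimes>\<^sub>M nu j = sheet_law j"
  proof (rule pair_measure_eqI)
    show "sigma_finite_measure unit_law" by unfold_locales
    show "sigma_finite_measure (nu j)" using fin by (simp add: finite_measure_def)
    have "sets (unit_law \<Otimes>\<^sub>M nu j) = sets (lborel \<Otimes>\<^sub>M lborel)" by (rule sets_pair_measure_cong) auto
    also have "\<dots> = sets (sheet_law j)" by (subst lborel_prod) simp
    finally show "sets (unit_law \<Otimes>\<^sub>M nu j) = sets (sheet_law j)" .
    fix A B :: "real set" assume "A \<in> sets unit_law" "B \<in> sets (nu j)"
    then have A: "A \<in> sets borel" and B: "B \<in> sets borel" by simp_all
    let ?B = "B \<inter> {0<..<1}"
    have N: "- {0<..<1} \<in> null_sets (nu j)" using nu_outside[OF j] by (intro null_setsI) auto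
    have "emeasure (nu j) B = emeasure (nu j) (B - - {0<..<1})"
      using B by (intro emeasure_Diff_null_set[OF N, symmetric]) simp
    also have "B - - {0<..<1} = ?B" by auto
    finally have 1: "emeasure (nu j) B = emeasure (nu j) ?B" .
    have "UNIV \<times> - {0<..<1} \<in> null_sets (sheet_law j)"
      using nu_outside[OF j] by (intro null_setsI) (auto simp: emeasure_nu)
    from emeasure_Diff_null_set[OF this, of "A \<times> B"] A B
    have "emeasure (sheet_law j) (A \<times> B) = emeasure (sheet_law j) (A \<times> B - UNIV \<times> - {0<..<1})" by simp
    also have "A \<times> B - UNIV \<times> - {0<..<1} = A \<times> ?B" by auto
    also have "emeasure (sheet_law j) (A \<times> ?B) = emeasure unit_law A * emeasure (nu j) ?B"
      using A B j by (intro sheet_law_strip) auto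
    finally show "emeasure unit_law A * emeasure (nu j) B = emeasure (sheet_law j) (A \<times> B)"
      using 1 by simp
  qed
  then show ?thesis using nu_eq[OF j] by simp
qed

text \<open>The right-hand side does not mention M, so all invariant probability measures agree, and
  \<open>area\<close> is one of them.\<close>

lemma emeasure_M:
  assumes A: "A \<in> sets (cover_borel d h)"
  shows "emeasure M A =
    (\<Sum>j\<in>{1..d}. emeasure (unit_law \<Otimes>\<^sub>M scale_measure (ennreal (1 / d)) unit_law) (sheet_part j A))"
proof -
  have As: "A \<subseteq> surface" using A sets.sets_into_space space_cover_borel by blast
  have part: "sheet_part j A \<inter> half_square = sheet_part j A" for j by (auto simp: sheet_part_def)
  have "emeasure M A = emeasure M (\<Union>j\<in>{1..d}. emb j ` sheet_part j A)"
    using surface_part_eq[OF As] by simp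
  also have "\<dots> = (\<Sum>j\<in>{1..d}. emeasure M (emb j ` sheet_part j A))"
  proof (rule sum_emeasure[symmetric])
    have "emb j ` sheet_part j A \<in> sets M" if "j \<in> {1..d}" for j
      using sets_emb[OF sets_sheet_part[OF A that] that] by (simp add: part sets_M)
    then show "(\<lambda>j. emb j ` sheet_part j A) ` {1..d} \<subseteq> sets M" by blast
    show "disjoint_family_on (\<lambda>j. emb j ` sheet_part j A) {1..d}"
      unfolding disjoint_family_on_def sheet_part_def using emb_eq_iff by blast
  qed auto
  also have "\<dots> = (\<Sum>j\<in>{1..d}. emeasure (sheet_law j) (sheet_part j A))"
    by (intro sum.cong refl) (simp add: emeasure_sheet_law sets_sheet_part[OF A] part)
  finally show ?thesis by (simp add: sheet_law_eq)
qed

end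

context renormalized_cover
begin

lemma renormalized_measureI:
  "sets M = sets (cover_borel d h) \<Longrightarrow> prob_space M \<Longrightarrow> flow_invariant d h M \<Longrightarrow>
     renormalized_measure d h mon s m M"
  by (simp add: renormalized_measure_def renormalized_cover_axioms invariant_measure_def
      invariant_measure_axioms_def sheeted_cover_axioms)

lemma uniquely_ergodic: "uniquely_ergodic d h"
  unfolding uniquely_ergodic_def
proof (intro subset_antisym subsetI)
  fix M
  assume M: "M \<in> {M. space M = surface \<and> sets M = sets (cover_borel d h) \<and> prob_space M \<and> flow_invariant d h M}"
  then interpret M: renormalized_measure d h mon s m M by (intro renormalized_measureI) auto
  interpret N: renormalized_measure d h mon s m area
    by (intro renormalized_measureI sets_area prob_space_area flow_invariant_area)
  have "M = area"
    by (rule measure_eqI) (auto simp: M.sets_M sets_area M.emeasure_M N.emeasure_M)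
  then show "M \<in> {area}" by simp
next
  fix M assume "M \<in> {area}"
  then show "M \<in> {M. space M = surface \<and> sets M = sets (cover_borel d h) \<and> prob_space M \<and> flow_invariant d h M}"
    using space_area sets_area prob_space_area flow_invariant_area by simp
qed

end

section \<open>Prescribed monodromies and accumulation points\<close>

definition letter_perm :: "(int \<Rightarrow> nat \<Rightarrow> nat) \<Rightarrow> letter \<Rightarrow> nat \<Rightarrow> nat" where
  "letter_perm f x = (if snd x then f (fst x) else inv' (f (fst x)))"

primrec word_perm :: "(int \<Rightarrow> nat \<Rightarrow> nat) \<Rightarrow> letter list \<Rightarrow> nat \<Rightarrow> nat" where
  "word_perm f [] = id"
| "word_perm f (x # w) = letter_perm f x \<circ> word_perm f w"

definition free_hom :: "(int \<Rightarrow> nat \<Rightarrow> nat) \<Rightarrow> letter list \<Rightarrow> nat \<Rightarrow> nat" where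
  "free_hom f = restrict (word_perm f) (carrier Gam)"

lemma subgroup_perm: "subgroup H (sym_group d) \<Longrightarrow> p \<in> H \<Longrightarrow> p permutes {1..d}"
  using subgroup.subset sym_group_carrier by blast

lemma subgroup_comp: "subgroup H (sym_group d) \<Longrightarrow> p \<in> H \<Longrightarrow> q \<in> H \<Longrightarrow> p \<circ> q \<in> H"
  using subgroup.m_closed[of H "sym_group d" p q] by (simp add: sym_group_mult)

lemma subgroup_inv': "subgroup H (sym_group d) \<Longrightarrow> p \<in> H \<Longrightarrow> inv' p \<in> H"
  using subgroup.m_inv_closed[of H "sym_group d" p] subgroup_perm[of H d p]
  by (simp add: sym_group_carrier)

lemma subgroup_id: "subgroup H (sym_group d) \<Longrightarrow> id \<in> H"
  using subgroup.one_closed[of H "sym_group d"] by (simp add: sym_group_one)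

lemma foldr_push_in_Gam: "u \<in> carrier Gam \<Longrightarrow> v \<in> carrier Gam \<Longrightarrow> foldr push u v \<in> carrier Gam"
  by (simp add: Gam_def reduced_foldr_push)

text \<open>The universal property of the free group: \<open>push\<close> cancels only mutually
  inverse letters, and their permutations cancel as well.\<close>

lemma free_hom_in_Hom:
  assumes G: "subgroup G (sym_group d)" and f: "\<And>n. f n \<in> G"
  shows "free_hom f \<in> Hom d G" "free_hom f (gen n) = f n"
proof -
  have perm: "f n permutes {1..d}" for n using subgroup_perm[OF G f] .
  have l: "letter_perm f x \<in> G" for x using f subgroup_inv'[OF G] by (simp add: letter_perm_def)
  have e: "word_perm f w \<in> G" for w
  proof (induction w)
    case Nil
    show ?case unfolding word_perm.simps by (rule subgroup_id[OF G])
  next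
    case (Cons x w)
    show ?case unfolding word_perm.simps by (rule subgroup_comp[OF G l Cons])
  qed
  have inv_l: "letter_perm f x \<circ> letter_perm f (inv_letter x) = id" for x
    by (cases x) (auto simp: letter_perm_def permutes_inv_o[OF perm])
  have push: "word_perm f (push x w) = letter_perm f x \<circ> word_perm f w" for x w
  proof (cases "\<exists>v. w = inv_letter x # v")
    case True
    then obtain v where v: "w = inv_letter x # v" by blast
    have "letter_perm f x \<circ> word_perm f w = (letter_perm f x \<circ> letter_perm f (inv_letter x)) \<circ> word_perm f v"
      by (simp only: v word_perm.simps o_assoc)
    also have "\<dots> = word_perm f v" unfolding inv_l by simp
    finally show ?thesis by (simp add: v)
  next
    case False
    then have "push x w = x # w" by (cases w) auto
    then show ?thesis by (simp only: word_perm.simps)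
  qed
  have app: "word_perm f (foldr push u v) = word_perm f u \<circ> word_perm f v" for u v
  proof (induction u)
    case (Cons x u)
    then show ?case by (simp only: foldr_Cons comp_apply push word_perm.simps o_assoc)
  qed simp
  have "free_hom f \<in> hom Gam (sym_group d\<lparr>carrier := G\<rparr>)"
  proof (rule homI)
    fix u assume "u \<in> carrier Gam"
    then show "free_hom f u \<in> carrier (sym_group d\<lparr>carrier := G\<rparr>)" using e by (simp add: free_hom_def)
  next
    fix u v assume uv: "u \<in> carrier Gam" "v \<in> carrier Gam"
    have "u \<otimes>\<^bsub>Gam\<^esub> v = foldr push u v" by (simp add: Gam_def)
    then show "free_hom f (u \<otimes>\<^bsub>Gam\<^esub> v) = free_hom f u \<otimes>\<^bsub>sym_group d\<lparr>carrier := G\<rparr>\<^esub> free_hom f v"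
      using uv foldr_push_in_Gam[OF uv] app by (simp add: free_hom_def sym_group_mult)
  qed
  then show "free_hom f \<in> Hom d G" by (simp add: Hom_def free_hom_def)
  show "free_hom f (gen n) = f n" using gen_in_Gam[of n] by (simp add: free_hom_def gen_def letter_perm_def)
qed

lemma Hom_mult:
  assumes "h \<in> Hom d G" "u \<in> carrier Gam" "v \<in> carrier Gam"
  shows "h (u \<otimes>\<^bsub>Gam\<^esub> v) = h u \<circ> h v"
  using assms by (simp add: Hom_def hom_def sym_group_mult)

lemma Hom_in: "h \<in> Hom d G \<Longrightarrow> u \<in> carrier Gam \<Longrightarrow> h u \<in> G"
  by (auto simp: Hom_def hom_def)

lemma Hom_inv:
  assumes G: "subgroup G (sym_group d)" and h: "h \<in> Hom d G" and u: "u \<in> carrier Gam"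
  shows "h (inv\<^bsub>Gam\<^esub> u) = inv' (h u)"
proof -
  interpret group Gam by (rule group_Gam)
  have p: "h v permutes {1..d}" if "v \<in> carrier Gam" for v using subgroup_perm[OF G Hom_in[OF h that]] .
  have "h \<one>\<^bsub>Gam\<^esub> \<circ> h \<one>\<^bsub>Gam\<^esub> = h \<one>\<^bsub>Gam\<^esub>" using Hom_mult[OF h one_closed one_closed] by simp
  then have "inv' (h \<one>\<^bsub>Gam\<^esub>) \<circ> (h \<one>\<^bsub>Gam\<^esub> \<circ> h \<one>\<^bsub>Gam\<^esub>) = inv' (h \<one>\<^bsub>Gam\<^esub>) \<circ> h \<one>\<^bsub>Gam\<^esub>" by simp
  then have one: "h \<one>\<^bsub>Gam\<^esub> = id" by (simp add: o_assoc permutes_inv_o(2)[OF p[OF one_closed]])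
  have "h u \<circ> h (inv\<^bsub>Gam\<^esub> u) = id" using Hom_mult[OF h u inv_closed[OF u]] u one by simp
  then have "inv' (h u) \<circ> (h u \<circ> h (inv\<^bsub>Gam\<^esub> u)) = inv' (h u)" by simp
  then show ?thesis by (simp add: o_assoc permutes_inv_o(2)[OF p[OF u]])
qed

lemma Hom_subgroupI:
  assumes G: "subgroup G (sym_group d)" and h: "h \<in> Hom d G"
    and H: "subgroup H (sym_group d)" and gens: "\<And>n. h (gen n) \<in> H"
  shows "h \<in> Hom d H"
proof -
  interpret group Gam by (rule group_Gam)
  have "h w \<in> H" if "w \<in> carrier Gam" for w
    using that
  proof (induction w)
    case Nil
    have "h \<one>\<^bsub>Gam\<^esub> = h (gen 0 \<otimes>\<^bsub>Gam\<^esub> inv\<^bsub>Gam\<^esub> (gen 0))" using gen_in_Gam by simp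
    also have "\<dots> = h (gen 0) \<circ> inv' (h (gen 0))"
      using Hom_mult[OF h gen_in_Gam inv_closed[OF gen_in_Gam]] Hom_inv[OF G h gen_in_Gam] by simp
    finally have "h \<one>\<^bsub>Gam\<^esub> \<in> H" using subgroup_comp[OF H gens subgroup_inv'[OF H gens]] by simp
    then show ?case by (simp add: Gam_def)
  next
    case (Cons x w)
    have w: "w \<in> carrier Gam" using Cons.prems reduced_tl by (simp add: Gam_def)
    have x: "[x] \<in> carrier Gam" by (simp add: Gam_def)
    have "[x] \<otimes>\<^bsub>Gam\<^esub> w = x # w"
      using Cons.prems by (cases w) (auto simp: Gam_def)
    then have "h (x # w) = h [x] \<circ> h w" using Hom_mult[OF h x w] by simp
    moreover have "h [x] \<in> H"
    proof (cases "snd x")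
      case True
      then have "[x] = gen (fst x)" by (simp add: gen_def prod_eq_iff)
      then show ?thesis using gens by simp
    next
      case False
      then have "gen (fst x) \<otimes>\<^bsub>Gam\<^esub> [x] = \<one>\<^bsub>Gam\<^esub>"
        by (cases x) (simp add: Gam_def gen_def)
      then have "[x] = inv\<^bsub>Gam\<^esub> (gen (fst x))"
        using inv_solve_left'[of "gen (fst x)" "\<one>\<^bsub>Gam\<^esub>" "[x]"] inv_equality[of "gen (fst x)" "[x]"]
          x gen_in_Gam r_inv by (metis inv_comm inv_equality)
      then show ?thesis using Hom_inv[OF G h gen_in_Gam] subgroup_inv'[OF H gens] by simp
    qed
    ultimately show ?case using subgroup_comp[OF H _ Cons.IH[OF w]] by (simp only:)
  qed
  then show ?thesis using h by (auto simp: Hom_def hom_def)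
qed

section \<open>Iterating the automorphism\<close>

lemma phi_pullback_in_Hom:
  assumes h: "h \<in> Hom d G" shows "phi_pullback n h \<in> Hom d G"
proof -
  have "(phi_inv ^^ n) \<in> hom Gam Gam"
  proof (induction n)
    case 0
    then show ?case by (simp add: hom_def Pi_iff id_def)
  next
    case (Suc n)
    then show ?case using phi_inv_hom by (auto simp: hom_def Pi_iff)
  qed
  moreover have "h \<in> hom Gam (sym_group d\<lparr>carrier := G\<rparr>)" using h by (simp add: Hom_def)
  ultimately have "h \<circ> (phi_inv ^^ n) \<in> hom Gam (sym_group d\<lparr>carrier := G\<rparr>)"
    by (rule hom_compose)
  then show ?thesis
    using group.is_monoid[OF group_Gam]
    by (auto simp: Hom_def phi_pullback_def hom_def Pi_iff monoid.m_closed)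
qed

lemma phi_pullback_Suc:
  "w \<in> carrier Gam \<Longrightarrow> phi_pullback (Suc n) h w = phi_pullback n h (phi_inv w)"
  by (simp only: phi_pullback_def phi_inv_in_Gam restrict_apply' funpow_Suc_right comp_apply)

lemma phi_pullback_gen:
  assumes G: "subgroup G (sym_group d)" and h: "h \<in> Hom d G"
  shows "k > 0 \<Longrightarrow> phi_pullback (Suc n) h (gen k) = phi_pullback n h (gen 1) \<circ> phi_pullback n h (gen (k + 1))"
    and "phi_pullback (Suc n) h (gen 0) = phi_pullback n h (gen 1)"
    and "k < 0 \<Longrightarrow> phi_pullback (Suc n) h (gen k) =
      phi_pullback n h (gen (k + 1)) \<circ> inv' (phi_pullback n h (gen 1))"
proof -
  interpret group Gam by (rule group_Gam)
  note hn = phi_pullback_in_Hom[OF h, of n]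
  note * = phi_pullback_Suc[OF gen_in_Gam] phi_inv_gen phi_gen_def
  show "k > 0 \<Longrightarrow> phi_pullback (Suc n) h (gen k) = phi_pullback n h (gen 1) \<circ> phi_pullback n h (gen (k + 1))"
    using Hom_mult[OF hn gen_in_Gam gen_in_Gam] by (simp add: *)
  show "phi_pullback (Suc n) h (gen 0) = phi_pullback n h (gen 1)" by (simp add: *)
  show "k < 0 \<Longrightarrow> phi_pullback (Suc n) h (gen k) =
      phi_pullback n h (gen (k + 1)) \<circ> inv' (phi_pullback n h (gen 1))"
    using Hom_mult[OF hn gen_in_Gam inv_closed[OF gen_in_Gam]] Hom_inv[OF G hn gen_in_Gam] by (simp add: *)
qed

text \<open>Write a_l for the value of the l-th pullback at \<open>gen 1\<close>. Solving the
  recursion, the n-th pullback at \<open>gen k\<close> is a product of a_n, ..., a_(n+k-1) and their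
  inverses if k > 0, and of a_(n-1-|k|), ..., a_(n-1) and their inverses if k \<le> 0.\<close>

lemma phi_pullback_window:
  assumes G: "subgroup G (sym_group d)" and h: "h \<in> Hom d G" and H: "subgroup H (sym_group d)"
    and n: "N < n" and window: "\<And>l. n \<le> l + N + 1 \<Longrightarrow> l \<le> n + N \<Longrightarrow> phi_pullback l h (gen 1) \<in> H"
    and k: "\<bar>k\<bar> \<le> int N"
  shows "phi_pullback n h (gen k) \<in> H"
proof -
  let ?a = "\<lambda>l. phi_pullback l h (gen 1)"
  have perm: "?a l permutes {1..d}" for l
    using subgroup_perm[OF G Hom_in[OF phi_pullback_in_Hom[OF h] gen_in_Gam]] .
  have pos: "phi_pullback l h (gen (int i + 1)) \<in> H" if "\<And>r. r \<le> i \<Longrightarrow> ?a (l + r) \<in> H" for l i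
    using that
  proof (induction i arbitrary: l)
    case 0
    then show ?case using 0[of 0] by simp
  next
    case (Suc i)
    have "phi_pullback (Suc l) h (gen (int i + 1)) \<in> H"
    proof (rule Suc.IH)
      fix r assume "r \<le> i"
      then show "?a (Suc l + r) \<in> H" using Suc.prems[of "Suc r"] by simp
    qed
    then have "?a l \<circ> phi_pullback l h (gen (int (Suc i) + 1)) \<in> H"
      using phi_pullback_gen(1)[OF G h, of "int i + 1" l] by (simp add: algebra_simps)
    moreover have "inv' (?a l) \<in> H" using Suc.prems[of 0] subgroup_inv'[OF H] by simp
    ultimately have "inv' (?a l) \<circ> (?a l \<circ> phi_pullback l h (gen (int (Suc i) + 1))) \<in> H"
      using subgroup_comp[OF H] by blast
    then show ?case by (simp add: o_assoc permutes_inv_o(2)[OF perm])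
  qed
  have neg: "phi_pullback (Suc (l + i)) h (gen (- int i)) \<in> H" if "\<And>r. r \<le> i \<Longrightarrow> ?a (l + r) \<in> H" for l i
    using that
  proof (induction i)
    case 0
    then show ?case using 0[of 0] phi_pullback_gen(2)[OF G h, of l] by simp
  next
    case (Suc i)
    have "phi_pullback (Suc (l + i)) h (gen (- int i)) \<in> H" using Suc.IH Suc.prems by simp
    moreover have "inv' (?a (Suc (l + i))) \<in> H" using Suc.prems[of "Suc i"] subgroup_inv'[OF H] by simp
    ultimately have "phi_pullback (Suc (l + i)) h (gen (- int i)) \<circ> inv' (?a (Suc (l + i))) \<in> H"
      by (rule subgroup_comp[OF H])
    moreover have "- int (Suc i) + 1 = - int i" "- int (Suc i) < 0" by simp_all
    ultimately show ?case
      using phi_pullback_gen(3)[OF G h, of "- int (Suc i)" "Suc (l + i)"] by (simp only: add_Suc_right)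
  qed
  show ?thesis
  proof (cases "k > 0")
    case True
    define i where "i = nat k - 1"
    have i: "k = int i + 1" "i < N" using True k by (auto simp: i_def)
    show ?thesis unfolding i(1)
    proof (rule pos)
      fix r assume "r \<le> i"
      then show "?a (n + r) \<in> H" using i by (intro window) auto
    qed
  next
    case False
    define i where "i = nat (- k)"
    have i: "k = - int i" "i \<le> N" using False k by (auto simp: i_def)
    \<comment> \<open>The subtraction is exact because i \<le> N < n.\<close>
    define l where "l = n - 1 - i"
    have l: "n = Suc (l + i)" using n i by (simp add: l_def)
    have "phi_pullback (Suc (l + i)) h (gen (- int i)) \<in> H"
    proof (rule neg)
      fix r assume "r \<le> i"
      then show "?a (l + r) \<in> H" using i l by (intro window) auto
    qed
    then show ?thesis using i l by simp
  qed
qed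

text \<open>The monodromies prescribed by \<open>a\<close> are \<open>a\<^sub>0\<inverse> \<cdots> a\<^sub>k\<^sub>-\<^sub>1\<inverse> a\<^sub>k\<close>, the
  solution of the recursion for \<open>\<phi>\<^sub>\<beta>\<inverse>\<close> on the positive generators.\<close>

fun prescribed :: "(nat \<Rightarrow> nat \<Rightarrow> nat) \<Rightarrow> nat \<Rightarrow> nat \<Rightarrow> nat" where
  "prescribed a 0 = a 0"
| "prescribed a (Suc k) = inv' (a 0) \<circ> prescribed (\<lambda>i. a (Suc i)) k"

lemma prescribed_in:
  "subgroup G (sym_group d) \<Longrightarrow> (\<And>i. a i \<in> G) \<Longrightarrow> prescribed a k \<in> G"
proof (induction k arbitrary: a)
  case (Suc k)
  show ?case
    unfolding prescribed.simps by (intro subgroup_comp[OF Suc.prems(1)] subgroup_inv'[OF Suc.prems(1)] Suc)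
qed simp

lemma ex_Hom_prescribed:
  assumes G: "subgroup G (sym_group d)" and a: "\<And>n. a n \<in> G"
  shows "\<exists>h\<in>Hom d G. \<forall>n. phi_pullback n h (gen 1) = a n"
proof -
  \<comment> \<open>Positive generators are mapped to words in positive generators, so the values at
    the others are free and set to \<open>id\<close>.\<close>
  define h where "h = free_hom (\<lambda>k. if k > 0 then prescribed a (nat k - 1) else id)"
  have f: "(if k > 0 then prescribed a (nat k - 1) else id) \<in> G" for k :: int
    using prescribed_in[OF G a] subgroup_id[OF G] by simp
  have h: "h \<in> Hom d G" unfolding h_def by (rule free_hom_in_Hom[OF G f])
  \<comment> \<open>All positive generators are treated together, since the step from n to n + 1
    uses the next generator.\<close>
  have "phi_pullback n h (gen (int i + 1)) = prescribed (\<lambda>r. a (n + r)) i" for n i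
  proof (induction n arbitrary: i)
    case 0
    have "phi_pullback 0 h (gen (int i + 1)) = h (gen (int i + 1))"
      using gen_in_Gam by (simp add: phi_pullback_def)
    also have "\<dots> = prescribed a i"
      unfolding h_def by (subst free_hom_in_Hom(2)[OF G f]) (simp add: nat_add_distrib)
    finally show ?case by simp
  next
    case (Suc n)
    have "phi_pullback (Suc n) h (gen (int i + 1)) = phi_pullback n h (gen 1) \<circ> phi_pullback n h (gen (int (Suc i) + 1))"
      using phi_pullback_gen(1)[OF G h, of "int i + 1" n] by (simp add: algebra_simps)
    also have "\<dots> = a n \<circ> (inv' (a n) \<circ> prescribed (\<lambda>r. a (Suc n + r)) i)"
    proof -
      have "phi_pullback n h (gen 1) = a n" using Suc[of 0] by simp
      moreover have "phi_pullback n h (gen (int (Suc i) + 1)) = inv' (a n) \<circ> prescribed (\<lambda>r. a (Suc n + r)) i"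
        using Suc[of "Suc i"] by (simp only: prescribed.simps add_0_right add_Suc_right add_Suc)
      ultimately show ?thesis by (simp only:)
    qed
    also have "\<dots> = prescribed (\<lambda>r. a (Suc n + r)) i"
      by (simp add: o_assoc permutes_inv_o(1)[OF subgroup_perm[OF G a]])
    finally show ?case .
  qed
  from this[of _ 0] have "phi_pullback n h (gen 1) = a n" for n by simp
  then show ?thesis using h by blast
qed

section \<open>Topology of the space of covers\<close>

lemma topspace_Hom: "topspace (Hom_topology d G) = Hom d G"
  by (auto simp: Hom_topology_def Hom_def hom_def extensional_def PiE_def Pi_iff)

lemma openin_Hom_gen: "openin (Hom_topology d G) {h \<in> Hom d G. h (gen k) \<in> A}"
proof -
  have "continuous_map (Hom_topology d G) (discrete_topology G) (\<lambda>h. h (gen k))"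
    unfolding Hom_topology_def
    by (intro continuous_map_from_subtopology continuous_map_product_projection gen_in_Gam)
  from openin_continuous_map_preimage[OF this, of "A \<inter> G"]
  have "openin (Hom_topology d G) {h \<in> Hom d G. h (gen k) \<in> A \<inter> G}" by (simp add: topspace_Hom)
  moreover have "{h \<in> Hom d G. h (gen k) \<in> A \<inter> G} = {h \<in> Hom d G. h (gen k) \<in> A}"
    using Hom_in gen_in_Gam by blast
  ultimately show ?thesis by simp
qed

definition conj_by :: "(nat \<Rightarrow> nat) \<Rightarrow> (nat \<Rightarrow> nat) \<Rightarrow> nat \<Rightarrow> nat" where
  "conj_by p q = p \<circ> q \<circ> inv' p"

lemma cover_class_iff:
  "h' \<in> cover_class d G h \<longleftrightarrow>
     h' \<in> Hom d G \<and> (\<exists>p. p permutes {1..d} \<and> (\<forall>g\<in>carrier Gam. h' g = conj_by p (h g)))"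
  unfolding cover_class_def conj_by_def
  by (auto simp: sym_group_mult sym_group_carrier)

lemma conj_by_comp: "p permutes {1..d} \<Longrightarrow> q permutes {1..d} \<Longrightarrow> conj_by p (conj_by q r) = conj_by (p \<circ> q) r"
  by (simp add: conj_by_def o_inv_distrib permutes_bij o_assoc)

lemma conj_by_mult: "p permutes {1..d} \<Longrightarrow> conj_by p (q \<circ> r) = conj_by p q \<circ> conj_by p r"
proof -
  assume p: "p permutes {1..d}"
  have "conj_by p q \<circ> conj_by p r = p \<circ> q \<circ> (inv' p \<circ> p) \<circ> r \<circ> inv' p" by (simp add: conj_by_def o_assoc)
  then show ?thesis by (simp add: conj_by_def permutes_inv_o(2)[OF p] o_assoc)
qed

lemma cover_class_conj:
  assumes p: "p permutes {1..d}" and h': "\<And>g. g \<in> carrier Gam \<Longrightarrow> h' g = conj_by p (h g)"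
  shows "cover_class d G h' = cover_class d G h"
proof -
  have ip: "inv' p permutes {1..d}" by (rule permutes_inv[OF p])
  have h_back: "h g = conj_by (inv' p) (h' g)" if "g \<in> carrier Gam" for g
    using conj_by_comp[OF ip p, of "h g"] that
    by (simp add: h' permutes_inv_o(2)[OF p]) (simp add: conj_by_def)
  have "(\<exists>q. q permutes {1..d} \<and> (\<forall>g\<in>carrier Gam. x g = conj_by q (h' g))) \<longleftrightarrow>
      (\<exists>q. q permutes {1..d} \<and> (\<forall>g\<in>carrier Gam. x g = conj_by q (h g)))" for x
  proof
    assume "\<exists>q. q permutes {1..d} \<and> (\<forall>g\<in>carrier Gam. x g = conj_by q (h' g))"
    then obtain q where "q permutes {1..d}" "\<forall>g\<in>carrier Gam. x g = conj_by q (h' g)" by blast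
    then show "\<exists>q. q permutes {1..d} \<and> (\<forall>g\<in>carrier Gam. x g = conj_by q (h g))"
      using h' conj_by_comp[OF _ p] permutes_compose[OF p] by (intro exI[of _ "q \<circ> p"]) simp
  next
    assume "\<exists>q. q permutes {1..d} \<and> (\<forall>g\<in>carrier Gam. x g = conj_by q (h g))"
    then obtain q where "q permutes {1..d}" "\<forall>g\<in>carrier Gam. x g = conj_by q (h g)" by blast
    then show "\<exists>q. q permutes {1..d} \<and> (\<forall>g\<in>carrier Gam. x g = conj_by q (h' g))"
      using h_back conj_by_comp[OF _ ip] permutes_compose[OF ip] by (intro exI[of _ "q \<circ> inv' p"]) simp
  qed
  then show ?thesis by (intro subset_antisym subsetI) (simp_all add: cover_class_iff)
qed

lemma cover_class_self: "h \<in> Hom d G \<Longrightarrow> h \<in> cover_class d G h"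
  unfolding cover_class_iff by (auto simp: conj_by_def intro!: exI[of _ id] permutes_id)

text \<open>If c is outside the collection, then for each permutation p and each H some generator
  shows that the conjugate by p of a representative leaves H. There are finitely many pairs (p, H),
  so generators up to some N suffice, and agreement with a conjugate on these defines a
  neighbourhood of c that the sequence eventually avoids.\<close>

lemma accumulation_in_subgroups:
  assumes G: "subgroup G (sym_group d)" and HH: "finite HH"
    and subgroups: "\<And>H. H \<in> HH \<Longrightarrow> subgroup H (sym_group d) \<and> H \<subseteq> G"
    and x: "\<And>n. x n \<in> Hom d G"
    and window: "\<And>N. \<exists>n0. \<forall>n\<ge>n0. \<exists>H\<in>HH. \<forall>k. \<bar>k\<bar> \<le> int N \<longrightarrow> x n (gen k) \<in> H"
    and accum: "accumulation_point (cover_space d G) (\<lambda>n. cover_class d G (x n)) c"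
  shows "c \<in> cover_class d G ` (\<Union>H\<in>HH. Hom d H)"
proof (rule ccontr)
  assume c: "c \<notin> cover_class d G ` (\<Union>H\<in>HH. Hom d H)"
  obtain h0 where h0: "h0 \<in> Hom d G" "c = cover_class d G h0"
    using accum by (auto simp: accumulation_point_def cover_space_def topspace_quotient_topology topspace_Hom)
  let ?P = "{p. p permutes {1..d}}"
  have "\<exists>k. conj_by p (h0 (gen k)) \<notin> H" if p: "p \<in> ?P" and H: "H \<in> HH" for p H
  proof (rule ccontr)
    assume "\<not> (\<exists>k. conj_by p (h0 (gen k)) \<notin> H)"
    then have gens: "conj_by p (h0 (gen k)) \<in> H" for k by blast
    define h' where "h' = restrict (\<lambda>g. conj_by p (h0 g)) (carrier Gam)"
    \<comment> \<open>Conjugation by p need not preserve G, so the conjugate is first taken into the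
      full symmetric group.\<close>
    let ?S = "carrier (sym_group d)"
    have S: "subgroup ?S (sym_group d)" by (rule group.subgroup_self[OF sym_group_is_group])
    have p': "p permutes {1..d}" using p by simp
    have cp: "conj_by p q permutes {1..d}" if "q permutes {1..d}" for q
      unfolding conj_by_def using that p' permutes_inv[OF p'] by (intro permutes_compose)
    have "h' \<in> hom Gam (sym_group d\<lparr>carrier := ?S\<rparr>)"
    proof (rule homI)
      fix u assume "u \<in> carrier Gam"
      then show "h' u \<in> carrier (sym_group d\<lparr>carrier := ?S\<rparr>)"
        using cp subgroup_perm[OF G Hom_in[OF h0(1)]] by (simp add: h'_def sym_group_carrier)
    next
      fix u v assume "u \<in> carrier Gam" "v \<in> carrier Gam"
      then show "h' (u \<otimes>\<^bsub>Gam\<^esub> v) = h' u \<otimes>\<^bsub>sym_group d\<lparr>carrier := ?S\<rparr>\<^esub> h' v"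
        using monoid.m_closed[OF group.is_monoid[OF group_Gam]] Hom_mult[OF h0(1)] conj_by_mult[OF p']
        by (simp add: h'_def sym_group_mult)
    qed
    then have "h' \<in> Hom d ?S" by (simp add: Hom_def h'_def)
    then have "h' \<in> Hom d H"
    proof (rule Hom_subgroupI[OF S])
      show "subgroup H (sym_group d)" using subgroups[OF H] by simp
      show "h' (gen n) \<in> H" for n using gens[of n] gen_in_Gam[of n] by (simp add: h'_def)
    qed
    moreover have "cover_class d G h' = c"
      unfolding h0(2) by (rule cover_class_conj[OF p']) (simp add: h'_def)
    ultimately show False using c H by blast
  qed
  then obtain K where K: "\<And>p H. p \<in> ?P \<Longrightarrow> H \<in> HH \<Longrightarrow> conj_by p (h0 (gen (K p H))) \<notin> H" by metis
  have finP: "finite ?P" by (rule finite_permutations) simp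
  obtain N :: nat where N: "\<And>p H. p \<in> ?P \<Longrightarrow> H \<in> HH \<Longrightarrow> \<bar>K p H\<bar> \<le> int N"
  proof -
    have "finite ((\<lambda>(p, H). nat \<bar>K p H\<bar>) ` (?P \<times> HH))" using finP HH by simp
    then obtain N where "\<forall>y\<in>(\<lambda>(p, H). nat \<bar>K p H\<bar>) ` (?P \<times> HH). y \<le> N"
      using finite_nat_set_iff_bounded_le by metis
    then have N: "nat \<bar>K p H\<bar> \<le> N" if "p \<in> ?P" "H \<in> HH" for p H using that by simp
    show thesis
    proof (rule that[of N])
      show "\<bar>K p H\<bar> \<le> int N" if "p \<in> ?P" "H \<in> HH" for p H using N[OF that] by linarith
    qed
  qed
  let ?I = "{- int N..int N}"
  \<comment> \<open>Admitting every conjugator p makes V a union of classes, so that its image in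
    the quotient is open.\<close>
  define V where "V = {y \<in> Hom d G. \<exists>p\<in>?P. \<forall>k\<in>?I. y (gen k) = conj_by p (h0 (gen k))}"
  define U where "U = cover_class d G ` V"
  have V_eq: "V = (\<Union>p\<in>?P. \<Inter>k\<in>?I. {y \<in> Hom d G. y (gen k) \<in> {conj_by p (h0 (gen k))}})"
    unfolding V_def by auto
  have "openin (Hom_topology d G) V"
    unfolding V_eq
  proof (rule openin_Union, elim imageE, hypsubst)
    fix p
    show "openin (Hom_topology d G) (\<Inter>k\<in>?I. {y \<in> Hom d G. y (gen k) \<in> {conj_by p (h0 (gen k))}})"
      by (rule openin_INT2[OF _ _ openin_Hom_gen]) auto
  qed
  moreover have sat: "y \<in> V" if y: "y \<in> Hom d G" "cover_class d G y \<in> U" for y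
  proof -
    obtain z where z: "z \<in> V" "cover_class d G y = cover_class d G z" using y(2) by (auto simp: U_def)
    then have "y \<in> cover_class d G z" using cover_class_self[OF y(1)] by simp
    then obtain q where q: "q permutes {1..d}" "\<forall>g\<in>carrier Gam. y g = conj_by q (z g)"
      by (auto simp: cover_class_iff)
    obtain p where p: "p \<in> ?P" "\<forall>k\<in>?I. z (gen k) = conj_by p (h0 (gen k))" using z(1) by (auto simp: V_def)
    have "q \<circ> p \<in> ?P" using permutes_compose p(1) q(1) by simp
    moreover have "\<forall>k\<in>?I. y (gen k) = conj_by (q \<circ> p) (h0 (gen k))"
      using q p gen_in_Gam conj_by_comp[OF q(1)] by simp
    ultimately show ?thesis using y(1) unfolding V_def by blast
  qed
  moreover have "V \<subseteq> Hom d G" by (auto simp: V_def)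
  ultimately have "openin (cover_space d G) U"
    unfolding cover_space_def openin_quotient_topology topspace_Hom
  proof (intro conjI)
    assume "V \<subseteq> Hom d G"
    then show "U \<subseteq> cover_class d G ` Hom d G" by (auto simp: U_def)
    assume o: "openin (Hom_topology d G) V"
    have "{y \<in> Hom d G. cover_class d G y \<in> U} = V"
      using sat \<open>V \<subseteq> Hom d G\<close> by (auto simp: U_def)
    then show "openin (Hom_topology d G) {y \<in> Hom d G. cover_class d G y \<in> U}" using o by simp
  qed
  moreover have "c \<in> U"
  proof -
    have "h0 \<in> V" using h0(1) unfolding V_def by (auto simp: conj_by_def intro!: exI[of _ id] permutes_id)
    then show ?thesis by (simp add: U_def h0(2))
  qed
  ultimately have "infinite {n. cover_class d G (x n) \<in> U}" using accum by (simp add: accumulation_point_def)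
  moreover obtain n0 where n0: "\<forall>n\<ge>n0. \<exists>H\<in>HH. \<forall>k. \<bar>k\<bar> \<le> int N \<longrightarrow> x n (gen k) \<in> H" using window by blast
  have "n < n0" if n: "cover_class d G (x n) \<in> U" for n
  proof (rule ccontr)
    assume "\<not> n < n0"
    then obtain H where H: "H \<in> HH" "\<forall>k. \<bar>k\<bar> \<le> int N \<longrightarrow> x n (gen k) \<in> H" using n0 by (meson not_less)
    obtain p where p: "p \<in> ?P" "\<forall>k\<in>?I. x n (gen k) = conj_by p (h0 (gen k))"
      using sat[OF x n] by (auto simp: V_def)
    have b: "\<bar>K p H\<bar> \<le> int N" by (rule N[OF p(1) H(1)])
    then have "K p H \<in> ?I" by (simp add: abs_le_iff)
    then have "x n (gen (K p H)) \<in> H" "x n (gen (K p H)) = conj_by p (h0 (gen (K p H)))"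
      using H(2) b p(2) by blast+
    then show False using K[OF p(1) H(1)] by simp
  qed
  then have "{n. cover_class d G (x n) \<in> U} \<subseteq> {..<n0}" by blast
  then have "finite {n. cover_class d G (x n) \<in> U}" by (rule finite_subset) simp
  ultimately show False by blast
qed

text \<open>The window has spread 2N + 1, and consecutive squares a^2 and (a + 1)^2 differ by 2a +
  1. The bound on n forces a^2 > N^2, hence a > N.\<close>

lemma squares_far_apart:
  fixes q r N n :: nat
  assumes n: "N\<^sup>2 + N + 2 \<le> n" and q: "n \<le> q\<^sup>2 + N + 1" "q\<^sup>2 \<le> n + N" and r: "n \<le> r\<^sup>2 + N + 1" "r\<^sup>2 \<le> n + N"
  shows "q = r"
proof -
  have *: False if "a < b" "n \<le> a\<^sup>2 + N + 1" "b\<^sup>2 \<le> n + N" for a b :: nat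
  proof -
    have "(Suc a)\<^sup>2 \<le> b\<^sup>2" using that(1) by (intro power_mono) auto
    then have "a\<^sup>2 + 2 * a + 1 \<le> n + N" using that(3) by (simp add: power2_eq_square)
    then have "a \<le> N" using that(2) by linarith
    then have "a\<^sup>2 \<le> N\<^sup>2" by (intro power_mono) auto
    then show False using that(2) n by linarith
  qed
  show ?thesis using *[of q r] *[of r q] q r by (meson linorder_neqE_nat)
qed

theorem theorem23:
  fixes d :: nat and G H1 H2 :: "(nat \<Rightarrow> nat) set"
  assumes "d \<ge> 2"
    and "subgroup G (sym_group d)"
    and "subgroup H1 (sym_group d)" and "H1 \<subseteq> G"
    and "subgroup H2 (sym_group d)" and "H2 \<subseteq> G"
    and "\<not> acts_transitively d H1" and "\<not> acts_transitively d H2"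
    and "acts_transitively d (generate (sym_group d) (H1 \<union> H2))"
  shows "\<exists>h \<in> Hom d G. uniquely_ergodic d h \<and>
    (\<forall>c. accumulation_point (cover_space d G) (\<lambda>n. cover_class d G (phi_pullback n h)) c \<longrightarrow>
         c \<in> cover_class d G ` (Hom d H1 \<union> Hom d H2))"
proof -
  note G = assms(2) and H1 = assms(3) and H2 = assms(5)
  have "finite (carrier (sym_group d))"
    using finite_permutations[of "{1..d}"] by (simp add: sym_group_def)
  then have "finite (H1 \<union> H2)"
    using subgroup.subset[OF H1] subgroup.subset[OF H2] by (meson finite_UnI finite_subset)
  then obtain m :: nat and e where e: "H1 \<union> H2 = e ` {i. i < m}"
    using finite_imp_nat_seg_image_inj_on by metis
  have m: "0 < m" using e subgroup_id[OF H1] by (cases m) auto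
  \<comment> \<open>A periodic enumeration of \<open>H1 \<union> H2\<close>, so that each of its
    elements is placed at infinitely many squares.\<close>
  define s where "s r = e (r mod m)" for r
  have s: "s r \<in> H1 \<union> H2" for r unfolding e s_def using m by simp
  have s_image: "s ` {..<m} = H1 \<union> H2" unfolding e s_def by (intro image_cong) auto
  \<comment> \<open>Squaring is injective on the naturals, so the description denotes the square
    root of n.\<close>
  define a where "a n = (if \<exists>k. n = k\<^sup>2 then s ((THE k. n = k\<^sup>2) mod m) else id)" for n :: nat
  have a_square: "a (k\<^sup>2) = s (k mod m)" for k
  proof -
    have "(THE l. k\<^sup>2 = l\<^sup>2) = k" by (rule the_equality) (auto simp: power2_eq_iff_nonneg)
    then show ?thesis by (auto simp: a_def)
  qed
  have a_id: "a n = id" if "\<And>k. n \<noteq> k\<^sup>2" for n using that by (simp add: a_def)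
  have aG: "a n \<in> G" for n
    using s[of "(THE k. n = k\<^sup>2) mod m"] assms(4,6) subgroup_id[OF G] by (auto simp: a_def)
  obtain h where h: "h \<in> Hom d G" "\<And>n. phi_pullback n h (gen 1) = a n"
    using ex_Hom_prescribed[OF G, of a] aG by blast
  have mon_perm: "phi_pullback n h (gen k) permutes {1..d}" for n k
    using subgroup_perm[OF G Hom_in[OF phi_pullback_in_Hom[OF h(1)] gen_in_Gam]] .
  have h0: "phi_pullback 0 h (gen k) = h (gen k)" for k
    using gen_in_Gam by (simp add: phi_pullback_def)
  have "renormalized_cover d h (\<lambda>n k. phi_pullback n h (gen k)) s m"
  proof
    show "0 < d" using assms(1) by simp
    show "phi_pullback n h (gen i) permutes {1..d}" for n i by (rule mon_perm)
    show "h (gen n) permutes {1..d}" for n using mon_perm[of 0 n] by (simp add: h0)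
    show "phi_pullback n h (gen 1) = id" if "\<And>k. n \<noteq> k\<^sup>2" for n using a_id[OF that] by (simp add: h(2))
    show "s r permutes {1..d}" for r using s[of r] subgroup_perm[OF H1] subgroup_perm[OF H2] by blast
    show "acts_transitively d (generate (sym_group d) (s ` {..<m}))" using assms(9) by (simp add: s_image)
  qed (use m in \<open>simp_all add: h0 mon_perm h(2) a_square phi_pullback_gen(1)[OF G h(1)]\<close>)
  then have "uniquely_ergodic d h" by (rule renormalized_cover.uniquely_ergodic)
  moreover have "c \<in> cover_class d G ` (Hom d H1 \<union> Hom d H2)"
    if acc: "accumulation_point (cover_space d G) (\<lambda>n. cover_class d G (phi_pullback n h)) c" for c
  proof -
    have "c \<in> cover_class d G ` (\<Union>H\<in>{H1, H2}. Hom d H)"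
    proof (rule accumulation_in_subgroups[OF G _ _ _ _ acc])
      show "\<And>H. H \<in> {H1, H2} \<Longrightarrow> subgroup H (sym_group d) \<and> H \<subseteq> G" using assms by blast
      show "\<And>n. phi_pullback n h \<in> Hom d G" by (rule phi_pullback_in_Hom[OF h(1)])
      fix N :: nat
      show "\<exists>n0. \<forall>n\<ge>n0. \<exists>H\<in>{H1, H2}. \<forall>k. \<bar>k\<bar> \<le> int N \<longrightarrow> phi_pullback n h (gen k) \<in> H"
      proof (intro exI allI impI)
        \<comment> \<open>The threshold from which \<open>squares_far_apart\<close> leaves at most
          one square in the window.\<close>
        fix n assume n: "N\<^sup>2 + N + 2 \<le> n"
        have "\<exists>H\<in>{H1, H2}. \<forall>l. n \<le> l + N + 1 \<longrightarrow> l \<le> n + N \<longrightarrow> a l \<in> H"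
        proof (cases "\<exists>q. n \<le> q\<^sup>2 + N + 1 \<and> q\<^sup>2 \<le> n + N")
          case True
          then obtain q where q: "n \<le> q\<^sup>2 + N + 1" "q\<^sup>2 \<le> n + N" by blast
          \<comment> \<open>The single square decides the subgroup; the other values in the window
            are the identity, which lies in both.\<close>
          obtain H where H: "H \<in> {H1, H2}" "s (q mod m) \<in> H" using s[of "q mod m"] by blast
          have "a l \<in> H" if l: "n \<le> l + N + 1" "l \<le> n + N" for l
          proof (cases "\<exists>k. l = k\<^sup>2")
            case True
            then obtain k where k: "l = k\<^sup>2" by blast
            then have "k = q" using squares_far_apart[OF n _ _ q] l by blast
            then show ?thesis using H(2) by (simp add: k a_square)
          next
            case False
            then show ?thesis using a_id[of l] H(1) subgroup_id[OF H1] subgroup_id[OF H2] by auto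
          qed
          then show ?thesis using H(1) by blast
        next
          case False
          then have "a l = id" if "n \<le> l + N + 1" "l \<le> n + N" for l using that by (intro a_id) blast
          then show ?thesis using subgroup_id[OF H1] by auto
        qed
        then obtain H where H: "H \<in> {H1, H2}" "\<And>l. n \<le> l + N + 1 \<Longrightarrow> l \<le> n + N \<Longrightarrow> a l \<in> H" by blast
        have "subgroup H (sym_group d)" using H(1) H1 H2 by blast
        then have "phi_pullback n h (gen k) \<in> H" if "\<bar>k\<bar> \<le> int N" for k
          using H(2) n that by (intro phi_pullback_window[OF G h(1), of H N n k]) (auto simp: h(2))
        then show "\<exists>H\<in>{H1, H2}. \<forall>k. \<bar>k\<bar> \<le> int N \<longrightarrow> phi_pullback n h (gen k) \<in> H" using H(1) by blast
      qed
    qed simp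
    then show ?thesis by (simp add: Un_commute)
  qed
  ultimately show ?thesis using h(1) by blast
qed

end
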